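(* Let $N,M\ge 1$, let $p,q\ge 0$ with $p+q=1$ and $p\neq 0$, and let $\mathcal Y=(Y,\nu)$ be an initial configuration of the $M$-species ASEP with $N$ particles on $\mathbb Z$, where $Y=\{y_1<\cdots<y_N\}\subset\mathbb Z$ and $\nu:\{1,\dots,N\}\to\{1,\dots,M\}$. Then: (a) There is exactly one family $(h_\sigma^\pi)$ of rational functions of $\xi=(\xi_1,\dots,\xi_N)$, indexed by $\sigma\in\mathcal S_N$ and functions $\pi:\{1,\dots,N\}\to\{1,\dots,M\}$, such that $h_e^\pi=\delta_\nu(\pi)$ for all $\pi$ and $$h_{T_i\sigma}^\pi=h_\sigma^\pi+\bigl(1+S(\xi_{\sigma(i)},\xi_{\sigma(i+1)})\bigr)\bigl[\alpha_i(\pi)\,h_\sigma^{T_i\pi}-\beta_i(\pi)\,h_\sigma^\pi\bigr]$$ for all $\sigma\in\mathcal S_N$, all $\pi$, and all $1\le i\le N-1$. (b) With $A_\sigma^\pi(\xi)=h_\sigma^\pi(\xi)\,A_\sigma(\xi)$, for all sufficiently small $r>0$, all $t\ge 0$ and all configurations $\mathcal X=(X,\pi)$ with $X=\{x_1<\cdots<x_N\}$, $$P_{\mathcal Y}(\mathcal X;t)=\sum_{\sigma\in\mathcal S_N}\frac{1}{(2\pi i)^N}\int_{\mathcal C_r^N}A_\sigma^\pi(\xi)\,\prod_{i=1}^N\xi_{\sigma(i)}^{x_i}\,\prod_{i=1}^N\Bigl(\xi_i^{-y_i-1}\,e^{\varepsilon(\xi_i)t}\Bigr)\,d\xi_1\cdots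 d\xi_N .$$ (In the prefactor $(2\pi i)^{-N}$, $\pi$ and $i$ denote the usual constants.)
   Context: Multispecies ASEP: particles occupy distinct sites of $\mathbb Z$, and each particle belongs to a species in $\{1,\dots,M\}$. Each particle, independently of the others, waits a mean-one exponential time and then, with probability $p$, attempts to move one step to the right and, with probability $q=1-p$, attempts to move one step to the left; it then waits again, and so on. If the target site is empty the particle moves there. If a particle of species $s$ attempts to move to a site occupied by a particle of species $s'$, then it is blocked (nothing happens) if $s\le s'$, and the two particles interchange positions if $s>s'$. A configuration with $N$ particles is a pair $\mathcal X=(X,\pi)$ with $X=\{x_1,\dots,x_N\}\subset\mathbb Z$, $x_1<\cdots<x_N$, and $\pi:\{1,\dots,N\}\to\{1,\dots,M\}$; the $i$th particle from the left is at $x_i$ and belongs to species $\pi_i=\pi(i)$. $P_{\mathcal Y}(\mathcal X;t)$ is the probability that the system is in configuration $\mathcal X$ at time $t$ given that it is in configuration $\mathcal Y$ at time $0$. Notation: $\mathcal S_N$ is the group of permutations of $\{1,\dots,N\}$, with identity $e$. For $\sigma\in\mathcal S_N$, $T_i\sigma$ is $\sigma$ with the entries $\sigma(i)$ and $\sigma(i+1)$ interchanged; likewise $T_i\pi$ is $\pi$ with the entries $\pi_i$ and $\pi_{i+1}$ interchanged. $\delta_\nu(\pi)=1$ if $\pi=\nu$ and $0$ otherwise. Put $$S(\xi,\xi')=-\frac{p+q\xi\xi'-\xi}{p+q\xi\xi'-\xi'},\qquad \varepsilon(\xi)=p\,\xi^{-1}+q\,\xi-1,$$ $$\alpha_i(\pi)=\begin{cases}0&\pi_i=\pi_{i+1}\\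 p&\pi_i<\pi_{i+1}\\ q&\pi_i>\pi_{i+1}\end{cases},\qquad \beta_i(\pi)=\begin{cases}0&\pi_i=\pi_{i+1}\\ q&\pi_i<\pi_{i+1}\\ p&\pi_i>\pi_{i+1}.\end{cases}$$ An inversion in $\sigma$ is a pair $(i,j)$ with $i>j$ and $\sigma^{-1}(i)<\sigma^{-1}(j)$, and $$A_\sigma(\xi)=\prod_{\text{inversions }(i,j)\text{ of }\sigma}S(\xi_i,\xi_j).$$ $\mathcal C_r$ is the positively oriented circle of radius $r$ about $0$ in $\mathbb C$; "sufficiently small" includes that all denominators $p+q\xi\xi'-\xi'$ occurring in the $S$-factors are nonzero for $\xi,\xi'$ on and inside $\mathcal C_r$. *)

theory Defs
  imports
    "HOL-Probability.Probability"
    "HOL-Complex_Analysis.Complex_Analysis"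
    "HOL-Combinatorics.Permutations"
    "HOL-Library.Poly_Mapping"
    "HOL-Computational_Algebra.Fraction_Field"
begin

section \<open>The multispecies ASEP\<close>

type_synonym config = "int set \<times> (nat \<Rightarrow> nat)"

definition configurations :: "nat \<Rightarrow> nat \<Rightarrow> config set" where
  "configurations N M = {(X, \<pi>). finite X \<and> card X = N \<and> \<pi> \<in> {1..N} \<rightarrow>\<^sub>E {1..M}}"

text \<open>\<open>site X i\<close> is $x_i$, where $X = \{x_1 < \cdots < x_N\}$ and $1 \le i \le N$.\<close>

definition site :: "int set \<Rightarrow> nat \<Rightarrow> int" where
  "site X i = sorted_list_of_set X ! (i - 1)"

text \<open>
  To let every particle carry its own clock, particles are labelled by $1,\dots,N$ in their initial
  order from the left and keep their label (and their species) forever. The state of the labelled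
  system is the function \<open>pos\<close> sending a label in \<open>{1..N}\<close> to the site of that particle;
  \<open>s\<close> sends a label to its species.
\<close>

definition attempt ::
  "nat \<Rightarrow> (nat \<Rightarrow> nat) \<Rightarrow> nat \<Rightarrow> bool \<Rightarrow> (nat \<Rightarrow> int) \<Rightarrow> (nat \<Rightarrow> int)" where
  "attempt N s i right pos =
     (let target = pos i + (if right then 1 else -1) in
      if target \<notin> pos ` {1..N} then pos(i := target)
      else let j = inv_into {1..N} pos target in
           if s i > s j then pos(i := target, j := pos i) else pos)"

text \<open>
  The sample point \<open>\<omega> (i, k) = (w, right)\<close> says that particle \<open>i\<close> waits the time \<open>w\<close> before
  its \<open>k\<close>-th attempt (\<open>k = 0, 1, \<dots>\<close>), and that this attempt is to the right iff \<open>right\<close>. All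
  waiting times are exponential with mean 1, all directions are to the right with probability
  \<open>p\<close>, and everything is independent.
\<close>

definition clocks :: "nat \<Rightarrow> real \<Rightarrow> (nat \<times> nat \<Rightarrow> real \<times> bool) measure" where
  "clocks N p =
     (\<Pi>\<^sub>M ik \<in> {1..N} \<times> UNIV.
        density lborel (exponential_density 1) \<Otimes>\<^sub>M measure_pmf (bernoulli_pmf p))"

definition ring_time :: "(nat \<times> nat \<Rightarrow> real \<times> bool) \<Rightarrow> nat \<times> nat \<Rightarrow> real" where
  "ring_time \<omega> = (\<lambda>(i, k). \<Sum>j\<le>k. fst (\<omega> (i, j)))"

text \<open>
  The attempts made up to time \<open>t\<close> are carried out in chronological order. Almost surely there are
  finitely many of them and no two happen simultaneously; on the exceptional null set the value
  of the following function is irrelevant.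
\<close>

definition positions ::
  "nat \<Rightarrow> (nat \<Rightarrow> nat) \<Rightarrow> (nat \<Rightarrow> int) \<Rightarrow> real \<Rightarrow> (nat \<times> nat \<Rightarrow> real \<times> bool) \<Rightarrow> (nat \<Rightarrow> int)" where
  "positions N s y t \<omega> =
     fold (\<lambda>(i, k). attempt N s i (snd (\<omega> (i, k))))
       (sorted_key_list_of_set (ring_time \<omega>)
          {(i, k). i \<in> {1..N} \<and> ring_time \<omega> (i, k) \<le> t})
       y"

definition config_of :: "nat \<Rightarrow> (nat \<Rightarrow> nat) \<Rightarrow> (nat \<Rightarrow> int) \<Rightarrow> config" where
  "config_of N s pos =
     (let X = pos ` {1..N} in (X, \<lambda>i\<in>{1..N}. s (inv_into {1..N} pos (site X i))))"

text \<open>\<open>asep_prob N p \<Y> \<X> t\<close> is $P_{\mathcal Y}(\mathcal X; t)$.\<close>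

definition asep_prob :: "nat \<Rightarrow> real \<Rightarrow> config \<Rightarrow> config \<Rightarrow> real \<Rightarrow> real" where
  "asep_prob N p \<Y> \<X> t =
     measure (clocks N p)
       {\<omega> \<in> space (clocks N p).
          config_of N (snd \<Y>) (positions N (snd \<Y>) (site (fst \<Y>)) t \<omega>) = \<X>}"


section \<open>Rational functions in several indeterminates\<close>

text \<open>
  Polynomials have complex coefficients and indeterminates $\xi_0, \xi_1, \dots$; a monomial is the
  finitely supported map of its exponents. Rational functions are the elements of the fraction field.
\<close>

type_synonym mpoly = "(nat \<Rightarrow>\<^sub>0 nat) \<Rightarrow>\<^sub>0 complex"
type_synonym ratfun = "mpoly fract"

definition mpoly_vars :: "mpoly \<Rightarrow> nat set" where
  "mpoly_vars P = (\<Union>m\<in>Poly_Mapping.keys P. Poly_Mapping.keys m)"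

definition mpoly_eval :: "mpoly \<Rightarrow> (nat \<Rightarrow> complex) \<Rightarrow> complex" where
  "mpoly_eval P z =
     (\<Sum>m\<in>Poly_Mapping.keys P.
        Poly_Mapping.lookup P m *
        (\<Prod>i\<in>Poly_Mapping.keys m. z i ^ Poly_Mapping.lookup m i))"

definition ratfuns :: "nat \<Rightarrow> ratfun set" where
  "ratfuns N = {Fract a b |a b. b \<noteq> 0 \<and> mpoly_vars a \<subseteq> {1..N} \<and> mpoly_vars b \<subseteq> {1..N}}"

text \<open>
  The value at \<open>z\<close> is taken from any representation whose denominator does not vanish at \<open>z\<close>; it does
  not depend on the choice, and is unspecified if there is no such representation.
\<close>

definition ratfun_eval :: "ratfun \<Rightarrow> (nat \<Rightarrow> complex) \<Rightarrow> complex" where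
  "ratfun_eval f z =
     (THE v. \<exists>a b. f = Fract a b \<and> mpoly_eval b z \<noteq> 0 \<and> v = mpoly_eval a z / mpoly_eval b z)"

definition rf_const :: "real \<Rightarrow> ratfun" where
  "rf_const c = Fract (Poly_Mapping.single 0 (complex_of_real c)) 1"

definition rf_var :: "nat \<Rightarrow> ratfun" where
  "rf_var i = Fract (Poly_Mapping.single (Poly_Mapping.single i 1) 1) 1"


section \<open>The coefficients\<close>

text \<open>\<open>S_factor p q i j\<close> is $S(\xi_i, \xi_j)$.\<close>

definition S_factor :: "real \<Rightarrow> real \<Rightarrow> nat \<Rightarrow> nat \<Rightarrow> ratfun" where
  "S_factor p q i j =
     - ((rf_const p + rf_const q * rf_var i * rf_var j - rf_var i) /
        (rf_const p + rf_const q * rf_var i * rf_var j - rf_var j))"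

definition \<epsilon> :: "real \<Rightarrow> real \<Rightarrow> complex \<Rightarrow> complex" where
  "\<epsilon> p q \<xi> = p * inverse \<xi> + q * \<xi> - 1"

definition \<alpha> :: "real \<Rightarrow> real \<Rightarrow> nat \<Rightarrow> (nat \<Rightarrow> nat) \<Rightarrow> real" where
  "\<alpha> p q i \<pi> = (if \<pi> i = \<pi> (i + 1) then 0 else if \<pi> i < \<pi> (i + 1) then p else q)"

definition \<beta> :: "real \<Rightarrow> real \<Rightarrow> nat \<Rightarrow> (nat \<Rightarrow> nat) \<Rightarrow> real" where
  "\<beta> p q i \<pi> = (if \<pi> i = \<pi> (i + 1) then 0 else if \<pi> i < \<pi> (i + 1) then q else p)"

definition T :: "nat \<Rightarrow> (nat \<Rightarrow> nat) \<Rightarrow> (nat \<Rightarrow> nat)" where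
  "T i f = f(i := f (i + 1), i + 1 := f i)"

definition inversions :: "nat \<Rightarrow> (nat \<Rightarrow> nat) \<Rightarrow> (nat \<times> nat) set" where
  "inversions N \<sigma> = {(i, j). i \<in> {1..N} \<and> j \<in> {1..N} \<and> i > j \<and> inv \<sigma> i < inv \<sigma> j}"

definition A_coeff :: "real \<Rightarrow> real \<Rightarrow> nat \<Rightarrow> (nat \<Rightarrow> nat) \<Rightarrow> ratfun" where
  "A_coeff p q N \<sigma> = (\<Prod>(i, j)\<in>inversions N \<sigma>. S_factor p q i j)"

text \<open>The extensional function spaces make the uniqueness of the family \<open>h\<close> meaningful.\<close>

definition is_h_family ::
  "nat \<Rightarrow> nat \<Rightarrow> real \<Rightarrow> real \<Rightarrow> (nat \<Rightarrow> nat) \<Rightarrow> ((nat \<Rightarrow> nat) \<Rightarrow> (nat \<Rightarrow> nat) \<Rightarrow> ratfun) \<Rightarrow> bool" where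
  "is_h_family N M p q \<nu> h \<longleftrightarrow>
     h \<in> {\<sigma>. \<sigma> permutes {1..N}} \<rightarrow>\<^sub>E (({1..N} \<rightarrow>\<^sub>E {1..M}) \<rightarrow>\<^sub>E ratfuns N) \<and>
     (\<forall>\<pi> \<in> {1..N} \<rightarrow>\<^sub>E {1..M}. h id \<pi> = (if \<pi> = \<nu> then 1 else 0)) \<and>
     (\<forall>\<sigma> \<pi> i. \<sigma> permutes {1..N} \<longrightarrow> \<pi> \<in> {1..N} \<rightarrow>\<^sub>E {1..M} \<longrightarrow> 1 \<le> i \<longrightarrow> i + 1 \<le> N \<longrightarrow>
        h (T i \<sigma>) \<pi> =
          h \<sigma> \<pi> + (1 + S_factor p q (\<sigma> i) (\<sigma> (i + 1))) *
            (rf_const (\<alpha> p q i \<pi>) * h \<sigma> (T i \<pi>) - rf_const (\<beta> p q i \<pi>) * h \<sigma> \<pi>))"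


section \<open>Integration over a product of circles\<close>

text \<open>
  \<open>torus_integral r n f \<xi>\<close> integrates \<open>f\<close> over $\xi_1, \dots, \xi_n \in \mathcal C_r$ (innermost
  $\xi_1$), all other coordinates being those of \<open>\<xi>\<close>.
\<close>

primrec torus_integral ::
  "real \<Rightarrow> nat \<Rightarrow> ((nat \<Rightarrow> complex) \<Rightarrow> complex) \<Rightarrow> (nat \<Rightarrow> complex) \<Rightarrow> complex" where
  "torus_integral r 0 f \<xi> = f \<xi>"
| "torus_integral r (Suc n) f \<xi> =
     contour_integral (circlepath 0 r) (\<lambda>z. torus_integral r n f (\<xi>(Suc n := z)))"

end

theory Submission
  imports Defs
begin

text \<open>
  Write $B_i$ for the Hecke operator $f \mapsto \alpha_i(\pi) f(T_i\pi) - \beta_i(\pi) f(\pi)$ on functions of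
  the species. The operators $1 + (1 + S) B_i$ solve the Yang--Baxter equation, so $h_\sigma$ can be
  transported along any path of adjacent transpositions; the largest entry is inserted last.

  Both sides of the integral formula are $e^{-Nt}$ times a power series in $t$. On the left the coefficients
  count sequences of attempts: the attempts up to time $t$ form a given sequence of length $n$ with
  probability $e^{-Nt} t^n / n!$ times the probability of its directions. On the right they are constant
  terms $c_n(x, y)$ of $E^n \Psi_x \xi^{-y}$ with $E = \sum (p \xi_i^{-1} + q \xi_i)$. The cocycle property of
  the amplitudes gives a boundary condition in $y$, by which $c_n$ satisfies the same backward
  recursion in $n$, so that only $c_0 = \delta$ remains to be shown.

  Let $K = c_0 - \delta$. On small contours all amplitudes are holomorphic, so the term of $\sigma$
  vanishes unless $x_i \le y_{\sigma(i)}$ for all $i$. By the boundary conditions in $x$ and in $y$, $K$ commutes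
  with the generator. Choose $K(x, y) \ne 0$ with $\sum (y_i - x_i)$ minimal and then $\sum (m - i) (y_i - x_i)$
  maximal. In the commutation relation at $(x + e_m, y)$ all terms but two vanish and
  $K(x, y) = K(x + e_m, y + e_m)$ follows. Hence $x_m$ and $y_m$ can be moved far to the right, where only
  the $\sigma$ with $\sigma(m) = m$ contribute, and induction on $m$ gives $K = 0$.
\<close>

section \<open>The Hecke action on species and the Yang--Baxter equation\<close>

text \<open>The averages over sequences of attempts split off the first attempt, so their recursion
  moves the initial data y, \<nu> and keeps the target fixed. The defining recursion of the
  coefficients, however, multiplies \<sigma> on the right and acts on the target species \<pi>, so
  only the condition in x is immediate. The condition in y needs multiplication on the left. It
  couples \<nu> with T_k \<nu> through the transposed Hecke operator, so the families of all initial
  species are treated together, and it holds only after integration, where \<xi>_k and \<xi>_(k+1)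
  may be exchanged.

  For the initial condition no residue is computed and no explicit cancellation among permutations
  is exhibited. What replaces this is that K is supported where x_i <= y_i for all i, so both
  extremal choices exist; the two surviving terms carry the same factor p, and p > 0 turns their
  equality into invariance under translation of the last pair. The contours also come from p > 0:
  for |\<xi>|, |\<xi>'| < p/4 one has |\<xi>' - q \<xi> \<xi>'| < p/2, so no denominator
  vanishes.\<close>

lemma T_apply [simp]: "T i f i = f (Suc i)" "T i f (Suc i) = f i"
  "j \<noteq> i \<Longrightarrow> j \<noteq> Suc i \<Longrightarrow> T i f j = f j"
  by (auto simp: T_def)

lemma T_T [simp]: "T i (T i f) = f"
  by (auto simp: T_def fun_eq_iff)

lemma T_far: "Suc i < j \<Longrightarrow> T i (T j f) = T j (T i f)"
  by (auto simp: T_def fun_eq_iff)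

lemma T_braid: "T i (T (Suc i) (T i f)) = T (Suc i) (T i (T (Suc i) f))"
  by (auto simp: T_def fun_eq_iff)

lemma T_triv: "f i = f (Suc i) \<Longrightarrow> T i f = f"
  by (auto simp: T_def fun_eq_iff)

lemma T_eq_comp: "T i f = f \<circ> Transposition.transpose i (Suc i)"
  by (auto simp: T_def fun_eq_iff transpose_def)

lemma T_permutes: "\<sigma> permutes {1..m} \<Longrightarrow> 1 \<le> i \<Longrightarrow> i < m \<Longrightarrow> T i \<sigma> permutes {1..m}"
  unfolding T_eq_comp by (intro permutes_compose permutes_swap_id) auto

lemma T_PiE: "f \<in> {1..N} \<rightarrow>\<^sub>E A \<Longrightarrow> 1 \<le> i \<Longrightarrow> i < N \<Longrightarrow> T i f \<in> {1..N} \<rightarrow>\<^sub>E A"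
  by (auto simp: T_def PiE_iff extensional_def)

definition hecke :: "'a \<Rightarrow> 'a \<Rightarrow> nat \<Rightarrow> ((nat \<Rightarrow> nat) \<Rightarrow> 'a::field) \<Rightarrow> (nat \<Rightarrow> nat) \<Rightarrow> 'a" where
  "hecke P Q i f \<pi> = (if \<pi> i = \<pi> (Suc i) then 0 else if \<pi> i < \<pi> (Suc i)
     then P * f (T i \<pi>) - Q * f \<pi> else Q * f (T i \<pi>) - P * f \<pi>)"

definition rmat :: "'a \<Rightarrow> 'a \<Rightarrow> 'a \<Rightarrow> nat \<Rightarrow> ((nat \<Rightarrow> nat) \<Rightarrow> 'a::field) \<Rightarrow> (nat \<Rightarrow> nat) \<Rightarrow> 'a" where
  "rmat P Q u i f = (\<lambda>\<pi>. f \<pi> + u * hecke P Q i f \<pi>)"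

lemma hecke_add: "hecke P Q i (\<lambda>\<pi>. f \<pi> + g \<pi>) = (\<lambda>\<pi>. hecke P Q i f \<pi> + hecke P Q i g \<pi>)"
  by (auto simp: hecke_def fun_eq_iff algebra_simps)

lemma hecke_scale: "hecke P Q i (\<lambda>\<pi>. c * f \<pi>) = (\<lambda>\<pi>. c * hecke P Q i f \<pi>)"
  by (auto simp: hecke_def fun_eq_iff algebra_simps)

text \<open>On the span of \<pi> and T_i \<pi> the operator is a 2x2 matrix with determinant 0 and
  trace -(P + Q) = -1, so the Cayley-Hamilton theorem gives B^2 = -B.\<close>

lemma hecke_square: "P + Q = 1 \<Longrightarrow> hecke P Q i (hecke P Q i f) = (\<lambda>\<pi>. - hecke P Q i f \<pi>)"
proof -
  assume "P + Q = 1"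
  then have Q: "Q = 1 - P" by (simp add: algebra_simps)
  show ?thesis
    unfolding Q by (auto simp: hecke_def fun_eq_iff algebra_simps)
qed

lemma hecke_far:
  assumes "Suc i < j"
  shows "hecke P Q i (hecke P Q j f) = hecke P Q j (hecke P Q i f)"
proof
  fix \<pi>
  have "T i \<pi> j = \<pi> j" "T i \<pi> (Suc j) = \<pi> (Suc j)" "T j \<pi> i = \<pi> i" "T j \<pi> (Suc i) = \<pi> (Suc i)"
    using assms by auto
  then show "hecke P Q i (hecke P Q j f) \<pi> = hecke P Q j (hecke P Q i f) \<pi>"
    unfolding hecke_def T_far[OF assms] by (simp add: algebra_simps)
qed

text \<open>The braid relation of the Hecke algebra in shifted generators: equivalently, the
  operators B_i + P satisfy the ordinary braid relation. Only the relative order of the three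
  entries matters; the facts \<open>t\<close> identify arrangements when two of the entries
  coincide.\<close>

lemma hecke_braid:
  assumes "P + Q = 1"
  shows "hecke P Q i (hecke P Q (Suc i) (hecke P Q i f)) \<pi> - hecke P Q (Suc i) (hecke P Q i (hecke P Q (Suc i) f)) \<pi>
    = P * Q * (hecke P Q i f \<pi> - hecke P Q (Suc i) f \<pi>)"
proof -
  have Q: "Q = 1 - P" using assms by (simp add: algebra_simps)
  have t: "\<pi> i = \<pi> (Suc i) \<Longrightarrow> T i \<pi> = \<pi>" "\<pi> (Suc i) = \<pi> (Suc (Suc i)) \<Longrightarrow> T (Suc i) \<pi> = \<pi>"
    "\<pi> i = \<pi> (Suc (Suc i)) \<Longrightarrow> T (Suc i) (T i \<pi>) = T i \<pi>"
    "\<pi> i = \<pi> (Suc (Suc i)) \<Longrightarrow> T i (T (Suc i) \<pi>) = T (Suc i) \<pi>"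
    by (auto intro!: T_triv)
  consider "\<pi> i < \<pi> (Suc i)" | "\<pi> i = \<pi> (Suc i)" | "\<pi> i > \<pi> (Suc i)" by linarith
  then show ?thesis
  proof cases
    case 1
    consider "\<pi> (Suc i) < \<pi> (Suc (Suc i))" | "\<pi> (Suc i) = \<pi> (Suc (Suc i))"
      | "\<pi> (Suc i) > \<pi> (Suc (Suc i))" "\<pi> i < \<pi> (Suc (Suc i))"
      | "\<pi> (Suc i) > \<pi> (Suc (Suc i))" "\<pi> i = \<pi> (Suc (Suc i))"
      | "\<pi> (Suc i) > \<pi> (Suc (Suc i))" "\<pi> i > \<pi> (Suc (Suc i))" by linarith
    then show ?thesis by cases (use 1 t in \<open>simp_all add: hecke_def T_braid Q algebra_simps\<close>)
  next
    case 2
    consider "\<pi> (Suc i) < \<pi> (Suc (Suc i))" | "\<pi> (Suc i) = \<pi> (Suc (Suc i))"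
      | "\<pi> (Suc i) > \<pi> (Suc (Suc i))" by linarith
    then show ?thesis by cases (use 2 t in \<open>simp_all add: hecke_def T_braid Q algebra_simps\<close>)
  next
    case 3
    consider "\<pi> (Suc i) > \<pi> (Suc (Suc i))" | "\<pi> (Suc i) = \<pi> (Suc (Suc i))"
      | "\<pi> (Suc i) < \<pi> (Suc (Suc i))" "\<pi> i < \<pi> (Suc (Suc i))"
      | "\<pi> (Suc i) < \<pi> (Suc (Suc i))" "\<pi> i = \<pi> (Suc (Suc i))"
      | "\<pi> (Suc i) < \<pi> (Suc (Suc i))" "\<pi> i > \<pi> (Suc (Suc i))" by linarith
    then show ?thesis by cases (use 3 t in \<open>simp_all add: hecke_def T_braid Q algebra_simps\<close>)
  qed
qed

lemma hecke_rmat: "hecke P Q i (rmat P Q u j f) = (\<lambda>\<pi>. hecke P Q i f \<pi> + u * hecke P Q i (hecke P Q j f) \<pi>)"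
  unfolding rmat_def by (simp add: hecke_add hecke_scale)

text \<open>As B^2 = -B, one has (1 + uB)(1 + vB) = 1 + (u + v - uv)B.\<close>

lemma rmat_unitary:
  assumes "P + Q = 1" "u * v = u + v"
  shows "rmat P Q u i (rmat P Q v i f) = f"
proof
  fix \<pi>
  have "rmat P Q u i (rmat P Q v i f) \<pi> = f \<pi> + (v + u - u * v) * hecke P Q i f \<pi>"
    by (subst rmat_def, simp add: hecke_rmat hecke_square[OF assms(1)], simp add: rmat_def algebra_simps)
  then show "rmat P Q u i (rmat P Q v i f) \<pi> = f \<pi>" by (simp add: assms(2))
qed

lemma rmat_far:
  assumes "Suc i < j"
  shows "rmat P Q u i (rmat P Q v j f) = rmat P Q v j (rmat P Q u i f)"
proof
  fix \<pi>
  show "rmat P Q u i (rmat P Q v j f) \<pi> = rmat P Q v j (rmat P Q u i f) \<pi>"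
    unfolding rmat_def hecke_add hecke_scale hecke_far[OF assms] by (simp add: algebra_simps)
qed

text \<open>After expansion the terms with two different operators agree on both sides. The
  difference is a multiple of B_i - B_(i+1): the linear terms together with B_i^2 = -B_i contribute
  u + w - v - uw, and the braid defect of the cubic terms contributes PQuvw.\<close>

lemma rmat_braid:
  assumes PQ: "P + Q = 1" and u: "u + w - v - u * w + P * Q * u * v * w = 0"
  shows "rmat P Q w i (rmat P Q v (Suc i) (rmat P Q u i f)) = rmat P Q u (Suc i) (rmat P Q v i (rmat P Q w (Suc i) f))"
    (is "?L = ?R")
proof
  fix \<pi>
  have L: "?L \<pi> = f \<pi> + (u + w - u * w) * hecke P Q i f \<pi> + v * hecke P Q (Suc i) f \<pi>
      + u * v * hecke P Q (Suc i) (hecke P Q i f) \<pi> + v * w * hecke P Q i (hecke P Q (Suc i) f) \<pi>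
      + u * v * w * hecke P Q i (hecke P Q (Suc i) (hecke P Q i f)) \<pi>"
    by (subst rmat_def, simp add: hecke_rmat hecke_add hecke_scale hecke_square[OF PQ],
        simp add: rmat_def hecke_add hecke_scale, simp add: algebra_simps)
  have R: "?R \<pi> = f \<pi> + (u + w - u * w) * hecke P Q (Suc i) f \<pi> + v * hecke P Q i f \<pi>
      + v * w * hecke P Q i (hecke P Q (Suc i) f) \<pi> + u * v * hecke P Q (Suc i) (hecke P Q i f) \<pi>
      + u * v * w * hecke P Q (Suc i) (hecke P Q i (hecke P Q (Suc i) f)) \<pi>"
    by (subst rmat_def, simp add: hecke_rmat hecke_add hecke_scale hecke_square[OF PQ],
        simp add: rmat_def hecke_add hecke_scale, simp add: algebra_simps)
  have "?L \<pi> - ?R \<pi> = (u + w - v - u * w) * (hecke P Q i f \<pi> - hecke P Q (Suc i) f \<pi>)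
     + u * v * w * (hecke P Q i (hecke P Q (Suc i) (hecke P Q i f)) \<pi> - hecke P Q (Suc i) (hecke P Q i (hecke P Q (Suc i) f)) \<pi>)"
    unfolding L R by (simp add: algebra_simps)
  also have "\<dots> = (u + w - v - u * w + P * Q * u * v * w) * (hecke P Q i f \<pi> - hecke P Q (Suc i) f \<pi>)"
    unfolding hecke_braid[OF PQ] by (simp add: algebra_simps)
  finally show "?L \<pi> = ?R \<pi>" by (simp add: u)
qed

text \<open>Bubble sort: the largest entry is carried to the end by adjacent exchanges, and the rest
  is a permutation of a smaller set. Each exchange is undone by the same \<open>T n\<close>, which
  is an involution.\<close>

lemma perm_T_induct [consumes 1, case_names id T]:
  assumes "\<sigma> permutes {1..m}" "P id"
    "\<And>\<sigma> i. \<sigma> permutes {1..m} \<Longrightarrow> 1 \<le> i \<Longrightarrow> i < m \<Longrightarrow> P \<sigma> \<Longrightarrow> P (T i \<sigma>)"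
  shows "P \<sigma>"
  using assms
proof (induction m arbitrary: \<sigma>)
  case 0
  then show ?case by simp
next
  case (Suc m)
  have *: "P \<sigma>" if "\<sigma> permutes {1..Suc m}" "\<sigma> n = Suc m" "1 \<le> n" "n \<le> Suc m" for n \<sigma>
    using that(4,1,2,3)
  proof (induction n arbitrary: \<sigma> rule: inc_induct)
    case base
    have "\<sigma> permutes {1..m}"
      using base by (intro permutes_superset[OF base(1)]) (auto simp: le_Suc_eq)
    moreover have "P (T i \<tau>)" if "\<tau> permutes {1..m}" "1 \<le> i" "i < m" "P \<tau>" for \<tau> i
      using that by (intro Suc.prems(3)) (auto intro: permutes_subset)
    ultimately show ?case using Suc.IH Suc.prems(2) by blast
  next
    case (step n)
    have perm: "T n \<sigma> permutes {1..Suc m}" by (rule T_permutes) (use step in auto)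
    have "P (T n \<sigma>)" using step by (intro step.IH perm) auto
    from Suc.prems(3)[OF perm _ _ this, of n] show ?case using step by simp
  qed
  have "inv \<sigma> (Suc m) \<in> {1..Suc m}" "\<sigma> (inv \<sigma> (Suc m)) = Suc m"
    using Suc.prems(1) permutes_in_image[OF permutes_inv[OF Suc.prems(1)], of "Suc m"] permutes_inverses(1) by auto
  then show ?case using * Suc.prems(1) by auto
qed

section \<open>Path-independent transport over the symmetric group\<close>

locale yang_baxter =
  fixes P Q :: "'a::field" and u :: "nat \<Rightarrow> nat \<Rightarrow> 'a"
  assumes PQ: "P + Q = 1"
    and unitary: "u a b * u b a = u a b + u b a"
    and ybe: "u a b + u b c - u a c - u a b * u b c + P * Q * u a b * u a c * u b c = 0"
begin

abbreviation R where "R a b i \<equiv> rmat P Q (u a b) i"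

text \<open>\<open>insertion L \<sigma> f k\<close> transports \<open>f\<close> along the path that moves the entry \<open>L\<close>
  from position \<open>L\<close> to position \<open>L - k\<close> through the entries of \<open>\<sigma>\<close>.\<close>

primrec insertion :: "nat \<Rightarrow> (nat \<Rightarrow> nat) \<Rightarrow> ((nat \<Rightarrow> nat) \<Rightarrow> 'a) \<Rightarrow> nat \<Rightarrow> (nat \<Rightarrow> nat) \<Rightarrow> 'a" where
  "insertion L \<sigma> f 0 = f"
| "insertion L \<sigma> f (Suc k) = R (\<sigma> (L - Suc k)) L (L - Suc k) (insertion L \<sigma> f k)"

definition delete :: "nat \<Rightarrow> (nat \<Rightarrow> nat) \<Rightarrow> (nat \<Rightarrow> nat)" where
  "delete L \<sigma> = (\<lambda>i. if i < inv \<sigma> L then \<sigma> i else if i < L then \<sigma> (Suc i) else i)"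

primrec transport :: "((nat \<Rightarrow> nat) \<Rightarrow> 'a) \<Rightarrow> nat \<Rightarrow> (nat \<Rightarrow> nat) \<Rightarrow> (nat \<Rightarrow> nat) \<Rightarrow> 'a" where
  "transport f 0 \<sigma> = f"
| "transport f (Suc m) \<sigma> =
     insertion (Suc m) (delete (Suc m) \<sigma>) (transport f m (delete (Suc m) \<sigma>)) (Suc m - inv \<sigma> (Suc m))"

lemma transport_id: "transport f m id = f"
proof (induction m)
  case (Suc m)
  have "delete (Suc m) id = id" by (auto simp: delete_def fun_eq_iff)
  moreover have "Suc m - inv id (Suc m) = 0" by simp
  ultimately show ?case unfolding transport.simps using Suc by (metis insertion.simps(1))
qed simp

lemma insertion_cong:
  "(\<And>j. L - k \<le> j \<Longrightarrow> j < L \<Longrightarrow> \<sigma> j = \<tau> j) \<Longrightarrow> k \<le> L \<Longrightarrow> insertion L \<sigma> f k = insertion L \<tau> f k"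
proof (induction k)
  case (Suc k)
  then show ?case by simp
qed simp

lemma insertion_far:
  assumes "Suc j < L - k"
  shows "insertion L \<sigma> (R a b j f) k = R a b j (insertion L \<sigma> f k)"
  using assms
proof (induction k)
  case (Suc k)
  then show ?case by (simp add: rmat_far[of j "L - Suc k", symmetric])
qed simp

text \<open>The entry \<open>L\<close> runs past the whole pair, which thereby moves one place to
  the right. While \<open>L\<close> is still to the right of the pair, or already to its left,
  locality suffices; at the crossing the Yang-Baxter equation exchanges the two operations.\<close>

lemma insertion_swap:
  assumes "1 \<le> i" "Suc i < L" "L - k \<le> i"
  shows "insertion L (T i \<sigma>) (R (\<sigma> i) (\<sigma> (Suc i)) i f) k
    = R (\<sigma> i) (\<sigma> (Suc i)) (Suc i) (insertion L \<sigma> f k)"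
  using assms
proof (induction k)
  case (Suc k)
  show ?case
  proof (cases "L - k \<le> i")
    case True
    have "L - Suc k < i" using True Suc.prems by auto
    then have "T i \<sigma> (L - Suc k) = \<sigma> (L - Suc k)" "Suc (L - Suc k) < Suc i" by auto
    then show ?thesis using Suc.IH[OF Suc.prems(1,2) True] by (simp add: rmat_far[of "L - Suc k" "Suc i"])
  next
    case False
    then have i: "L - Suc k = i" using Suc.prems by auto
    have "L - k = Suc i" "k \<noteq> 0" using i Suc.prems False by auto
    then obtain k' where k: "k = Suc k'" and k': "L - Suc k' = Suc i"
      by (cases k) auto
    have i': "L - Suc (Suc k') = i" using i k by simp
    have far: "Suc i < L - k'" using k' by auto
    have *: "insertion L (T i \<sigma>) f k' = insertion L \<sigma> f k'" for f
      by (intro insertion_cong) (use far k' in auto)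
    have "insertion L (T i \<sigma>) (R (\<sigma> i) (\<sigma> (Suc i)) i f) (Suc k)
      = R (\<sigma> (Suc i)) L i (R (\<sigma> i) L (Suc i) (R (\<sigma> i) (\<sigma> (Suc i)) i (insertion L \<sigma> f k')))"
      unfolding k insertion.simps i' k' by (simp add: * insertion_far[OF far])
    also have "\<dots> = R (\<sigma> i) (\<sigma> (Suc i)) (Suc i) (R (\<sigma> i) L i (R (\<sigma> (Suc i)) L (Suc i) (insertion L \<sigma> f k')))"
      by (rule rmat_braid[OF PQ]) (use ybe[of "\<sigma> i" "\<sigma> (Suc i)" L] in \<open>simp add: mult_ac\<close>)
    also have "\<dots> = R (\<sigma> i) (\<sigma> (Suc i)) (Suc i) (insertion L \<sigma> f (Suc k))"
      unfolding k insertion.simps i' k' by simp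
    finally show ?thesis .
  qed
qed auto

lemma delete_permutes:
  assumes "\<sigma> permutes {1..Suc m}"
  shows "delete (Suc m) \<sigma> permutes {1..m}"
proof -
  define n where "n = inv \<sigma> (Suc m)"
  have n: "\<sigma> n = Suc m" "1 \<le> n" "n \<le> Suc m"
    using permutes_in_image[OF permutes_inv[OF assms], of "Suc m"] permutes_inverses(1)[OF assms]
    by (auto simp: n_def)
  have inj: "inj \<sigma>" using assms permutes_inj by blast
  have "inj_on (delete (Suc m) \<sigma>) {1..m}"
  proof (rule inj_onI)
    fix i j assume ij: "i \<in> {1..m}" "j \<in> {1..m}" "delete (Suc m) \<sigma> i = delete (Suc m) \<sigma> j"
    have "delete (Suc m) \<sigma> k = \<sigma> (if k < n then k else Suc k)" if "k \<in> {1..m}" for k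
      using that by (simp add: delete_def n_def)
    then have "\<sigma> (if i < n then i else Suc i) = \<sigma> (if j < n then j else Suc j)"
      using ij by simp
    then have "(if i < n then i else Suc i) = (if j < n then j else Suc j)"
      by (rule injD[OF inj])
    then show "i = j" by (simp split: if_splits)
  qed
  moreover have "delete (Suc m) \<sigma> ` {1..m} \<subseteq> {1..m}"
  proof clarify
    fix i assume i: "i \<in> {1..m}"
    have *: "\<sigma> j \<in> {1..m}" if "j \<in> {1..Suc m}" "j \<noteq> n" for j
    proof -
      have "\<sigma> j \<in> {1..Suc m}" using that permutes_in_image[OF assms, of j] by blast
      moreover have "\<sigma> j \<noteq> Suc m" using that(2) n(1) injD[OF inj, of j n] by metis
      ultimately show ?thesis by simp
    qed
    show "delete (Suc m) \<sigma> i \<in> {1..m}"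
    proof (cases "i < n")
      case True
      then show ?thesis using i *[of i] by (simp add: delete_def n_def)
    next
      case False
      then show ?thesis using i *[of "Suc i"] by (simp add: delete_def n_def)
    qed
  qed
  moreover have "delete (Suc m) \<sigma> i = i" if "i \<notin> {1..m}" for i
    using that n permutes_not_in[OF assms, of i] unfolding delete_def n_def[symmetric] by auto
  moreover from calculation(1,2) have "delete (Suc m) \<sigma> ` {1..m} = {1..m}"
    by (intro endo_inj_surj) auto
  ultimately show ?thesis
    by (intro bij_imp_permutes) (auto simp: bij_betw_def)
qed

text \<open>Four positions of the largest entry \<open>L\<close> relative to the pair: if it moves
  left, one more insertion step is made; if it moves right, the last insertion step is undone by
  unitarity; a pair to the left of \<open>L\<close> commutes with the insertion; a pair to the right
  of \<open>L\<close> sat one place further left before the insertion, and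
  \<open>insertion_swap\<close> applies.\<close>

lemma transport_T:
  assumes "\<sigma> permutes {1..m}" "1 \<le> i" "i < m"
  shows "transport f m (T i \<sigma>) = R (\<sigma> i) (\<sigma> (Suc i)) i (transport f m \<sigma>)"
  using assms
proof (induction m arbitrary: \<sigma> i)
  case (Suc m)
  define L where "L = Suc m"
  define n where "n = inv \<sigma> L"
  have perm: "\<sigma> permutes {1..L}" using Suc.prems by (simp add: L_def)
  have n: "\<sigma> n = L" "1 \<le> n" "n \<le> L"
    using permutes_in_image[OF permutes_inv[OF perm], of L] permutes_inverses(1)[OF perm]
    by (auto simp: n_def L_def)
  have T: "T i \<sigma> permutes {1..L}" by (rule T_permutes[OF perm]) (use Suc.prems L_def in auto)
  have inv: "inv (T i \<sigma>) L = k" if "T i \<sigma> k = L" for k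
    using that T by (metis permutes_inverses(2))
  have i: "1 \<le> i" "i < L" using Suc.prems by (auto simp: L_def)
  have tr: "transport f L \<tau> = insertion L (delete L \<tau>) (transport f m (delete L \<tau>)) (L - inv \<tau> L)" for \<tau>
    by (simp add: L_def)
  have dp: "delete L \<sigma> permutes {1..m}" using delete_permutes perm unfolding L_def by blast
  consider "Suc i = n" | "i = n" | "Suc i < n" | "n < i" by linarith
  then have "transport f L (T i \<sigma>) = R (\<sigma> i) (\<sigma> (Suc i)) i (transport f L \<sigma>)"
  proof cases
    case 1
    have inv': "inv (T i \<sigma>) L = i" using inv[of i] n 1 by simp
    have del: "delete L (T i \<sigma>) = delete L \<sigma>"
      using n 1 unfolding delete_def inv' n_def[symmetric] by (auto simp: fun_eq_iff less_Suc_eq)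
    have k: "L - i = Suc (L - n)" "L - Suc (L - n) = i" "delete L \<sigma> i = \<sigma> i"
      using 1 n i unfolding delete_def n_def[symmetric] by auto
    show ?thesis unfolding tr del inv' n_def[symmetric] k(1) insertion.simps k(2,3)
      using n 1 by simp
  next
    case 2
    have inv': "inv (T i \<sigma>) L = Suc i" using inv[of "Suc i"] n 2 by simp
    have del: "delete L (T i \<sigma>) = delete L \<sigma>"
      using n 2 i unfolding delete_def inv' n_def[symmetric] by (auto simp: fun_eq_iff less_Suc_eq)
    have k: "L - n = Suc (L - Suc i)" "L - Suc (L - Suc i) = i" "delete L \<sigma> i = \<sigma> (Suc i)"
      using 2 n i unfolding delete_def n_def[symmetric] by auto
    show ?thesis unfolding tr del inv' n_def[symmetric] k(1) insertion.simps k(2,3)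
      using n 2 by (simp add: rmat_unitary[OF PQ unitary])
  next
    case 3
    have inv': "inv (T i \<sigma>) L = n" using inv[of n] n 3 by simp
    have del: "delete L (T i \<sigma>) = T i (delete L \<sigma>)"
      using n 3 i unfolding delete_def inv' n_def[symmetric] by (auto simp: fun_eq_iff T_def)
    have d: "delete L \<sigma> i = \<sigma> i" "delete L \<sigma> (Suc i) = \<sigma> (Suc i)"
      using 3 unfolding delete_def n_def[symmetric] by auto
    have m: "i < m" using 3 n L_def by simp
    have "insertion L (T i (delete L \<sigma>)) g (L - n) = insertion L (delete L \<sigma>) g (L - n)" for g
      by (intro insertion_cong) (use 3 n in auto)
    moreover have "Suc i < L - (L - n)" using 3 n by auto
    ultimately show ?thesis
      unfolding tr del inv' n_def[symmetric] Suc.IH[OF dp i(1) m] by (simp add: insertion_far d)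
  next
    case 4
    then obtain j where j: "i = Suc j" "1 \<le> j" "n \<le> j" using n by (cases i) auto
    have inv': "inv (T i \<sigma>) L = n" using inv[of n] n 4 by simp
    have del: "delete L (T i \<sigma>) = T j (delete L \<sigma>)"
      using n 4 i j unfolding delete_def inv' n_def[symmetric] by (auto simp: fun_eq_iff T_def)
    have d: "delete L \<sigma> j = \<sigma> i" "delete L \<sigma> (Suc j) = \<sigma> (Suc i)"
      using j i unfolding delete_def n_def[symmetric] by auto
    have m: "j < m" "Suc j < L" "L - (L - n) \<le> j" using j i n L_def by auto
    show ?thesis
      unfolding tr del inv' n_def[symmetric] Suc.IH[OF dp j(2) m(1)]
      using insertion_swap[OF j(2) m(2,3), of "delete L \<sigma>"] by (simp add: d j(1))
  qed
  then show ?case by (simp add: L_def)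
qed simp

end

section \<open>Evaluation of rational functions\<close>

abbreviation monomial_eval :: "(nat \<Rightarrow>\<^sub>0 nat) \<Rightarrow> (nat \<Rightarrow> complex) \<Rightarrow> complex" where
  "monomial_eval m z \<equiv> (\<Prod>i\<in>Poly_Mapping.keys m. z i ^ Poly_Mapping.lookup m i)"

lemma monomial_eval_superset:
  "finite A \<Longrightarrow> Poly_Mapping.keys m \<subseteq> A \<Longrightarrow> monomial_eval m z = (\<Prod>i\<in>A. z i ^ Poly_Mapping.lookup m i)"
  by (intro prod.mono_neutral_left) (auto simp: in_keys_iff)

lemma monomial_eval_add: "monomial_eval (m + n) z = monomial_eval m z * monomial_eval n z"
proof -
  let ?A = "Poly_Mapping.keys m \<union> Poly_Mapping.keys n"
  have "Poly_Mapping.keys (m + n) \<subseteq> ?A" by (rule keys_add)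
  then have "monomial_eval (m + n) z = (\<Prod>i\<in>?A. z i ^ Poly_Mapping.lookup (m + n) i)"
    by (intro monomial_eval_superset) auto
  then show ?thesis
    by (simp add: monomial_eval_superset[of ?A m] monomial_eval_superset[of ?A n] lookup_add power_add prod.distrib)
qed

lemma mpoly_eval_superset:
  "finite A \<Longrightarrow> Poly_Mapping.keys a \<subseteq> A \<Longrightarrow> mpoly_eval a z = (\<Sum>m\<in>A. Poly_Mapping.lookup a m * monomial_eval m z)"
  unfolding mpoly_eval_def by (intro sum.mono_neutral_left) (auto simp: in_keys_iff)

lemma mpoly_eval_add: "mpoly_eval (a + b) z = mpoly_eval a z + mpoly_eval b z"
proof -
  let ?A = "Poly_Mapping.keys a \<union> Poly_Mapping.keys b"
  have "Poly_Mapping.keys (a + b) \<subseteq> ?A" by (rule keys_add)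
  then show ?thesis
    by (simp add: mpoly_eval_superset[of ?A] lookup_add distrib_right sum.distrib)
qed

lemma mpoly_eval_0 [simp]: "mpoly_eval 0 z = 0"
  by (simp add: mpoly_eval_def)

lemma mpoly_eval_sum: "mpoly_eval (\<Sum>i\<in>A. f i) z = (\<Sum>i\<in>A. mpoly_eval (f i) z)"
  by (induction A rule: infinite_finite_induct) (auto simp: mpoly_eval_add)

lemma mpoly_eval_single [simp]: "mpoly_eval (Poly_Mapping.single m c) z = c * monomial_eval m z"
  by (cases "c = 0") (auto simp: mpoly_eval_def)

lemma mpoly_as_sum: "(a :: mpoly) = (\<Sum>m\<in>Poly_Mapping.keys a. Poly_Mapping.single m (Poly_Mapping.lookup a m))"
  by (rule poly_mapping_eqI) (auto simp: lookup_sum lookup_single when_def in_keys_iff)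

lemma mpoly_eval_mult: "mpoly_eval (a * b) z = mpoly_eval a z * mpoly_eval b z"
proof -
  let ?s = "\<lambda>a m. Poly_Mapping.single m (Poly_Mapping.lookup a m) :: mpoly"
  have "mpoly_eval (a * b) z = mpoly_eval (sum (?s a) (Poly_Mapping.keys a) * sum (?s b) (Poly_Mapping.keys b)) z"
    by (simp flip: mpoly_as_sum)
  also have "\<dots> = mpoly_eval a z * mpoly_eval b z"
    by (simp add: sum_product mult_single mpoly_eval_sum monomial_eval_add, simp add: mpoly_eval_def sum_product mult_ac)
  finally show ?thesis .
qed

lemma mpoly_eval_uminus: "mpoly_eval (- a) z = - mpoly_eval a z"
  using mpoly_eval_add[of a "- a" z] by (simp add: add_eq_0_iff)

lemma mpoly_eval_1 [simp]: "mpoly_eval 1 z = 1"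
  using mpoly_eval_single[of 0 1 z] by simp

definition regular :: "ratfun \<Rightarrow> (nat \<Rightarrow> complex) \<Rightarrow> bool" where
  "regular f z \<longleftrightarrow> (\<exists>a b. f = Fract a b \<and> mpoly_eval b z \<noteq> 0)"

text \<open>Two representations satisfy a * d = c * b as polynomials, and evaluation is
  multiplicative, so both quotients have the same value; this makes the description in
  \<open>ratfun_eval\<close> unique.\<close>

lemma ratfun_eval_Fract:
  assumes "mpoly_eval b z \<noteq> 0"
  shows "ratfun_eval (Fract a b) z = mpoly_eval a z / mpoly_eval b z"
  unfolding ratfun_eval_def
proof (rule the_equality)
  fix v assume "\<exists>c d. Fract a b = Fract c d \<and> mpoly_eval d z \<noteq> 0 \<and> v = mpoly_eval c z / mpoly_eval d z"
  then obtain c d where cd: "Fract a b = Fract c d" "mpoly_eval d z \<noteq> 0" "v = mpoly_eval c z / mpoly_eval d z" by blast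
  have "b \<noteq> 0" "d \<noteq> 0" using assms cd by auto
  then have "a * d = c * b" using cd(1) by (simp add: eq_fract)
  then have "mpoly_eval a z * mpoly_eval d z = mpoly_eval c z * mpoly_eval b z"
    by (simp flip: mpoly_eval_mult)
  then show "v = mpoly_eval a z / mpoly_eval b z" unfolding cd(3) using assms cd(2) by (subst frac_eq_eq) auto
qed (use assms in blast)

lemma regular_Fract: "mpoly_eval b z \<noteq> 0 \<Longrightarrow> regular (Fract a b) z"
  unfolding regular_def by blast

lemma regularE:
  assumes "regular f z"
  obtains a b where "f = Fract a b" "mpoly_eval b z \<noteq> 0" "b \<noteq> 0" "ratfun_eval f z = mpoly_eval a z / mpoly_eval b z"
  using assms ratfun_eval_Fract unfolding regular_def by (metis mpoly_eval_0)

lemma regular_mult: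
  assumes "regular f z" "regular g z"
  shows "regular (f * g) z" "ratfun_eval (f * g) z = ratfun_eval f z * ratfun_eval g z"
  using assms by (auto elim!: regularE simp: regular_Fract mpoly_eval_mult ratfun_eval_Fract)

lemma regular_add:
  assumes "regular f z" "regular g z"
  shows "regular (f + g) z" "ratfun_eval (f + g) z = ratfun_eval f z + ratfun_eval g z"
  using assms
  by (auto elim!: regularE simp: regular_Fract mpoly_eval_mult mpoly_eval_add ratfun_eval_Fract add_frac_eq)

lemma regular_uminus:
  assumes "regular f z"
  shows "regular (- f) z" "ratfun_eval (- f) z = - ratfun_eval f z"
  using assms by (auto elim!: regularE simp: regular_Fract mpoly_eval_uminus ratfun_eval_Fract)

lemma regular_diff:
  assumes "regular f z" "regular g z"
  shows "regular (f - g) z" "ratfun_eval (f - g) z = ratfun_eval f z - ratfun_eval g z"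
  using regular_add[OF assms(1) regular_uminus(1)[OF assms(2)]] regular_uminus(2)[OF assms(2)] by auto

lemma regular_divide:
  assumes "regular f z" "regular g z" "ratfun_eval g z \<noteq> 0"
  shows "regular (f / g) z" "ratfun_eval (f / g) z = ratfun_eval f z / ratfun_eval g z"
  using assms by (auto elim!: regularE simp: regular_Fract mpoly_eval_mult ratfun_eval_Fract)

lemma regular_const [simp]: "regular (rf_const c) z" "ratfun_eval (rf_const c) z = of_real c"
  by (auto simp: rf_const_def regular_Fract ratfun_eval_Fract)

lemma regular_var [simp]: "regular (rf_var i) z" "ratfun_eval (rf_var i) z = z i"
  by (auto simp: rf_var_def regular_Fract ratfun_eval_Fract)

lemma regular_0 [simp]: "regular 0 z" "ratfun_eval 0 z = 0"
  by (auto simp: Zero_fract_def regular_Fract ratfun_eval_Fract)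

lemma regular_1 [simp]: "regular 1 z" "ratfun_eval 1 z = 1"
  by (auto simp: One_fract_def regular_Fract ratfun_eval_Fract)

lemma mpoly_vars_add: "mpoly_vars (a + b) \<subseteq> mpoly_vars a \<union> mpoly_vars b"
  using keys_add[of a b] unfolding mpoly_vars_def by blast

lemma mpoly_vars_mult: "mpoly_vars (a * b) \<subseteq> mpoly_vars a \<union> mpoly_vars b"
proof
  fix i assume "i \<in> mpoly_vars (a * b)"
  then obtain m n where "m \<in> Poly_Mapping.keys a" "n \<in> Poly_Mapping.keys b" "i \<in> Poly_Mapping.keys (m + n)"
    using keys_mult[of a b] unfolding mpoly_vars_def by blast
  then show "i \<in> mpoly_vars a \<union> mpoly_vars b" using keys_add[of m n] unfolding mpoly_vars_def by blast
qed

lemma mpoly_vars_uminus: "mpoly_vars (- a) = mpoly_vars a"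
  by (simp add: mpoly_vars_def in_keys_iff set_eq_iff)

lemma ratfunsE:
  assumes "f \<in> ratfuns N"
  obtains a b where "f = Fract a b" "b \<noteq> 0" "mpoly_vars a \<subseteq> {1..N}" "mpoly_vars b \<subseteq> {1..N}"
  using assms unfolding ratfuns_def by blast

lemma ratfunsI: "b \<noteq> 0 \<Longrightarrow> mpoly_vars a \<subseteq> {1..N} \<Longrightarrow> mpoly_vars b \<subseteq> {1..N} \<Longrightarrow> Fract a b \<in> ratfuns N"
  unfolding ratfuns_def by blast

lemma mpoly_vars_const: "mpoly_vars (Poly_Mapping.single 0 c) = {}"
  by (cases "c = 0") (auto simp: mpoly_vars_def)

lemma mpoly_vars_01: "mpoly_vars 1 = {}" "mpoly_vars 0 = {}"
  using mpoly_vars_const[of 1] mpoly_vars_const[of 0] by simp_all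

lemma ratfuns_mult: "f \<in> ratfuns N \<Longrightarrow> g \<in> ratfuns N \<Longrightarrow> f * g \<in> ratfuns N"
  by (elim ratfunsE) (simp, intro ratfunsI order.trans[OF mpoly_vars_mult], auto)

lemma ratfuns_add: "f \<in> ratfuns N \<Longrightarrow> g \<in> ratfuns N \<Longrightarrow> f + g \<in> ratfuns N"
  by (elim ratfunsE) (simp, intro ratfunsI order.trans[OF mpoly_vars_mult] order.trans[OF mpoly_vars_add] Un_least, auto)

lemma ratfuns_uminus: "f \<in> ratfuns N \<Longrightarrow> - f \<in> ratfuns N"
  by (elim ratfunsE) (simp, intro ratfunsI, auto simp: mpoly_vars_uminus)

lemma ratfuns_diff: "f \<in> ratfuns N \<Longrightarrow> g \<in> ratfuns N \<Longrightarrow> f - g \<in> ratfuns N"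
  using ratfuns_add[of f N "- g"] ratfuns_uminus by simp

lemma ratfuns_const: "rf_const c \<in> ratfuns N"
  unfolding rf_const_def by (intro ratfunsI) (auto simp: mpoly_vars_const mpoly_vars_01)

lemma ratfuns_01: "0 \<in> ratfuns N" "1 \<in> ratfuns N"
  unfolding Zero_fract_def One_fract_def by (intro ratfunsI; simp add: mpoly_vars_01)+

lemma ratfuns_var: "i \<in> {1..N} \<Longrightarrow> rf_var i \<in> ratfuns N"
  unfolding rf_var_def by (intro ratfunsI) (auto simp: mpoly_vars_01, auto simp: mpoly_vars_def)

lemma ratfuns_divide: "f \<in> ratfuns N \<Longrightarrow> g \<in> ratfuns N \<Longrightarrow> f / g \<in> ratfuns N"
proof (cases "g = 0")
  case False
  assume fg: "f \<in> ratfuns N" "g \<in> ratfuns N"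
  obtain a b where f: "f = Fract a b" "b \<noteq> 0" "mpoly_vars a \<subseteq> {1..N}" "mpoly_vars b \<subseteq> {1..N}" using fg(1) by (rule ratfunsE)
  obtain c d where g: "g = Fract c d" "d \<noteq> 0" "mpoly_vars c \<subseteq> {1..N}" "mpoly_vars d \<subseteq> {1..N}" using fg(2) by (rule ratfunsE)
  have "c \<noteq> 0" using False g(1) by (auto simp: fract_collapse)
  then show ?thesis using f g mpoly_vars_mult[of a d] mpoly_vars_mult[of b c]
    by (simp, intro ratfunsI) auto
qed (simp add: ratfuns_01)

section \<open>The S-factors and their Yang-Baxter equation\<close>

abbreviation S_den :: "real \<Rightarrow> real \<Rightarrow> nat \<Rightarrow> nat \<Rightarrow> ratfun" where
  "S_den p q i j \<equiv> rf_const p + rf_const q * rf_var i * rf_var j - rf_var j"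

text \<open>At the origin the denominator takes the value p.\<close>

lemma S_den_nonzero: "p \<noteq> 0 \<Longrightarrow> S_den p q i j \<noteq> 0"
proof
  assume p: "p \<noteq> 0" and "S_den p q i j = 0"
  then have "ratfun_eval (S_den p q i j) (\<lambda>_. 0) = 0" by simp
  moreover have "ratfun_eval (S_den p q i j) (\<lambda>_. 0) = p"
    by (simp add: regular_mult regular_add regular_diff)
  ultimately show False using p by simp
qed

lemma S_factor_alt: "S_factor p q i j = - (S_den p q j i / S_den p q i j)"
  unfolding S_factor_def by (simp add: mult_ac)

lemma S_factor_inverse: "p \<noteq> 0 \<Longrightarrow> S_factor p q i j * S_factor p q j i = 1"
proof -
  have "- (x / y) * - (y / x) = 1" if "x \<noteq> 0" "y \<noteq> 0" for x y :: ratfun using that by simp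
  moreover assume "p \<noteq> 0"
  ultimately show ?thesis unfolding S_factor_alt using S_den_nonzero by blast
qed

lemma rf_const_add: "rf_const a + rf_const b = rf_const (a + b)"
  by (simp add: rf_const_def single_add)

lemma rf_const_01 [simp]: "rf_const 0 = 0" "rf_const 1 = 1"
  by (simp_all add: rf_const_def fract_collapse)

text \<open>The scalar condition of \<open>rmat_braid\<close> for 1 + S(a, b) = (a - b) / (P + Qab -
  b). Cleared of its three denominators it becomes a polynomial identity modulo P + Q = 1.\<close>

lemma ybe_scalar:
  fixes P Q a b c :: "'a::field"
  assumes "P + Q = 1" "P + Q * a * b - b \<noteq> 0" "P + Q * b * c - c \<noteq> 0" "P + Q * a * c - c \<noteq> 0"
  shows "(a - b) / (P + Q * a * b - b) + (b - c) / (P + Q * b * c - c) - (a - c) / (P + Q * a * c - c)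
    - (a - b) / (P + Q * a * b - b) * ((b - c) / (P + Q * b * c - c))
    + P * Q * ((a - b) / (P + Q * a * b - b)) * ((a - c) / (P + Q * a * c - c)) * ((b - c) / (P + Q * b * c - c)) = 0"
proof -
  define D1 D2 D3 where D: "D1 = P + Q * a * b - b" "D2 = P + Q * b * c - c" "D3 = P + Q * a * c - c"
  have nz: "D1 \<noteq> 0" "D2 \<noteq> 0" "D3 \<noteq> 0" using assms by (auto simp: D)
  have Q: "Q = 1 - P" using assms(1) by (simp add: algebra_simps)
  have "(a - b) * D2 * D3 + (b - c) * D1 * D3 - (a - c) * D1 * D2 - (a - b) * (b - c) * D3
    + P * Q * (a - b) * (a - c) * (b - c) = 0"
    unfolding D Q by (simp add: algebra_simps)
  moreover have "x / D1 + y / D2 - z / D3 - x / D1 * (y / D2) + P * Q * (x / D1) * (z / D3) * (y / D2)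
    = (x * D2 * D3 + y * D1 * D3 - z * D1 * D2 - x * y * D3 + P * Q * x * z * y) / (D1 * D2 * D3)" for x y z
    using nz by (simp add: divide_simps) (simp add: algebra_simps)
  ultimately show ?thesis unfolding D[symmetric] by simp
qed

lemma one_plus_S_factor:
  assumes "p \<noteq> 0"
  shows "1 + S_factor p q i j = (rf_var i - rf_var j) / S_den p q i j"
  unfolding S_factor_def using S_den_nonzero[OF assms, of q i j] by (simp add: field_simps)

lemma yang_baxter_S:
  assumes "p + q = 1" "p \<noteq> 0"
  shows "yang_baxter (rf_const p) (rf_const q) (\<lambda>i j. 1 + S_factor p q i j)"
proof
  show PQ: "rf_const p + rf_const q = 1" using assms by (simp add: rf_const_add)
  show "(1 + S_factor p q a b) * (1 + S_factor p q b a) = 1 + S_factor p q a b + (1 + S_factor p q b a)" for a b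
    using S_factor_inverse[OF assms(2), of q a b] by (simp add: algebra_simps)
  show "1 + S_factor p q a b + (1 + S_factor p q b c) - (1 + S_factor p q a c) - (1 + S_factor p q a b) * (1 + S_factor p q b c) +
       rf_const p * rf_const q * (1 + S_factor p q a b) * (1 + S_factor p q a c) * (1 + S_factor p q b c) = 0" for a b c
    unfolding one_plus_S_factor[OF assms(2)]
    using ybe_scalar[OF PQ S_den_nonzero S_den_nonzero S_den_nonzero] assms(2) by blast
qed


text \<open>The exchange alters the relative order of the two values \<sigma>(i) and \<sigma>(i+1)
  only; the fact \<open>tr\<close> expresses this through their positions.\<close>

lemma inversions_T:
  assumes \<sigma>: "\<sigma> permutes {1..N}" and i: "1 \<le> i" "i < N" and less: "\<sigma> i < \<sigma> (Suc i)"
  shows "inversions N (T i \<sigma>) = insert (\<sigma> (Suc i), \<sigma> i) (inversions N \<sigma>)"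
    "(\<sigma> (Suc i), \<sigma> i) \<notin> inversions N \<sigma>"
proof -
  have bij: "bij \<sigma>" using \<sigma> permutes_bij by blast
  have inv: "inv (T i \<sigma>) x = Transposition.transpose i (Suc i) (inv \<sigma> x)" for x
    unfolding T_eq_comp using bij by (subst o_inv_distrib) auto
  have im: "\<sigma> i \<in> {1..N}" "\<sigma> (Suc i) \<in> {1..N}"
    using i by (auto simp only: permutes_in_image[OF \<sigma>]) auto
  have tr: "Transposition.transpose i (Suc i) s < Transposition.transpose i (Suc i) t \<longleftrightarrow>
      s < t \<and> \<not> (s = i \<and> t = Suc i) \<or> s = Suc i \<and> t = i" for s t
    by (auto simp: Transposition.transpose_def)
  have eq: "inv \<sigma> x = k \<longleftrightarrow> x = \<sigma> k" for x k
    using permutes_inverses[OF \<sigma>] by metis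
  show "inversions N (T i \<sigma>) = insert (\<sigma> (Suc i), \<sigma> i) (inversions N \<sigma>)"
    unfolding inversions_def inv tr eq using im less by auto
  show "(\<sigma> (Suc i), \<sigma> i) \<notin> inversions N \<sigma>"
    unfolding inversions_def by (simp add: permutes_inverses(2)[OF \<sigma>])
qed

text \<open>For \<sigma>(i) < \<sigma>(i+1) one inversion is added. The opposite case is the same
  relation for T_i \<sigma>, solved by means of S(a, b) S(b, a) = 1.\<close>

lemma A_coeff_T:
  assumes \<sigma>: "\<sigma> permutes {1..N}" and i: "1 \<le> i" "i < N" and p: "p \<noteq> 0"
  shows "A_coeff p q N (T i \<sigma>) = S_factor p q (\<sigma> (Suc i)) (\<sigma> i) * A_coeff p q N \<sigma>"
proof -
  have fin: "finite (inversions N \<tau>)" for \<tau>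
    by (rule finite_subset[of _ "{1..N} \<times> {1..N}"]) (auto simp: inversions_def)
  have *: "A_coeff p q N (T i \<tau>) = S_factor p q (\<tau> (Suc i)) (\<tau> i) * A_coeff p q N \<tau>"
    if "\<tau> permutes {1..N}" "\<tau> i < \<tau> (Suc i)" for \<tau>
    using inversions_T[OF that(1) i that(2)] fin by (simp add: A_coeff_def)
  have "\<sigma> i \<noteq> \<sigma> (Suc i)" using permutes_inj[OF \<sigma>] by (simp add: inj_eq)
  then consider "\<sigma> i < \<sigma> (Suc i)" | "\<sigma> (Suc i) < \<sigma> i" by linarith
  then show ?thesis
  proof cases
    case 1
    then show ?thesis using * \<sigma> by blast
  next
    case 2
    then have "A_coeff p q N \<sigma> = S_factor p q (\<sigma> i) (\<sigma> (Suc i)) * A_coeff p q N (T i \<sigma>)"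
      using *[OF T_permutes[OF \<sigma> i]] by simp
    then show ?thesis
      using S_factor_inverse[OF p, of q "\<sigma> (Suc i)" "\<sigma> i"] by (simp flip: mult.assoc)
  qed
qed

lemma A_coeff_id: "A_coeff p q N id = 1"
proof -
  have "inversions N id = {}" by (auto simp: inversions_def)
  then show ?thesis by (simp add: A_coeff_def)
qed

lemma hecke_alpha_beta:
  "rf_const (\<alpha> p q i \<pi>) * f (T i \<pi>) - rf_const (\<beta> p q i \<pi>) * f \<pi> = hecke (rf_const p) (rf_const q) i f \<pi>"
  by (simp add: \<alpha>_def \<beta>_def hecke_def)

lemma is_h_family_T:
  assumes "is_h_family N M p q \<nu> h" "\<sigma> permutes {1..N}" "\<pi> \<in> {1..N} \<rightarrow>\<^sub>E {1..M}" "1 \<le> i" "i < N"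
  shows "h (T i \<sigma>) \<pi> = rmat (rf_const p) (rf_const q) (1 + S_factor p q (\<sigma> i) (\<sigma> (Suc i))) i (h \<sigma>) \<pi>"
  using assms unfolding is_h_family_def hecke_alpha_beta rmat_def by simp

lemma is_h_family_id:
  "is_h_family N M p q \<nu> h \<Longrightarrow> \<pi> \<in> {1..N} \<rightarrow>\<^sub>E {1..M} \<Longrightarrow> h id \<pi> = (if \<pi> = \<nu> then 1 else 0)"
  by (simp add: is_h_family_def)

lemma hecke_cong:
  "f \<pi> = g \<pi> \<Longrightarrow> f (T i \<pi>) = g (T i \<pi>) \<Longrightarrow> hecke P Q i f \<pi> = hecke P Q i g \<pi>"
  by (simp add: hecke_def)

text \<open>Adjacent transpositions connect every permutation with the identity, and the extensional
  function spaces fix all values at the remaining arguments.\<close>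

lemma h_family_unique:
  assumes "is_h_family N M p q \<nu> h" "is_h_family N M p q \<nu> g"
  shows "h = g"
proof -
  let ?\<Pi> = "{1..N} \<rightarrow>\<^sub>E {1..M}"
  have hg: "h \<in> {\<sigma>. \<sigma> permutes {1..N}} \<rightarrow>\<^sub>E (?\<Pi> \<rightarrow>\<^sub>E ratfuns N)" "g \<in> {\<sigma>. \<sigma> permutes {1..N}} \<rightarrow>\<^sub>E (?\<Pi> \<rightarrow>\<^sub>E ratfuns N)"
    using conjunct1[OF assms(1)[unfolded is_h_family_def]] conjunct1[OF assms(2)[unfolded is_h_family_def]] .
  have "\<forall>\<pi>\<in>?\<Pi>. h \<sigma> \<pi> = g \<sigma> \<pi>" if "\<sigma> permutes {1..N}" for \<sigma>
    using that
  proof (induction rule: perm_T_induct)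
    case id
    show ?case using is_h_family_id[OF assms(1)] is_h_family_id[OF assms(2)] by metis
  next
    case (T \<sigma> i)
    show ?case
    proof
      fix \<pi> assume \<pi>: "\<pi> \<in> ?\<Pi>"
      have *: "h \<sigma> \<pi> = g \<sigma> \<pi>" "h \<sigma> (T i \<pi>) = g \<sigma> (T i \<pi>)"
        by (rule bspec[OF T(4) \<pi>], rule bspec[OF T(4) T_PiE[OF \<pi> T(2,3)]])
      show "h (T i \<sigma>) \<pi> = g (T i \<sigma>) \<pi>"
        unfolding is_h_family_T[OF assms(1) T(1) \<pi> T(2,3)] is_h_family_T[OF assms(2) T(1) \<pi> T(2,3)] rmat_def
        by (simp only: * hecke_cong[OF *])
    qed
  qed
  then have "h \<sigma> = g \<sigma>" if "\<sigma> \<in> {\<sigma>. \<sigma> permutes {1..N}}" for \<sigma>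
    using that by (intro PiE_ext[OF PiE_mem[OF hg(1) that] PiE_mem[OF hg(2) that]]) simp
  then show ?thesis by (rule PiE_ext[OF hg])
qed

lemma h_family_exists:
  assumes "p + q = 1" "p \<noteq> 0"
  obtains h where "is_h_family N M p q \<nu> h"
proof -
  interpret yang_baxter "rf_const p" "rf_const q" "\<lambda>i j. 1 + S_factor p q i j"
    by (rule yang_baxter_S[OF assms])
  define t where "t = transport (\<lambda>\<pi>. if \<pi> = \<nu> then 1 else 0) N"
  have rat: "t \<sigma> \<pi> \<in> ratfuns N" if "\<sigma> permutes {1..N}" for \<sigma> \<pi>
    using that
  proof (induction arbitrary: \<pi> rule: perm_T_induct)
    case id
    then show ?case unfolding t_def transport_id by (simp add: ratfuns_01)
  next
    case (T \<sigma> i)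
    have "\<sigma> i \<in> {1..N}" "\<sigma> (Suc i) \<in> {1..N}"
      using T(2,3) by (auto simp only: permutes_in_image[OF T(1)]) auto
    then have "S_factor p q (\<sigma> i) (\<sigma> (Suc i)) \<in> ratfuns N"
      unfolding S_factor_def
      by (intro ratfuns_uminus ratfuns_divide ratfuns_diff ratfuns_add ratfuns_mult ratfuns_const ratfuns_var) auto
    then show ?case using T
      unfolding t_def transport_T[OF T(1-3)] rmat_def hecke_def
      by (auto intro!: ratfuns_add ratfuns_diff ratfuns_mult ratfuns_const ratfuns_01)
  qed
  have perm: "T i \<sigma> permutes {1..N}" if "\<sigma> permutes {1..N}" "1 \<le> i" "i + 1 \<le> N" for i \<sigma>
    by (rule T_permutes) (use that in auto)
  have PiE: "T i \<pi> \<in> {1..N} \<rightarrow>\<^sub>E {1..M}" if "\<pi> \<in> {1..N} \<rightarrow>\<^sub>E {1..M}" "1 \<le> i" "i + 1 \<le> N" for i \<pi>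
    by (rule T_PiE) (use that in auto)
  let ?h = "\<lambda>\<sigma>\<in>{\<sigma>. \<sigma> permutes {1..N}}. \<lambda>\<pi>\<in>{1..N} \<rightarrow>\<^sub>E {1..M}. t \<sigma> \<pi>"
  have "is_h_family N M p q \<nu> ?h"
    unfolding is_h_family_def
  proof (intro conjI allI ballI impI)
    fix \<sigma> \<pi> :: "nat \<Rightarrow> nat" and i assume *: "\<sigma> permutes {1..N}" "\<pi> \<in> {1..N} \<rightarrow>\<^sub>E {1..M}" "1 \<le> i" "i + 1 \<le> N"
    have "t (T i \<sigma>) \<pi> = t \<sigma> \<pi> + (1 + S_factor p q (\<sigma> i) (\<sigma> (i + 1))) *
      (rf_const (\<alpha> p q i \<pi>) * t \<sigma> (T i \<pi>) - rf_const (\<beta> p q i \<pi>) * t \<sigma> \<pi>)"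
      unfolding t_def hecke_alpha_beta using * by (subst transport_T) (auto simp: rmat_def)
    then show "?h (T i \<sigma>) \<pi> = ?h \<sigma> \<pi> + (1 + S_factor p q (\<sigma> i) (\<sigma> (i + 1))) *
      (rf_const (\<alpha> p q i \<pi>) * ?h \<sigma> (T i \<pi>) - rf_const (\<beta> p q i \<pi>) * ?h \<sigma> \<pi>)"
      using * perm[OF *(1,3,4)] PiE[OF *(2,3,4)] by simp
  qed (use rat in \<open>auto simp: t_def transport_id permutes_id restrict_apply' id_def[symmetric]\<close>)
  then show ?thesis using that by blast
qed

section \<open>Amplitudes as functions on a small polydisc\<close>

definition S_val :: "real \<Rightarrow> real \<Rightarrow> complex \<Rightarrow> complex \<Rightarrow> complex" where
  "S_val p q x y = - ((p + q * x * y - x) / (p + q * x * y - y))"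

definition polydisc :: "nat \<Rightarrow> real \<Rightarrow> (nat \<Rightarrow> complex) set" where
  "polydisc N R = {z. \<forall>i\<in>{1..N}. cmod (z i) < R}"

text \<open>A zero would give p = |y - qxy| <= 2|y| < p/2. The margin left by the radius p/4 also
  provides a uniform lower bound for the denominators on the torus.\<close>

lemma S_den_val_nonzero:
  assumes "p \<ge> 0" "q \<ge> 0" "p + q = 1" "p \<noteq> 0" "cmod x < p / 4" "cmod y < p / 4"
  shows "complex_of_real p + of_real q * x * y - y \<noteq> 0"
proof
  assume "complex_of_real p + of_real q * x * y - y = 0"
  then have "complex_of_real p = y - of_real q * x * y" by (simp add: algebra_simps)
  then have "p = cmod (y - of_real q * x * y)" using assms by (metis norm_of_real abs_of_nonneg)
  also have "\<dots> \<le> cmod y + q * cmod x * cmod y"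
    using norm_triangle_ineq4[of y "of_real q * x * y"] assms by (simp add: norm_mult)
  also have "\<dots> \<le> cmod y + 1 * 1 * cmod y"
    using assms by (intro add_left_mono mult_right_mono mult_mono) auto
  also have "\<dots> < p" using assms by simp
  finally show False by simp
qed

lemma S_factor_regular:
  assumes "p \<ge> 0" "q \<ge> 0" "p + q = 1" "p \<noteq> 0" "z \<in> polydisc N (p / 4)" "i \<in> {1..N}" "j \<in> {1..N}"
  shows "regular (S_factor p q i j) z" "ratfun_eval (S_factor p q i j) z = S_val p q (z i) (z j)"
proof -
  have "cmod (z i) < p / 4" "cmod (z j) < p / 4" using assms unfolding polydisc_def by blast+
  then have "of_real p + of_real q * z i * z j - z j \<noteq> 0"
    using assms by (intro S_den_val_nonzero) auto
  then show "regular (S_factor p q i j) z" "ratfun_eval (S_factor p q i j) z = S_val p q (z i) (z j)"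
    unfolding S_factor_def S_val_def
    by (simp_all add: regular_uminus regular_divide regular_add regular_mult regular_diff)
qed

lemma hecke_eval:
  assumes "\<And>\<pi>. regular (f \<pi>) z"
  shows "regular (hecke (rf_const p) (rf_const q) i f \<pi>) z"
    "ratfun_eval (hecke (rf_const p) (rf_const q) i f \<pi>) z
      = hecke (of_real p) (of_real q) i (\<lambda>\<pi>. ratfun_eval (f \<pi>) z) \<pi>"
  using assms by (simp_all add: hecke_def regular_mult regular_diff)

definition amplitude :: "real \<Rightarrow> real \<Rightarrow> nat \<Rightarrow> ((nat \<Rightarrow> nat) \<Rightarrow> (nat \<Rightarrow> nat) \<Rightarrow> ratfun) \<Rightarrow>
    (nat \<Rightarrow> nat) \<Rightarrow> (nat \<Rightarrow> nat) \<Rightarrow> (nat \<Rightarrow> complex) \<Rightarrow> complex" where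
  "amplitude p q N h \<sigma> \<pi> z = ratfun_eval (h \<sigma> \<pi> * A_coeff p q N \<sigma>) z"

lemma amplitude_id:
  assumes "is_h_family N M p q \<nu> h" "\<pi> \<in> {1..N} \<rightarrow>\<^sub>E {1..M}"
  shows "amplitude p q N h id \<pi> z = (if \<pi> = \<nu> then 1 else 0)"
  using is_h_family_id[OF assms] by (simp add: amplitude_def A_coeff_id)

text \<open>Passing from h to the amplitude multiplies the recursion by S = S(\<xi>_(\<sigma>(i+1)),
  \<xi>_(\<sigma>(i))), the inverse of the factor S' in the recursion of h. Hence S(1 + S') = 1 + S,
  and only S remains.\<close>

lemma amplitude_T:
  assumes h: "is_h_family N M p q \<nu> h" and pq: "p \<ge> 0" "q \<ge> 0" "p + q = 1" "p \<noteq> 0"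
    and z: "z \<in> polydisc N (p / 4)"
    and \<sigma>: "\<sigma> permutes {1..N}" "\<pi> \<in> {1..N} \<rightarrow>\<^sub>E {1..M}" "1 \<le> i" "i < N"
  shows "amplitude p q N h (T i \<sigma>) \<pi> z =
    S_val p q (z (\<sigma> (Suc i))) (z (\<sigma> i)) * amplitude p q N h \<sigma> \<pi> z +
    (1 + S_val p q (z (\<sigma> (Suc i))) (z (\<sigma> i))) * hecke (of_real p) (of_real q) i (\<lambda>\<pi>. amplitude p q N h \<sigma> \<pi> z) \<pi>"
proof -
  let ?\<Pi> = "{1..N} \<rightarrow>\<^sub>E {1..M}"
  \<comment> \<open>Off the species functions \<open>h \<sigma>\<close> is \<open>undefined\<close>,
    and nothing is known about the regularity of that value. It is replaced by 0, so that
    \<open>hecke\<close> acts on functions all of whose values are regular.\<close>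
  define F where "F \<sigma> \<pi> = (if \<pi> \<in> ?\<Pi> then h \<sigma> \<pi> * A_coeff p q N \<sigma> else 0)" for \<sigma> \<pi>
  have rec: "F (T i \<sigma>) \<pi> = S_factor p q (\<sigma> (Suc i)) (\<sigma> i) * F \<sigma> \<pi> +
      (1 + S_factor p q (\<sigma> (Suc i)) (\<sigma> i)) * hecke (rf_const p) (rf_const q) i (F \<sigma>) \<pi>"
    if "\<sigma> permutes {1..N}" "1 \<le> i" "i < N" "\<pi> \<in> ?\<Pi>" for \<sigma> \<pi> i
  proof -
    have he: "hecke (rf_const p) (rf_const q) i (F \<sigma>) \<pi> = hecke (rf_const p) (rf_const q) i (h \<sigma>) \<pi> * A_coeff p q N \<sigma>"
      using that T_PiE[of \<pi> N "{1..M}" i] by (simp add: hecke_def F_def algebra_simps)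
    define S S' where S: "S = S_factor p q (\<sigma> (Suc i)) (\<sigma> i)" "S' = S_factor p q (\<sigma> i) (\<sigma> (Suc i))"
    have SS: "S * S' = 1" unfolding S by (rule S_factor_inverse[OF pq(4)])
    have "F (T i \<sigma>) \<pi> = (h \<sigma> \<pi> + (1 + S') * hecke (rf_const p) (rf_const q) i (h \<sigma>) \<pi>) * (S * A_coeff p q N \<sigma>)"
      using that is_h_family_T[OF h that(1,4,2,3)] A_coeff_T[OF that(1-3) pq(4)]
      unfolding S by (simp add: F_def rmat_def)
    also have "\<dots> = S * (h \<sigma> \<pi> * A_coeff p q N \<sigma>) + (S + S * S') * (hecke (rf_const p) (rf_const q) i (h \<sigma>) \<pi> * A_coeff p q N \<sigma>)"
      by (simp add: algebra_simps)
    also have "\<dots> = S * F \<sigma> \<pi> + (1 + S) * hecke (rf_const p) (rf_const q) i (F \<sigma>) \<pi>"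
      unfolding SS he using that by (simp add: F_def add.commute)
    finally show ?thesis unfolding S .
  qed
  have S: "regular (S_factor p q (\<sigma> (Suc i)) (\<sigma> i)) z"
      "ratfun_eval (S_factor p q (\<sigma> (Suc i)) (\<sigma> i)) z = S_val p q (z (\<sigma> (Suc i))) (z (\<sigma> i))"
    if "\<sigma> permutes {1..N}" "1 \<le> i" "i < N" for \<sigma> i
  proof -
    have "\<sigma> i \<in> {1..N}" "\<sigma> (Suc i) \<in> {1..N}"
      using that(2,3) by (auto simp only: permutes_in_image[OF that(1)]) auto
    then show "regular (S_factor p q (\<sigma> (Suc i)) (\<sigma> i)) z"
      "ratfun_eval (S_factor p q (\<sigma> (Suc i)) (\<sigma> i)) z = S_val p q (z (\<sigma> (Suc i))) (z (\<sigma> i))"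
      using S_factor_regular[OF pq z] by auto
  qed
  have reg: "regular (F \<sigma> \<pi>) z" if "\<sigma> permutes {1..N}" for \<sigma> \<pi>
    using that
  proof (induction arbitrary: \<pi> rule: perm_T_induct)
    case id
    then show ?case unfolding F_def A_coeff_id using is_h_family_id[OF h, of \<pi>] by (cases "\<pi> = \<nu>") auto
  next
    case (T \<sigma> i)
    show ?case
    proof (cases "\<pi> \<in> ?\<Pi>")
      case True
      show ?thesis unfolding rec[OF T(1-3) True]
        using T S[OF T(1-3)] by (intro regular_add regular_mult regular_1 hecke_eval)
    qed (simp add: F_def)
  qed
  have "ratfun_eval (F (T i \<sigma>) \<pi>) z = S_val p q (z (\<sigma> (Suc i))) (z (\<sigma> i)) * ratfun_eval (F \<sigma> \<pi>) z
    + (1 + S_val p q (z (\<sigma> (Suc i))) (z (\<sigma> i))) * hecke (of_real p) (of_real q) i (\<lambda>\<pi>. ratfun_eval (F \<sigma> \<pi>) z) \<pi>"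
    unfolding rec[OF \<sigma>(1,3,4,2)]
    using S[OF \<sigma>(1,3,4)] reg[OF \<sigma>(1)] hecke_eval[of "F \<sigma>", OF reg[OF \<sigma>(1)]]
    by (simp add: regular_add regular_mult)
  moreover have "hecke (of_real p) (of_real q) i (\<lambda>\<pi>. ratfun_eval (F \<sigma> \<pi>) z) \<pi>
      = hecke (of_real p) (of_real q) i (\<lambda>\<pi>. amplitude p q N h \<sigma> \<pi> z) \<pi>"
    using \<sigma> T_PiE[OF \<sigma>(2-4)] by (intro hecke_cong) (auto simp: F_def amplitude_def)
  ultimately show ?thesis using \<sigma>(2) by (simp add: F_def amplitude_def)
qed

section \<open>Constant terms\<close>

text \<open>The circle is the whole space rather than a set of full measure in the plane, so bounds
  and non-vanishing hold at every point of the product space.\<close>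

definition circle_space :: "real \<Rightarrow> complex measure" where
  "circle_space r = restrict_space borel (sphere 0 r)"

text \<open>For r > 0 this is the normalised arc length d\<xi> / (2 \<pi> i \<xi>); integration
  against it extracts the constant term of a Laurent polynomial.\<close>

definition circle_measure :: "real \<Rightarrow> complex measure" where
  "circle_measure r = distr (restrict_space lborel {0..1}) (circle_space r) (circlepath 0 r)"

lemma space_circle_measure [simp]: "space (circle_measure r) = sphere 0 r"
  by (simp add: circle_measure_def circle_space_def space_restrict_space)

lemma sets_circle_measure [measurable_cong]: "sets (circle_measure r) = sets (circle_space r)"
  by (simp add: circle_measure_def)

lemma circlepath_measurable: "r \<ge> 0 \<Longrightarrow> circlepath 0 r \<in> measurable (restrict_space lborel {0..1}) (circle_space r)"
  unfolding circle_space_def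
  by (intro measurable_restrict_space2 measurable_restrict_space1)
    (auto simp: circlepath norm_mult intro!: borel_measurable_continuous_onI continuous_intros)

lemma prob_space_circle_measure: "r \<ge> 0 \<Longrightarrow> prob_space (circle_measure r)"
  unfolding circle_measure_def
  by (intro prob_space.prob_space_distr circlepath_measurable prob_spaceI)
    (auto simp: space_restrict_space emeasure_restrict_space)

lemma borel_measurable_circle_iff:
  "f \<in> borel_measurable (circle_measure r) \<longleftrightarrow> f \<in> borel_measurable (restrict_space borel (sphere 0 r))"
  unfolding measurable_cong_sets[OF sets_circle_measure refl] circle_space_def ..

lemma id_measurable_circle: "(\<lambda>z. z) \<in> borel_measurable (circle_measure r)"
  unfolding borel_measurable_circle_iff by (intro measurable_restrict_space1) simp

text \<open>The derivative of the parametrisation is 2 \<pi> i times the point reached, which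
  cancels the division by z. The bound on g provides integrability.\<close>

lemma integral_circle_measure:
  fixes g :: "complex \<Rightarrow> complex"
  assumes "r > 0" "g \<in> borel_measurable (circle_measure r)" "\<And>z. cmod z = r \<Longrightarrow> cmod (g z) \<le> B"
  shows "(\<integral>z. g z \<partial>circle_measure r) = contour_integral (circlepath 0 r) (\<lambda>z. g z / z) / (2 * pi * \<i>)"
proof -
  let ?c = "circlepath 0 r"
  have norm: "cmod (?c t) = r" for t using assms(1) by (simp add: circlepath norm_mult)
  have g: "g \<in> borel_measurable (circle_space r)"
    using assms(2) unfolding measurable_cong_sets[OF sets_circle_measure refl] .
  have m: "(\<lambda>t. g (?c t)) \<in> borel_measurable (restrict_space lborel {0..1})"
    using measurable_compose[OF circlepath_measurable g] assms(1) by simp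
  have "set_integrable lborel {0..1} (\<lambda>t. g (?c t))"
    unfolding set_integrable_def
  proof (rule integrableI_bounded_set[where A = "{0..1}" and B = B])
    show "(\<lambda>t. indicator {0..1} t *\<^sub>R g (?c t)) \<in> borel_measurable lborel"
      using m by (subst (asm) borel_measurable_restrict_space_iff) auto
  qed (use assms(3) norm in auto)
  then have "(\<integral>z. g z \<partial>circle_measure r) = integral {0..1} (\<lambda>t. g (?c t))"
    unfolding circle_measure_def
    by (simp add: integral_distr[OF circlepath_measurable g] assms(1) less_imp_le integral_restrict_space
        set_borel_integral_eq_integral(2)[symmetric] set_lebesgue_integral_def)
  moreover have "contour_integral ?c (\<lambda>z. g z / z) = integral {0..1} (\<lambda>t. (2 * pi * \<i>) * g (?c t))"
    unfolding contour_integral_integral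
  proof (rule integral_cong)
    fix t :: real assume "t \<in> {0..1}"
    have "?c t \<noteq> 0" using norm[of t] assms(1) by auto
    moreover have "vector_derivative ?c (at t) = 2 * pi * \<i> * ?c t"
      unfolding vector_derivative_circlepath by (simp add: circlepath)
    ultimately show "g (?c t) / ?c t * vector_derivative ?c (at t) = (2 * pi * \<i>) * g (?c t)" by simp
  qed
  ultimately show ?thesis by simp
qed

text \<open>Mean value property, from Cauchy's formula. Comparing f with g on the circle alone
  allows f to contain integer powers that become holomorphic only after cancellation.\<close>

lemma integral_circle_holomorphic:
  assumes r: "0 < r" "r < R" and g: "g holomorphic_on ball 0 R"
    and eq: "\<And>z. cmod z = r \<Longrightarrow> f z = g z"
  shows "(\<integral>z. f z \<partial>circle_measure r) = g 0"
proof -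
  have cont: "continuous_on (cball 0 r) g" using r by (intro holomorphic_on_imp_continuous_on holomorphic_on_subset[OF g]) auto
  have "compact (g ` sphere 0 r)" by (intro compact_continuous_image continuous_on_subset[OF cont]) auto
  from compact_imp_bounded[OF this] obtain B where "\<forall>x\<in>g ` sphere 0 r. cmod x \<le> B"
    unfolding bounded_iff ..
  then have B: "\<And>z. cmod z = r \<Longrightarrow> cmod (g z) \<le> B" by simp
  have "(\<integral>z. f z \<partial>circle_measure r) = (\<integral>z. g z \<partial>circle_measure r)"
    by (intro Bochner_Integration.integral_cong) (auto simp: eq)
  also have "\<dots> = contour_integral (circlepath 0 r) (\<lambda>z. g z / z) / (2 * pi * \<i>)"
  proof (rule integral_circle_measure[OF r(1) _ B])
    have "g \<in> borel_measurable (restrict_space borel (sphere 0 r))"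
      by (intro borel_measurable_continuous_on_restrict continuous_on_subset[OF cont]) auto
    then show "g \<in> borel_measurable (circle_measure r)"
      unfolding borel_measurable_circle_iff .
  qed
  also have "contour_integral (circlepath 0 r) (\<lambda>z. g z / z) = 2 * pi * \<i> * g 0"
  proof (rule contour_integral_unique)
    have "g holomorphic_on cball 0 r" using r by (intro holomorphic_on_subset[OF g]) auto
    then show "((\<lambda>z. g z / z) has_contour_integral 2 * pi * \<i> * g 0) (circlepath 0 r)"
      using Cauchy_integral_circlepath_simple[of g 0 r 0] r by simp
  qed
  finally show ?thesis by simp
qed

lemma integral_circle_powi:
  assumes r: "0 < r" and k: "k \<noteq> 0" and eq: "\<And>z. cmod z = r \<Longrightarrow> f z = c * z powi k"
  shows "(\<integral>z. f z \<partial>circle_measure r) = 0"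
proof -
  have "(\<integral>z. f z \<partial>circle_measure r) = (\<integral>z. c * z powi k \<partial>circle_measure r)"
    by (intro Bochner_Integration.integral_cong) (auto simp: eq)
  also have "\<dots> = contour_integral (circlepath 0 r) (\<lambda>z. c * z powi k / z) / (2 * pi * \<i>)"
  proof (rule integral_circle_measure[OF r, of _ "cmod c * r powi k"])
    have "(\<lambda>z. c * z powi k) \<in> borel_measurable (restrict_space borel (sphere 0 r))"
      using r by (intro borel_measurable_continuous_on_restrict continuous_intros) auto
    then show "(\<lambda>z. c * z powi k) \<in> borel_measurable (circle_measure r)"
      unfolding borel_measurable_circle_iff .
  qed (simp add: norm_mult norm_power_int)
  also have "contour_integral (circlepath 0 r) (\<lambda>z. c * z powi k / z) = 0"
  proof -
    have "((\<lambda>z. c * z powi k / z) has_contour_integral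
       (c / k * (pathfinish (circlepath 0 r)) powi k - c / k * (pathstart (circlepath 0 r)) powi k)) (circlepath 0 r)"
    proof (rule contour_integral_primitive[of "-{0}" "\<lambda>z. c / k * z powi k"])
      fix z :: complex assume z: "z \<in> -{0}"
      then have "z powi k = z * z powi (k - 1)" by (simp add: power_int_diff)
      then show "((\<lambda>z. c / k * z powi k) has_field_derivative c * z powi k / z) (at z within - {0})"
        using k z by (auto intro!: derivative_eq_intros)
    qed (use r in auto)
    then show ?thesis by (auto dest: contour_integral_unique)
  qed
  finally show ?thesis by simp
qed


section \<open>Constant terms as integrals over the torus\<close>

locale torus =
  fixes N :: nat and r :: real
  assumes r_pos: "r > 0"
begin

definition "TM = PiM {1..N} (\<lambda>_. circle_measure r)"

definition CT :: "((nat \<Rightarrow> complex) \<Rightarrow> complex) \<Rightarrow> complex" where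
  "CT f = (\<integral>x. f x \<partial>TM)"

text \<open>Bounded measurable functions form an algebra of integrable functions; closure rules for
  it replace separate integrability proofs for every sum and product.\<close>

definition nice :: "((nat \<Rightarrow> complex) \<Rightarrow> complex) \<Rightarrow> bool" where
  "nice f \<longleftrightarrow> f \<in> borel_measurable TM \<and> (\<exists>B. \<forall>x\<in>space TM. cmod (f x) \<le> B)"

sublocale circ: product_prob_space "\<lambda>_. circle_measure r" "{1..N}"
  using prob_space_circle_measure r_pos
  by (intro product_prob_space.intro product_sigma_finite.intro product_prob_space_axioms.intro)
    (auto intro: prob_space_imp_sigma_finite)

sublocale TM: prob_space TM
  unfolding TM_def by (rule prob_space_PiM) (use prob_space_circle_measure r_pos in auto)

lemma space_TM: "space TM = {1..N} \<rightarrow>\<^sub>E sphere 0 r"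
  by (simp add: TM_def space_PiM)

lemma norm_TM: "x \<in> space TM \<Longrightarrow> i \<in> {1..N} \<Longrightarrow> cmod (x i) = r"
  unfolding space_TM by (auto dest: PiE_mem)

lemma nice_integrable: "nice f \<Longrightarrow> integrable TM f"
  unfolding nice_def by (auto intro!: TM.integrable_const_bound)

lemma nice_const: "nice (\<lambda>_. c)"
  unfolding nice_def by auto

lemma nice_add: "nice f \<Longrightarrow> nice g \<Longrightarrow> nice (\<lambda>x. f x + g x)"
  unfolding nice_def
proof safe
  fix B C assume "\<forall>x\<in>space TM. cmod (f x) \<le> B" "\<forall>x\<in>space TM. cmod (g x) \<le> C"
  then have "\<forall>x\<in>space TM. cmod (f x + g x) \<le> B + C" by (auto intro: norm_triangle_mono)
  then show "\<exists>B. \<forall>x\<in>space TM. cmod (f x + g x) \<le> B" ..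
qed simp

lemma nice_mult: "nice f \<Longrightarrow> nice g \<Longrightarrow> nice (\<lambda>x. f x * g x)"
  unfolding nice_def
proof safe
  fix B C assume *: "\<forall>x\<in>space TM. cmod (f x) \<le> B" "\<forall>x\<in>space TM. cmod (g x) \<le> C"
  have "\<forall>x\<in>space TM. cmod (f x * g x) \<le> B * C"
    unfolding norm_mult using * by (auto intro!: mult_mono intro: order_trans[OF norm_ge_zero])
  then show "\<exists>B. \<forall>x\<in>space TM. cmod (f x * g x) \<le> B" ..
qed simp

lemma nice_uminus: "nice f \<Longrightarrow> nice (\<lambda>x. - f x)"
  using nice_mult[OF nice_const[of "-1"]] by simp

lemma nice_diff: "nice f \<Longrightarrow> nice g \<Longrightarrow> nice (\<lambda>x. f x - g x)"
  using nice_add[of f "\<lambda>x. - g x"] nice_uminus by simp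

lemma nice_sum: "(\<And>i. i \<in> A \<Longrightarrow> nice (f i)) \<Longrightarrow> nice (\<lambda>x. \<Sum>i\<in>A. f i x)"
  by (induction A rule: infinite_finite_induct) (auto intro: nice_const nice_add)

lemma nice_prod: "(\<And>i. i \<in> A \<Longrightarrow> nice (f i)) \<Longrightarrow> nice (\<lambda>x. \<Prod>i\<in>A. f i x)"
  by (induction A rule: infinite_finite_induct) (auto intro: nice_const nice_mult)

lemma nice_power: "nice f \<Longrightarrow> nice (\<lambda>x. f x ^ n)"
  by (induction n) (auto intro: nice_const nice_mult)

lemma nice_inverse:
  assumes "nice f" "c > 0" "\<And>x. x \<in> space TM \<Longrightarrow> c \<le> cmod (f x)"
  shows "nice (\<lambda>x. inverse (f x))"
  unfolding nice_def
proof
  show "(\<lambda>x. inverse (f x)) \<in> borel_measurable TM" using assms(1) unfolding nice_def by auto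
  have "\<forall>x\<in>space TM. cmod (inverse (f x)) \<le> inverse c"
    using assms by (auto simp: norm_inverse intro!: le_imp_inverse_le)
  then show "\<exists>B. \<forall>x\<in>space TM. cmod (inverse (f x)) \<le> B" ..
qed

lemma nice_coord: "i \<in> {1..N} \<Longrightarrow> nice (\<lambda>x. x i)"
proof -
  assume i: "i \<in> {1..N}"
  have "(\<lambda>x. x i) \<in> measurable TM (circle_measure r)"
    unfolding TM_def using i by (rule measurable_component_singleton)
  from measurable_compose[OF this id_measurable_circle] have "(\<lambda>x. x i) \<in> borel_measurable TM" .
  then show ?thesis unfolding nice_def using i by (auto intro!: exI[of _ r] simp: norm_TM)
qed

lemma nice_inverse_coord: "i \<in> {1..N} \<Longrightarrow> nice (\<lambda>x. inverse (x i))"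
  using r_pos by (intro nice_inverse[OF nice_coord, of _ r]) (auto simp: norm_TM)

lemma nice_powi: "i \<in> {1..N} \<Longrightarrow> nice (\<lambda>x. x i powi k)"
  by (cases k rule: int_cases2)
    (auto simp: power_int_minus power_inverse[symmetric] intro!: nice_power nice_coord nice_inverse_coord)

lemma CT_cong: "(\<And>x. x \<in> space TM \<Longrightarrow> f x = g x) \<Longrightarrow> CT f = CT g"
  unfolding CT_def by (rule Bochner_Integration.integral_cong) auto

lemma CT_add: "nice f \<Longrightarrow> nice g \<Longrightarrow> CT (\<lambda>x. f x + g x) = CT f + CT g"
  unfolding CT_def by (intro Bochner_Integration.integral_add nice_integrable)

lemma CT_diff: "nice f \<Longrightarrow> nice g \<Longrightarrow> CT (\<lambda>x. f x - g x) = CT f - CT g"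
  unfolding CT_def by (intro Bochner_Integration.integral_diff nice_integrable)

lemma CT_mult: "CT (\<lambda>x. c * f x) = c * CT f"
  unfolding CT_def by simp

lemma CT_sum: "(\<And>i. i \<in> A \<Longrightarrow> nice (f i)) \<Longrightarrow> CT (\<lambda>x. \<Sum>i\<in>A. f i x) = (\<Sum>i\<in>A. CT (f i))"
  unfolding CT_def by (intro Bochner_Integration.integral_sum nice_integrable)

lemma CT_const [simp]: "CT (\<lambda>_. c) = c"
  unfolding CT_def by (simp add: TM.prob_space)

lemma measurable_permute:
  assumes "\<sigma> permutes {1..N}"
  shows "(\<lambda>x. \<lambda>i\<in>{1..N}. x (\<sigma> i)) \<in> measurable TM TM"
  unfolding TM_def using permutes_in_image[OF assms]
  by (intro measurable_restrict measurable_component_singleton) auto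

lemma CT_permute:
  assumes \<sigma>: "\<sigma> permutes {1..N}" and f: "nice f"
  shows "CT (\<lambda>x. f (x \<circ> \<sigma>)) = CT f"
proof -
  have "TM = distr TM TM (\<lambda>x. \<lambda>i\<in>{1..N}. x (\<sigma> i))"
    unfolding TM_def
    by (rule distr_PiM_reindex[symmetric])
      (use \<sigma> permutes_inj_on permutes_in_image[OF \<sigma>] prob_space_circle_measure r_pos in auto)
  then have "CT f = (\<integral>x. f x \<partial>distr TM TM (\<lambda>x. \<lambda>i\<in>{1..N}. x (\<sigma> i)))"
    unfolding CT_def by simp
  also have "\<dots> = (\<integral>x. f (\<lambda>i\<in>{1..N}. x (\<sigma> i)) \<partial>TM)"
    using f by (intro integral_distr measurable_permute \<sigma>) (auto simp: nice_def)
  also have "\<dots> = CT (\<lambda>x. f (x \<circ> \<sigma>))"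
    unfolding CT_def
  proof (rule Bochner_Integration.integral_cong[OF refl])
    fix x assume "x \<in> space TM"
    then have "x \<in> extensional {1..N}" by (simp add: space_TM PiE_def)
    then have "(\<lambda>i\<in>{1..N}. x (\<sigma> i)) = x \<circ> \<sigma>"
      using permutes_not_in[OF \<sigma>] by (auto simp: fun_eq_iff restrict_def extensional_def)
    then show "f (\<lambda>i\<in>{1..N}. x (\<sigma> i)) = f (x \<circ> \<sigma>)" by simp
  qed
  finally show ?thesis by simp
qed

lemma CT_eq_0_coord:
  assumes f: "nice f" and j: "j \<in> {1..N}"
    and zero: "\<And>x. x \<in> space TM \<Longrightarrow> (\<integral>z. f (x(j := z)) \<partial>circle_measure r) = 0"
  shows "CT f = 0"
proof -
  let ?I = "{1..N} - {j}"
  have I: "insert j ?I = {1..N}" using j by auto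
  have "CT f = (\<integral>x. (\<integral>z. f (x(j := z)) \<partial>circle_measure r) \<partial>PiM ?I (\<lambda>_. circle_measure r))"
    unfolding CT_def TM_def
    using circ.product_integral_insert[of ?I j f, unfolded I] nice_integrable[OF f, unfolded TM_def] by simp
  also have "\<dots> = (\<integral>x. 0 \<partial>PiM ?I (\<lambda>_. circle_measure r))"
  proof (rule Bochner_Integration.integral_cong[OF refl])
    fix x assume x: "x \<in> space (PiM ?I (\<lambda>_. circle_measure r))"
    \<comment> \<open>The hypothesis \<open>zero\<close> speaks of points of the full torus. The
      value r at coordinate j is an arbitrary filler, overwritten by the inner integration.\<close>
    have "x(j := of_real r) \<in> insert j ?I \<rightarrow>\<^sub>E sphere 0 r"
      using x r_pos by (intro PiE_fun_upd) (auto simp: space_PiM)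
    then have "x(j := of_real r) \<in> space TM" unfolding I space_TM .
    from zero[OF this] show "(\<integral>z. f (x(j := z)) \<partial>circle_measure r) = 0" by simp
  qed
  finally show ?thesis by simp
qed

lemma CT_monomial:
  assumes "k i \<noteq> 0" "i \<in> {1..N}"
  shows "CT (\<lambda>x. c * (\<Prod>i\<in>{1..N}. x i powi k i)) = 0"
proof (rule CT_eq_0_coord[OF _ assms(2)])
  show "nice (\<lambda>x. c * (\<Prod>i\<in>{1..N}. x i powi k i))"
    by (intro nice_mult nice_const nice_prod nice_powi)
  fix x
  show "(\<integral>z. c * (\<Prod>l\<in>{1..N}. (x(i := z)) l powi k l) \<partial>circle_measure r) = 0"
  proof (rule integral_circle_powi[OF r_pos])
    show "k i \<noteq> 0" by fact
    show "c * (\<Prod>l\<in>{1..N}. (x(i := z)) l powi k l) = (c * (\<Prod>l\<in>{1..N} - {i}. x l powi k l)) * z powi k i" for z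
      using assms(2) by (subst prod.remove[of _ i]) (auto intro!: prod.cong)
  qed
qed

end

section \<open>The Bethe amplitudes\<close>

text \<open>The matrix transpose of \<open>hecke\<close>, acting on the initial species. With P + Q
  = 1, adding the identity gives the average over the two attempts across an adjacent pair: the
  species are exchanged with weight Q if \<nu>_i < \<nu>_(i+1) and with weight P if \<nu>_i >
  \<nu>_(i+1).\<close>

definition hecke_transpose :: "'a \<Rightarrow> 'a \<Rightarrow> nat \<Rightarrow> ((nat \<Rightarrow> nat) \<Rightarrow> 'a::field) \<Rightarrow> (nat \<Rightarrow> nat) \<Rightarrow> 'a" where
  "hecke_transpose P Q i g \<nu> = (if \<nu> i = \<nu> (Suc i) then 0 else if \<nu> i < \<nu> (Suc i)
     then Q * g (T i \<nu>) - Q * g \<nu> else P * g (T i \<nu>) - P * g \<nu>)"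

lemma hecke_transpose_square:
  "P + Q = 1 \<Longrightarrow> hecke_transpose P Q i (hecke_transpose P Q i g) \<nu> = - hecke_transpose P Q i g \<nu>"
proof -
  assume "P + Q = 1"
  then have Q: "Q = 1 - P" by (simp add: algebra_simps)
  show ?thesis
    unfolding Q by (auto simp: hecke_transpose_def algebra_simps)
qed

lemma hecke_transpose_add:
  "hecke_transpose P Q i (\<lambda>\<nu>. f \<nu> + g \<nu>) \<nu> = hecke_transpose P Q i f \<nu> + hecke_transpose P Q i g \<nu>"
  by (auto simp: hecke_transpose_def algebra_simps)

lemma hecke_transpose_scale: "hecke_transpose P Q i (\<lambda>\<nu>. c * f \<nu>) \<nu> = c * hecke_transpose P Q i f \<nu>"
  by (auto simp: hecke_transpose_def algebra_simps)

lemma hecke_transpose_sum: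
  "hecke_transpose P Q i (\<lambda>\<nu>. \<Sum>a\<in>A. f a \<nu>) \<nu> = (\<Sum>a\<in>A. hecke_transpose P Q i (f a) \<nu>)"
  by (auto simp: hecke_transpose_def sum_subtractf sum_distrib_left)

lemma hecke_sum: "hecke P Q i (\<lambda>\<pi>. \<Sum>a\<in>A. f a \<pi>) \<pi> = (\<Sum>a\<in>A. hecke P Q i (f a) \<pi>)"
  by (auto simp: hecke_def sum_subtractf sum_distrib_left)

lemma hecke_transpose_cong:
  "f \<nu> = g \<nu> \<Longrightarrow> f (T i \<nu>) = g (T i \<nu>) \<Longrightarrow> hecke_transpose P Q i f \<nu> = hecke_transpose P Q i g \<nu>"
  by (simp add: hecke_transpose_def)

lemma hecke_hecke_transpose:
  "hecke P Q i (\<lambda>\<pi>. hecke_transpose P Q k (\<lambda>\<nu>. f \<nu> \<pi>) \<nu>) \<pi> = hecke_transpose P Q k (\<lambda>\<nu>. hecke P Q i (f \<nu>) \<pi>) \<nu>"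
  by (auto simp: hecke_def hecke_transpose_def algebra_simps)

text \<open>The delta is the identity matrix, so this expresses that the two operators are
  transposes of each other.\<close>

lemma hecke_delta:
  "hecke P Q i (\<lambda>\<pi>. if \<pi> = \<nu> then 1 else 0) \<pi> = hecke_transpose P Q i (\<lambda>\<nu>. if \<pi> = \<nu> then 1 else 0) \<nu>"
proof -
  have "T i \<pi> = \<nu> \<longleftrightarrow> \<pi> = T i \<nu>" by (metis T_T)
  moreover have "T i \<nu> = \<nu> \<longleftrightarrow> \<nu> i = \<nu> (Suc i)" by (metis T_apply(1) T_triv)
  ultimately show ?thesis by (auto simp: hecke_def hecke_transpose_def)
qed

section \<open>The chamber of increasing positions and its walls\<close>

definition incr :: "nat \<Rightarrow> (nat \<Rightarrow> int) \<Rightarrow> bool" where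
  "incr m x \<longleftrightarrow> (\<forall>i\<in>{1..<m}. x i < x (Suc i))"

definition adj :: "nat \<Rightarrow> (nat \<Rightarrow> int) \<Rightarrow> nat set" where
  "adj m x = {k \<in> {1..<m}. x (Suc k) = x k + 1}"

definition up :: "(nat \<Rightarrow> int) \<Rightarrow> nat \<Rightarrow> (nat \<Rightarrow> int)" where "up x i = x(i := x i + 1)"
definition dn :: "(nat \<Rightarrow> int) \<Rightarrow> nat \<Rightarrow> (nat \<Rightarrow> int)" where "dn x i = x(i := x i - 1)"

lemma incr_less: "incr m x \<Longrightarrow> 1 \<le> i \<Longrightarrow> i < j \<Longrightarrow> j \<le> m \<Longrightarrow> x i < x j"
proof (induction j rule: nat_induct)
  case (Suc j)
  then have "x j < x (Suc j)" by (simp add: incr_def)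
  then show ?case using Suc by (cases "i = j") auto
qed simp

lemma incr_le: "incr m x \<Longrightarrow> 1 \<le> i \<Longrightarrow> i \<le> j \<Longrightarrow> j \<le> m \<Longrightarrow> x i \<le> x j"
  using incr_less[of m x i j] by (cases "i = j") auto

lemma incr_dn_iff:
  assumes "incr m x"
  shows "incr m (dn x i) \<longleftrightarrow> i \<notin> Suc ` adj m x"
proof -
  have "dn x i j < dn x i (Suc j) \<longleftrightarrow> \<not> (Suc j = i \<and> x (Suc j) = x j + 1)" if "j \<in> {1..<m}" for j
  proof -
    have "x j < x (Suc j)" using assms that by (simp add: incr_def)
    then show ?thesis by (auto simp: dn_def)
  qed
  then show ?thesis unfolding incr_def[of m "dn x i"] adj_def by (auto simp: image_iff)
qed

lemma incr_up_iff:
  assumes "incr m x"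
  shows "incr m (up x i) \<longleftrightarrow> i \<notin> adj m x"
proof -
  have "up x i j < up x i (Suc j) \<longleftrightarrow> \<not> (j = i \<and> x (Suc j) = x j + 1)" if "j \<in> {1..<m}" for j
  proof -
    have "x j < x (Suc j)" using assms that by (simp add: incr_def)
    then show ?thesis by (auto simp: up_def)
  qed
  then show ?thesis unfolding incr_def[of m "up x i"] adj_def by auto
qed

lemma up_dn [simp]: "dn (up x i) i = x" "up (dn x i) i = x"
  by (auto simp: up_def dn_def)

text \<open>A unit move leaves the chamber only at a wall: for an adjacent pair at k, lowering
  x_(k+1) or raising x_k makes the two coordinates equal, and every other move stays inside.\<close>

lemma sum_free_split:
  fixes F :: "(nat \<Rightarrow> int) \<Rightarrow> 'a::comm_ring_1"
  assumes x: "incr m x"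
  shows "(\<Sum>i\<in>{1..m}. a * F (dn x i) + b * F (up x i)) =
    (\<Sum>i\<in>{1..m}. (if incr m (dn x i) then a * F (dn x i) else 0) + (if incr m (up x i) then b * F (up x i) else 0))
    + (\<Sum>k\<in>adj m x. a * F (dn x (Suc k)) + b * F (up x k))"
proof -
  have adj: "adj m x \<subseteq> {1..m}" "Suc ` adj m x \<subseteq> {1..m}" by (auto simp: adj_def)
  have d: "(\<Sum>i\<in>{1..m}. a * F (dn x i)) =
      (\<Sum>i\<in>{1..m}. if incr m (dn x i) then a * F (dn x i) else 0) + (\<Sum>k\<in>adj m x. a * F (dn x (Suc k)))"
  proof -
    have "(\<Sum>i\<in>{1..m}. a * F (dn x i)) =
      (\<Sum>i\<in>{1..m}. if incr m (dn x i) then a * F (dn x i) else 0)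
      + (\<Sum>i\<in>{1..m}. if i \<in> Suc ` adj m x then a * F (dn x i) else 0)"
      by (subst sum.distrib[symmetric], rule sum.cong) (auto simp: incr_dn_iff[OF x])
    also have "(\<Sum>i\<in>{1..m}. if i \<in> Suc ` adj m x then a * F (dn x i) else 0) = (\<Sum>i\<in>Suc ` adj m x. a * F (dn x i))"
      using adj(2) by (subst sum.inter_restrict[symmetric]) (auto simp: Int_absorb1)
    also have "\<dots> = (\<Sum>k\<in>adj m x. a * F (dn x (Suc k)))"
      by (subst sum.reindex) auto
    finally show ?thesis .
  qed
  have u: "(\<Sum>i\<in>{1..m}. b * F (up x i)) =
      (\<Sum>i\<in>{1..m}. if incr m (up x i) then b * F (up x i) else 0) + (\<Sum>k\<in>adj m x. b * F (up x k))"
  proof -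
    have "(\<Sum>i\<in>{1..m}. b * F (up x i)) =
      (\<Sum>i\<in>{1..m}. if incr m (up x i) then b * F (up x i) else 0)
      + (\<Sum>i\<in>{1..m}. if i \<in> adj m x then b * F (up x i) else 0)"
      by (subst sum.distrib[symmetric], rule sum.cong) (auto simp: incr_up_iff[OF x])
    also have "(\<Sum>i\<in>{1..m}. if i \<in> adj m x then b * F (up x i) else 0) = (\<Sum>i\<in>adj m x. b * F (up x i))"
      using adj(1) by (subst sum.inter_restrict[symmetric]) (auto simp: Int_absorb1)
    finally show ?thesis .
  qed
  show ?thesis by (simp only: sum.distrib d u) (simp only: ac_simps)
qed

lemma prod_split_adjacent:
  assumes "1 \<le> k" "k < N"
  shows "(\<Prod>i\<in>{1..N}. f i) = f k * f (Suc k) * (\<Prod>i\<in>{1..N} - {k, Suc k}. f i :: 'a::comm_monoid_mult)"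
proof -
  have "(\<Prod>i\<in>{1..N}. f i) = f k * (\<Prod>i\<in>{1..N} - {k}. f i)"
    using assms by (intro prod.remove) auto
  also have "(\<Prod>i\<in>{1..N} - {k}. f i) = f (Suc k) * (\<Prod>i\<in>{1..N} - {k} - {Suc k}. f i)"
    using assms by (intro prod.remove) auto
  also have "{1..N} - {k} - {Suc k} = {1..N} - {k, Suc k}" by auto
  finally show ?thesis by (simp add: mult_ac)
qed

abbreviation adjswap :: "nat \<Rightarrow> nat \<Rightarrow> nat" where
  "adjswap k \<equiv> Transposition.transpose k (Suc k)"

lemma adjswap_simps [simp]: "adjswap k k = Suc k" "adjswap k (Suc k) = k"
  "i \<noteq> k \<Longrightarrow> i \<noteq> Suc k \<Longrightarrow> adjswap k i = i"
  by (auto simp: Transposition.transpose_def)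

lemma adjswap_permutes: "1 \<le> k \<Longrightarrow> k < m \<Longrightarrow> adjswap k permutes {1..m}"
  by (rule permutes_swap_id) auto

lemma permutes_le: "\<sigma> permutes {1..m} \<Longrightarrow> m \<le> N \<Longrightarrow> \<sigma> permutes {1..N::nat}"
  by (erule permutes_subset) auto

lemma permutes_range: "\<sigma> permutes {1..N} \<Longrightarrow> 1 \<le> i \<Longrightarrow> i \<le> N \<Longrightarrow> \<sigma> i \<in> {1..N::nat}"
  by (simp only: permutes_in_image) simp

lemma holomorphic_on_if_const:
  "f holomorphic_on A \<Longrightarrow> g holomorphic_on A \<Longrightarrow> (\<lambda>z. if P then f z else g z) holomorphic_on A"
  by (cases P) simp_all

text \<open>The boundary condition in y mixes \<nu> with T_k \<nu>, so \<open>amp\<close> is a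
  family over all initial species. The recursion is demanded only on the polydisc of radius p/4,
  where no denominator vanishes; r < p/4 puts the torus inside it.\<close>

locale bethe = torus N r for N r +
  fixes M :: nat and p q :: real
    and amp :: "(nat \<Rightarrow> nat) \<Rightarrow> (nat \<Rightarrow> nat) \<Rightarrow> (nat \<Rightarrow> nat) \<Rightarrow> (nat \<Rightarrow> complex) \<Rightarrow> complex"
  assumes p_pos: "p > 0" and q_nonneg: "q \<ge> 0" and pq: "p + q = 1" and r_less: "r < p / 4"
    and amp_id: "\<And>\<nu> \<pi> z. \<nu> \<in> {1..N} \<rightarrow>\<^sub>E {1..M} \<Longrightarrow> \<pi> \<in> {1..N} \<rightarrow>\<^sub>E {1..M} \<Longrightarrow>
        amp \<nu> id \<pi> z = (if \<pi> = \<nu> then 1 else 0)"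
    and amp_T: "\<And>\<nu> \<sigma> \<pi> i z. \<nu> \<in> {1..N} \<rightarrow>\<^sub>E {1..M} \<Longrightarrow> \<pi> \<in> {1..N} \<rightarrow>\<^sub>E {1..M} \<Longrightarrow> z \<in> polydisc N (p / 4) \<Longrightarrow>
        \<sigma> permutes {1..N} \<Longrightarrow> 1 \<le> i \<Longrightarrow> i < N \<Longrightarrow>
        amp \<nu> (T i \<sigma>) \<pi> z = S_val p q (z (\<sigma> (Suc i))) (z (\<sigma> i)) * amp \<nu> \<sigma> \<pi> z +
          (1 + S_val p q (z (\<sigma> (Suc i))) (z (\<sigma> i))) * hecke (of_real p) (of_real q) i (\<lambda>\<pi>. amp \<nu> \<sigma> \<pi> z) \<pi>"
begin

abbreviation "Sp \<equiv> {1..N} \<rightarrow>\<^sub>E {1..M}"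
abbreviation "hk \<equiv> hecke (complex_of_real p) (complex_of_real q)"
abbreviation "hkT \<equiv> hecke_transpose (complex_of_real p) (complex_of_real q)"

lemma pqC: "complex_of_real p + complex_of_real q = 1"
  using pq by (metis of_real_1 of_real_add)

lemma amp_fun_id: "\<nu> \<in> Sp \<Longrightarrow> \<pi> \<in> Sp \<Longrightarrow> amp \<nu> (\<lambda>a. a) \<pi> z = (if \<pi> = \<nu> then 1 else 0)"
  using amp_id unfolding id_def .

lemma T_Sp: "\<pi> \<in> Sp \<Longrightarrow> 1 \<le> i \<Longrightarrow> i < N \<Longrightarrow> T i \<pi> \<in> Sp"
  by (rule T_PiE)

lemma den_nonzero: "cmod x < p / 4 \<Longrightarrow> cmod y < p / 4 \<Longrightarrow> complex_of_real p + of_real q * x * y - y \<noteq> 0"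
  using S_den_val_nonzero[of p q x y] p_pos q_nonneg pq by auto

lemma TM_polydisc: "x \<in> space TM \<Longrightarrow> x \<in> polydisc N (p / 4)"
  using r_less by (auto simp: polydisc_def norm_TM)

lemma polydisc_norm: "z \<in> polydisc N R \<Longrightarrow> i \<in> {1..N} \<Longrightarrow> cmod (z i) < R"
  by (auto simp: polydisc_def)

lemma nice_cong: "nice f \<Longrightarrow> (\<And>x. x \<in> space TM \<Longrightarrow> g x = f x) \<Longrightarrow> nice g"
  unfolding nice_def by (auto cong: measurable_cong)

lemma nice_S:
  assumes "a \<in> {1..N}" "b \<in> {1..N}"
  shows "nice (\<lambda>x. S_val p q (x a) (x b))"
proof -
  have "nice (\<lambda>x. inverse (of_real p + of_real q * x a * x b - x b))"
  \<comment> \<open>On the torus the denominator has modulus at least p - 2r, which exceeds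
    p/2.\<close>
  proof (rule nice_inverse[of _ "p / 2"])
    show "nice (\<lambda>x. of_real p + of_real q * x a * x b - x b)"
      using assms by (intro nice_diff nice_add nice_mult nice_const nice_coord)
    fix x assume x: "x \<in> space TM"
    have "p = cmod ((of_real p + of_real q * x a * x b - x b) + (x b - of_real q * x a * x b))"
      using p_pos by simp
    also have "\<dots> \<le> cmod (of_real p + of_real q * x a * x b - x b) + (cmod (x b) + cmod (of_real q * x a * x b))"
      by (intro order.trans[OF norm_triangle_ineq] add_left_mono norm_triangle_ineq4)
    also have "cmod (of_real q * x a * x b) \<le> 1 * 1 * r"
      unfolding norm_mult using norm_TM[OF x assms(1)] norm_TM[OF x assms(2)] q_nonneg pq p_pos r_pos r_less
      by (intro mult_mono) auto
    finally show "p / 2 \<le> cmod (of_real p + of_real q * x a * x b - x b)"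
      using norm_TM[OF x assms(2)] r_less by simp
  qed (use p_pos in simp)
  then show ?thesis unfolding S_val_def divide_inverse
    using assms by (intro nice_uminus nice_mult nice_diff nice_add nice_const nice_coord)
qed

lemma nice_hk: "(\<And>\<pi>. \<pi> \<in> Sp \<Longrightarrow> nice (f \<pi>)) \<Longrightarrow> \<pi> \<in> Sp \<Longrightarrow> 1 \<le> i \<Longrightarrow> i < N \<Longrightarrow> nice (\<lambda>z. hk i (\<lambda>\<pi>. f \<pi> z) \<pi>)"
  using T_Sp[of \<pi> i] unfolding hecke_def
  by (cases "\<pi> i = \<pi> (Suc i)"; cases "\<pi> i < \<pi> (Suc i)") (auto intro!: nice_const nice_diff nice_mult)

lemma nice_hkT: "(\<And>\<pi>. \<pi> \<in> Sp \<Longrightarrow> nice (f \<pi>)) \<Longrightarrow> \<pi> \<in> Sp \<Longrightarrow> 1 \<le> i \<Longrightarrow> i < N \<Longrightarrow> nice (\<lambda>z. hkT i (\<lambda>\<pi>. f \<pi> z) \<pi>)"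
  using T_Sp[of \<pi> i] unfolding hecke_transpose_def
  by (cases "\<pi> i = \<pi> (Suc i)"; cases "\<pi> i < \<pi> (Suc i)") (auto intro!: nice_const nice_diff nice_mult)

lemma nice_amp:
  assumes "\<sigma> permutes {1..N}" "\<nu> \<in> Sp" "\<pi> \<in> Sp"
  shows "nice (amp \<nu> \<sigma> \<pi>)"
  using assms
proof (induction arbitrary: \<pi> rule: perm_T_induct)
  case id
  show ?case by (rule nice_cong[OF nice_const]) (use id amp_fun_id in auto)
next
  case (T \<sigma> i)
  have "\<sigma> i \<in> {1..N}" "\<sigma> (Suc i) \<in> {1..N}" using permutes_range[OF T(1)] T(2,3) by auto
  then have S: "nice (\<lambda>x. S_val p q (x (\<sigma> (Suc i))) (x (\<sigma> i)))" by (intro nice_S)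
  show ?case
  proof (rule nice_cong)
    show "nice (\<lambda>z. S_val p q (z (\<sigma> (Suc i))) (z (\<sigma> i)) * amp \<nu> \<sigma> \<pi> z +
          (1 + S_val p q (z (\<sigma> (Suc i))) (z (\<sigma> i))) * hk i (\<lambda>\<pi>. amp \<nu> \<sigma> \<pi> z) \<pi>)"
      using T by (intro nice_add nice_mult S nice_const nice_hk) auto
  qed (use T amp_T TM_polydisc in auto)
qed

text \<open>Holomorphy in one variable at a time is the form in which Cauchy's formula is applied,
  namely to a single coordinate of the torus.\<close>

lemma amp_holomorphic:
  assumes "\<sigma> permutes {1..N}" "\<nu> \<in> Sp" "\<pi> \<in> Sp" "x \<in> polydisc N (p / 4)"
  shows "(\<lambda>z. amp \<nu> \<sigma> \<pi> (x(j := z))) holomorphic_on ball 0 (p / 4)"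
  using assms
proof (induction arbitrary: \<pi> rule: perm_T_induct)
  case id
  then show ?case by (simp add: amp_fun_id)
next
  case (T \<sigma> i)
  have in_poly: "x(j := z) \<in> polydisc N (p / 4)" if "z \<in> ball 0 (p / 4)" for z
    using that T(7) by (auto simp: polydisc_def)
  have \<sigma>: "\<sigma> i \<in> {1..N}" "\<sigma> (Suc i) \<in> {1..N}" using permutes_range[OF T(1)] T(2,3) by auto
  have coord: "(\<lambda>z. (x(j := z)) a) holomorphic_on ball 0 (p / 4)" for a
    by (cases "a = j") (auto intro: holomorphic_intros)
  have S: "(\<lambda>z. S_val p q ((x(j := z)) (\<sigma> (Suc i))) ((x(j := z)) (\<sigma> i))) holomorphic_on ball 0 (p / 4)"
    unfolding S_val_def
    using den_nonzero[OF polydisc_norm[OF in_poly \<sigma>(2)] polydisc_norm[OF in_poly \<sigma>(1)]]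
    by (intro holomorphic_intros coord) auto
  have *: "(\<lambda>z. amp \<nu> \<sigma> \<kappa> (x(j := z))) holomorphic_on ball 0 (p / 4)" if "\<kappa> \<in> Sp" for \<kappa>
    using T(4)[OF T(5) that T(7)] .
  have h: "(\<lambda>z. hk i (\<lambda>\<pi>. amp \<nu> \<sigma> \<pi> (x(j := z))) \<pi>) holomorphic_on ball 0 (p / 4)"
    unfolding hecke_def
    by (intro holomorphic_on_if_const holomorphic_intros * T(6) T_Sp[OF T(6,2,3)])
  show ?case
  proof (rule holomorphic_transform)
    show "(\<lambda>z. S_val p q ((x(j := z)) (\<sigma> (Suc i))) ((x(j := z)) (\<sigma> i)) * amp \<nu> \<sigma> \<pi> (x(j := z)) +
        (1 + S_val p q ((x(j := z)) (\<sigma> (Suc i))) ((x(j := z)) (\<sigma> i))) *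
          hk i (\<lambda>\<pi>. amp \<nu> \<sigma> \<pi> (x(j := z))) \<pi>) holomorphic_on ball 0 (p / 4)"
      by (intro holomorphic_intros S h * T(6))
  qed (rule amp_T[OF T(5,6) in_poly T(1-3), symmetric])
qed

text \<open>Points of the torus are \<open>undefined\<close> outside {1..N}, whereas the iterated
  contour integral evaluates at points that are 0 there; the amplitude does not see the
  difference.\<close>

lemma amp_cong:
  assumes "\<sigma> permutes {1..m}" "m \<le> N" "\<nu> \<in> Sp" "\<pi> \<in> Sp" "z \<in> polydisc N (p / 4)" "z' \<in> polydisc N (p / 4)"
    "\<And>i. i \<in> {1..m} \<Longrightarrow> z i = z' i"
  shows "amp \<nu> \<sigma> \<pi> z = amp \<nu> \<sigma> \<pi> z'"
  using assms
proof (induction arbitrary: \<pi> rule: perm_T_induct)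
  case id
  then show ?case by (simp add: amp_fun_id)
next
  case (T \<sigma> i)
  have iN: "i < N" using T by simp
  have \<sigma>: "z (\<sigma> i) = z' (\<sigma> i)" "z (\<sigma> (Suc i)) = z' (\<sigma> (Suc i))"
    using permutes_range[OF T(1)] T(2,3) by (auto intro!: T(10))
  have *: "amp \<nu> \<sigma> \<kappa> z = amp \<nu> \<sigma> \<kappa> z'" if "\<kappa> \<in> Sp" for \<kappa>
    using T that by blast
  have "hk i (\<lambda>\<pi>. amp \<nu> \<sigma> \<pi> z) \<pi> = hk i (\<lambda>\<pi>. amp \<nu> \<sigma> \<pi> z') \<pi>"
    by (rule hecke_cong) (use * T(7) T_Sp[OF T(7) T(2) iN] in auto)
  then show ?case
    using amp_T[OF T(6,7,8) permutes_le[OF T(1,5)] T(2) iN] amp_T[OF T(6,7,9) permutes_le[OF T(1,5)] T(2) iN]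
      \<sigma> *[OF T(7)] by simp
qed

lemma polydisc_swap: "z \<in> polydisc N R \<Longrightarrow> 1 \<le> k \<Longrightarrow> k < N \<Longrightarrow> z \<circ> adjswap k \<in> polydisc N R"
  using permutes_range[OF adjswap_permutes] by (auto simp: polydisc_def)

text \<open>Right multiplication of \<sigma> acts on \<pi>, left multiplication acts on \<nu> and
  permutes the variables. The two commute, so the identity propagates along \<open>amp_T\<close>
  from \<sigma> = id, where it is \<open>hecke_delta\<close>.\<close>

lemma amp_cocycle:
  assumes "\<sigma> permutes {1..N}" "\<nu> \<in> Sp" "\<pi> \<in> Sp" "z \<in> polydisc N (p / 4)" "1 \<le> k" "k < N"
  shows "amp \<nu> (adjswap k \<circ> \<sigma>) \<pi> z = S_val p q (z (Suc k)) (z k) * amp \<nu> \<sigma> \<pi> (z \<circ> adjswap k)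
    + (1 + S_val p q (z (Suc k)) (z k)) * hkT k (\<lambda>\<nu>. amp \<nu> \<sigma> \<pi> (z \<circ> adjswap k)) \<nu>"
  using assms
proof (induction arbitrary: \<pi> rule: perm_T_induct)
  case id
  have "adjswap k \<circ> id = T k id" unfolding T_eq_comp by (simp only: id_comp comp_id)
  moreover have 1: "hk k (\<lambda>\<pi>. amp \<nu> id \<pi> z) \<pi> = hk k (\<lambda>\<pi>. if \<pi> = \<nu> then 1 else 0) \<pi>"
    by (rule hecke_cong) (use amp_id[OF id(1)] id(2) T_Sp[OF id(2,4,5)] in auto)
  moreover have 2: "hkT k (\<lambda>\<nu>. amp \<nu> id \<pi> (z \<circ> adjswap k)) \<nu> = hkT k (\<lambda>\<nu>. if \<pi> = \<nu> then 1 else 0) \<nu>"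
    by (rule hecke_transpose_cong) (use amp_id[OF _ id(2)] id(1) T_Sp[OF id(1,4,5)] in auto)
  moreover have "amp \<nu> (T k id) \<pi> z = S_val p q (z (Suc k)) (z k) * amp \<nu> id \<pi> z +
     (1 + S_val p q (z (Suc k)) (z k)) * hk k (\<lambda>\<pi>. amp \<nu> id \<pi> z) \<pi>"
    using amp_T[OF id(1-3) permutes_id id(4,5)] by (simp only: id_apply)
  ultimately show ?case
    by (simp only: hecke_delta amp_id[OF id(1,2)])
next
  case (T \<sigma> i)
  let ?z = "z \<circ> adjswap k"
  define s where "s = S_val p q (z (Suc k)) (z k)"
  define s' where "s' = S_val p q (?z (\<sigma> (Suc i))) (?z (\<sigma> i))"
  have perm: "adjswap k \<circ> \<sigma> permutes {1..N}"
    using permutes_compose[OF T(1) adjswap_permutes] T by auto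
  have comp: "adjswap k \<circ> T i \<sigma> = T i (adjswap k \<circ> \<sigma>)"
    by (simp add: T_eq_comp comp_assoc)
  have z': "?z \<in> polydisc N (p / 4)" using polydisc_swap T by auto
  have IH: "amp \<nu> (adjswap k \<circ> \<sigma>) \<kappa> z = s * amp \<nu> \<sigma> \<kappa> ?z + (1 + s) * hkT k (\<lambda>\<nu>. amp \<nu> \<sigma> \<kappa> ?z) \<nu>" if "\<kappa> \<in> Sp" for \<kappa>
    using T that unfolding s_def by blast
  have rec: "amp \<mu> (T i \<sigma>) \<pi> ?z = s' * amp \<mu> \<sigma> \<pi> ?z + (1 + s') * hk i (\<lambda>\<pi>. amp \<mu> \<sigma> \<pi> ?z) \<pi>" if "\<mu> \<in> Sp" for \<mu>
    unfolding s'_def using amp_T[OF that T(6) z' T(1-3)] .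
  have 1: "hk i (\<lambda>\<pi>. amp \<nu> (adjswap k \<circ> \<sigma>) \<pi> z) \<pi> =
      s * hk i (\<lambda>\<pi>. amp \<nu> \<sigma> \<pi> ?z) \<pi> + (1 + s) * hkT k (\<lambda>\<nu>. hk i (\<lambda>\<pi>. amp \<nu> \<sigma> \<pi> ?z) \<pi>) \<nu>"
  proof -
    have "hk i (\<lambda>\<pi>. amp \<nu> (adjswap k \<circ> \<sigma>) \<pi> z) \<pi> =
      hk i (\<lambda>\<pi>. s * amp \<nu> \<sigma> \<pi> ?z + (1 + s) * hkT k (\<lambda>\<nu>. amp \<nu> \<sigma> \<pi> ?z) \<nu>) \<pi>"
      by (rule hecke_cong) (use IH T(6) T_Sp[OF T(6) T(2,3)] in blast)+
    then show ?thesis by (simp only: hecke_add hecke_scale hecke_hecke_transpose)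
  qed
  have 2: "hkT k (\<lambda>\<nu>. amp \<nu> (T i \<sigma>) \<pi> ?z) \<nu> =
      s' * hkT k (\<lambda>\<nu>. amp \<nu> \<sigma> \<pi> ?z) \<nu> + (1 + s') * hkT k (\<lambda>\<nu>. hk i (\<lambda>\<pi>. amp \<nu> \<sigma> \<pi> ?z) \<pi>) \<nu>"
  proof -
    have "hkT k (\<lambda>\<nu>. amp \<nu> (T i \<sigma>) \<pi> ?z) \<nu> =
      hkT k (\<lambda>\<nu>. s' * amp \<nu> \<sigma> \<pi> ?z + (1 + s') * hk i (\<lambda>\<pi>. amp \<nu> \<sigma> \<pi> ?z) \<pi>) \<nu>"
      by (rule hecke_transpose_cong) (use rec T(5) T_Sp[OF T(5) T(8,9)] in blast)+
    then show ?thesis by (simp only: hecke_transpose_add hecke_transpose_scale)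
  qed
  have "amp \<nu> (adjswap k \<circ> T i \<sigma>) \<pi> z = s' * amp \<nu> (adjswap k \<circ> \<sigma>) \<pi> z
      + (1 + s') * hk i (\<lambda>\<pi>. amp \<nu> (adjswap k \<circ> \<sigma>) \<pi> z) \<pi>"
    unfolding comp s'_def using amp_T[OF T(5,6,7) perm T(2,3)] by simp
  then show ?case
    unfolding 1 2 IH[OF T(6)] rec[OF T(5)] s_def[symmetric]
    by (simp only: ring_distribs mult_1_left ac_simps)
qed

section \<open>The Bethe wave function and its symmetries\<close>

definition mon :: "(nat \<Rightarrow> int) \<Rightarrow> (nat \<Rightarrow> complex) \<Rightarrow> complex" where
  "mon x z = (\<Prod>i\<in>{1..N}. z i powi x i)"

text \<open>Only the first m particles are permuted, the others contribute plain monomials.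
  Intermediate values of m serve the induction on the number of particles in the initial
  condition.\<close>

definition Psi :: "nat \<Rightarrow> (nat \<Rightarrow> int) \<Rightarrow> (nat \<Rightarrow> nat) \<Rightarrow> (nat \<Rightarrow> nat) \<Rightarrow> (nat \<Rightarrow> complex) \<Rightarrow> complex" where
  "Psi m x \<nu> \<pi> z = (\<Sum>\<sigma> | \<sigma> permutes {1..m}. amp \<nu> \<sigma> \<pi> z * mon x (z \<circ> \<sigma>))"

definition coef :: "((nat \<Rightarrow> complex) \<Rightarrow> complex) \<Rightarrow> nat \<Rightarrow> (nat \<Rightarrow> int) \<Rightarrow> (nat \<Rightarrow> int) \<Rightarrow> (nat \<Rightarrow> nat) \<Rightarrow> (nat \<Rightarrow> nat) \<Rightarrow> complex" where
  "coef g m x y \<nu> \<pi> = CT (\<lambda>z. g z * Psi m x \<nu> \<pi> z * mon (\<lambda>i. - y i) z)"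

lemma TM_nonzero: "z \<in> space TM \<Longrightarrow> i \<in> {1..N} \<Longrightarrow> z i \<noteq> 0"
  using norm_TM[of z i] r_pos by auto

lemma nice_mon: "nice (mon x)"
  unfolding mon_def[abs_def] by (intro nice_prod nice_powi)

lemma nice_mon_comp: "\<sigma> permutes {1..N} \<Longrightarrow> nice (\<lambda>z. mon x (z \<circ> \<sigma>))"
  unfolding mon_def comp_def by (intro nice_prod nice_powi) (simp only: permutes_in_image)

lemma nice_Psi: "m \<le> N \<Longrightarrow> \<nu> \<in> Sp \<Longrightarrow> \<pi> \<in> Sp \<Longrightarrow> nice (Psi m x \<nu> \<pi>)"
  unfolding Psi_def[abs_def] by (intro nice_sum nice_mult nice_amp nice_mon_comp) (simp_all add: permutes_le del: One_nat_def)

lemma nice_integrand: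
  "nice g \<Longrightarrow> m \<le> N \<Longrightarrow> \<nu> \<in> Sp \<Longrightarrow> \<pi> \<in> Sp \<Longrightarrow> nice (\<lambda>z. g z * Psi m x \<nu> \<pi> z * mon (\<lambda>i. - y i) z)"
  by (intro nice_mult nice_Psi nice_mon)

lemma mon_up: "z \<in> space TM \<Longrightarrow> i \<in> {1..N} \<Longrightarrow> \<sigma> permutes {1..N} \<Longrightarrow> mon (up x i) (z \<circ> \<sigma>) = z (\<sigma> i) * mon x (z \<circ> \<sigma>)"
  using TM_nonzero[of z "\<sigma> i"] permutes_in_image[of \<sigma> "{1..N}" i]
  unfolding mon_def up_def by (subst (1 2) prod.remove[of _ i]) (auto simp: power_int_add_1 mult_ac)

lemma mon_dn: "z \<in> space TM \<Longrightarrow> i \<in> {1..N} \<Longrightarrow> \<sigma> permutes {1..N} \<Longrightarrow> mon (dn x i) (z \<circ> \<sigma>) = inverse (z (\<sigma> i)) * mon x (z \<circ> \<sigma>)"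
  using mon_up[of z i \<sigma> "dn x i"] TM_nonzero[of z "\<sigma> i"] permutes_in_image[of \<sigma> "{1..N}" i] by simp

lemma mon_uminus_up: "z \<in> space TM \<Longrightarrow> i \<in> {1..N} \<Longrightarrow> mon (\<lambda>j. - up y i j) z = inverse (z i) * mon (\<lambda>j. - y j) z"
proof -
  assume "z \<in> space TM" "i \<in> {1..N}"
  moreover have "(\<lambda>j. - up y i j) = dn (\<lambda>j. - y j) i" by (auto simp: up_def dn_def)
  ultimately show ?thesis using mon_dn[OF _ _ permutes_id, of z i "\<lambda>j. - y j"] by (simp only: comp_id id_apply)
qed

lemma mon_uminus_dn: "z \<in> space TM \<Longrightarrow> i \<in> {1..N} \<Longrightarrow> mon (\<lambda>j. - dn y i j) z = z i * mon (\<lambda>j. - y j) z"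
proof -
  assume "z \<in> space TM" "i \<in> {1..N}"
  moreover have "(\<lambda>j. - dn y i j) = up (\<lambda>j. - y j) i" by (auto simp: up_def dn_def)
  ultimately show ?thesis using mon_up[OF _ _ permutes_id, of z i "\<lambda>j. - y j"] by (simp only: comp_id id_apply)
qed

text \<open>Both boundary conditions reduce to these two scalar identities.\<close>

lemma S_val_identities:
  assumes "cmod u < p / 4" "cmod v < p / 4"
  defines "W \<equiv> complex_of_real p + of_real q * u * v"
  shows "(W - u) * S_val p q v u = v - W" "(W - u) * (1 + S_val p q v u) = v - u"
proof -
  have "W - u \<noteq> 0" using den_nonzero[of v u] assms by (simp add: mult_ac)
  moreover have "S_val p q v u = - ((W - v) / (W - u))" by (simp add: S_val_def W_def mult_ac)
  ultimately show "(W - u) * S_val p q v u = v - W" by simp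
  then show "(W - u) * (1 + S_val p q v u) = v - u" by (simp add: algebra_simps)
qed

text \<open>This combination is what a collision at k leaves over once the common monomial is split
  off. By B^2 = -B the recursion gives B A_(T_k \<sigma>) = -B A_\<sigma>; the scalar identities
  make the rest antisymmetric under \<open>T k\<close>, which exchanges u and v.\<close>

lemma amp_T_pair:
  assumes "\<nu> \<in> Sp" "\<pi> \<in> Sp" "z \<in> space TM" "\<sigma> permutes {1..N}" "1 \<le> k" "k < N"
  defines "u \<equiv> z (\<sigma> k)" and "v \<equiv> z (\<sigma> (Suc k))"
  defines "W \<equiv> complex_of_real p + of_real q * u * v"
  shows "(W - u) * amp \<nu> (T k \<sigma>) \<pi> z - u * hk k (\<lambda>\<pi>. amp \<nu> (T k \<sigma>) \<pi> z) \<pi>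
     = - ((W - v) * amp \<nu> \<sigma> \<pi> z - v * hk k (\<lambda>\<pi>. amp \<nu> \<sigma> \<pi> z) \<pi>)"
proof -
  define s where "s = S_val p q v u"
  let ?A = "\<lambda>\<pi>. amp \<nu> \<sigma> \<pi> z"
  have z: "z \<in> polydisc N (p / 4)" using TM_polydisc assms by blast
  have rec: "amp \<nu> (T k \<sigma>) \<kappa> z = s * ?A \<kappa> + (1 + s) * hk k ?A \<kappa>" if "\<kappa> \<in> Sp" for \<kappa>
    unfolding s_def u_def v_def using amp_T[OF assms(1) that z assms(4-6)] .
  have "hk k (\<lambda>\<pi>. amp \<nu> (T k \<sigma>) \<pi> z) \<pi> = hk k (\<lambda>\<kappa>. s * ?A \<kappa> + (1 + s) * hk k ?A \<kappa>) \<pi>"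
    by (rule hecke_cong) (use rec assms(2) T_Sp[OF assms(2,5,6)] in blast)+
  also have "\<dots> = - hk k ?A \<pi>"
    by (simp only: hecke_add hecke_scale hecke_square[OF pqC]) (simp add: algebra_simps)
  finally have h: "hk k (\<lambda>\<pi>. amp \<nu> (T k \<sigma>) \<pi> z) \<pi> = - hk k ?A \<pi>" .
  have "cmod u < p / 4" "cmod v < p / 4"
    unfolding u_def v_def using polydisc_norm[OF z] permutes_range[OF assms(4)] assms(5,6) by auto
  from S_val_identities[OF this] have s: "(W - u) * s = v - W" "(W - u) * (1 + s) = v - u"
    unfolding W_def s_def by auto
  have "(W - u) * (s * ?A \<pi> + (1 + s) * hk k ?A \<pi>) = ((W - u) * s) * ?A \<pi> + ((W - u) * (1 + s)) * hk k ?A \<pi>"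
    by (simp add: algebra_simps)
  then show ?thesis unfolding h rec[OF assms(2)] s by (simp add: algebra_simps)
qed

lemma sum_involution_zero:
  fixes F :: "'b \<Rightarrow> complex"
  assumes "\<And>a. a \<in> A \<Longrightarrow> f a \<in> A" "\<And>a. a \<in> A \<Longrightarrow> f (f a) = a" "\<And>a. a \<in> A \<Longrightarrow> F (f a) = - F a"
  shows "sum F A = 0"
proof -
  have "sum F A = (\<Sum>a\<in>A. F (f a))"
    by (rule sum.reindex_bij_witness[of _ f f]) (use assms in auto)
  also have "\<dots> = - sum F A" using assms(3) by (simp add: sum_negf)
  finally show ?thesis by simp
qed

text \<open>All terms share a monomial that is symmetric in the two colliding variables, and by
  \<open>amp_T_pair\<close> the contributions of \<sigma> and \<open>T k \<sigma>\<close>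
  cancel.\<close>

lemma Psi_x_boundary:
  assumes "m \<le> N" "\<nu> \<in> Sp" "\<pi> \<in> Sp" "z \<in> space TM" "k \<in> adj m x"
  shows "of_real p * Psi m (dn x (Suc k)) \<nu> \<pi> z + of_real q * Psi m (up x k) \<nu> \<pi> z
    = Psi m x \<nu> \<pi> z + hk k (\<lambda>\<pi>. Psi m x \<nu> \<pi> z) \<pi>"
proof -
  have k: "1 \<le> k" "k < m" "x (Suc k) = x k + 1" "k < N" using assms by (auto simp: adj_def)
  let ?P = "{\<sigma>. \<sigma> permutes {1..m}}"
  \<comment> \<open>As x_(k+1) = x_k + 1, lowering x_(k+1) makes both exponents equal to x_k, so
    \<open>T k\<close> leaves this monomial unchanged.\<close>
  define X where "X \<sigma> = mon (dn x (Suc k)) (z \<circ> \<sigma>)" for \<sigma>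
  define F where "F \<sigma> = X \<sigma> * ((of_real p + of_real q * z (\<sigma> k) * z (\<sigma> (Suc k)) - z (\<sigma> (Suc k))) * amp \<nu> \<sigma> \<pi> z
      - z (\<sigma> (Suc k)) * hk k (\<lambda>\<pi>. amp \<nu> \<sigma> \<pi> z) \<pi>)" for \<sigma>
  have perm: "\<sigma> permutes {1..N}" if "\<sigma> \<in> ?P" for \<sigma> using that assms(1) permutes_le by blast
  have dn: "dn x (Suc k) (Suc k) = x k" "dn x (Suc k) k = x k" by (auto simp: dn_def k)
  have X_T: "X (T k \<sigma>) = X \<sigma>" if "\<sigma> \<in> ?P" for \<sigma>
  proof -
    have "(\<Prod>i\<in>{1..N} - {k, Suc k}. (z \<circ> T k \<sigma>) i powi dn x (Suc k) i) =
        (\<Prod>i\<in>{1..N} - {k, Suc k}. (z \<circ> \<sigma>) i powi dn x (Suc k) i)"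
      by (rule prod.cong) auto
    then show ?thesis
      unfolding X_def mon_def prod_split_adjacent[OF k(1,4)] dn by (simp add: mult_ac)
  qed
  have F_T: "F (T k \<sigma>) = - F \<sigma>" if "\<sigma> \<in> ?P" for \<sigma>
  proof -
    have "F (T k \<sigma>) = X \<sigma> * ((of_real p + of_real q * z (\<sigma> k) * z (\<sigma> (Suc k)) - z (\<sigma> k)) * amp \<nu> (T k \<sigma>) \<pi> z
      - z (\<sigma> k) * hk k (\<lambda>\<pi>. amp \<nu> (T k \<sigma>) \<pi> z) \<pi>)"
      unfolding F_def X_T[OF that] by (simp add: mult_ac)
    also have "\<dots> = - F \<sigma>"
      unfolding amp_T_pair[OF assms(2-4) perm[OF that] k(1,4)] F_def by (simp only: mult_minus_right)
    finally show ?thesis .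
  qed
  have F: "F \<sigma> = of_real p * (amp \<nu> \<sigma> \<pi> z * mon (dn x (Suc k)) (z \<circ> \<sigma>)) + of_real q * (amp \<nu> \<sigma> \<pi> z * mon (up x k) (z \<circ> \<sigma>))
      - amp \<nu> \<sigma> \<pi> z * mon x (z \<circ> \<sigma>) - hk k (\<lambda>\<pi>. mon x (z \<circ> \<sigma>) * amp \<nu> \<sigma> \<pi> z) \<pi>" if "\<sigma> \<in> ?P" for \<sigma>
  proof -
    have x: "mon x (z \<circ> \<sigma>) = z (\<sigma> (Suc k)) * X \<sigma>"
      using mon_up[OF assms(4) _ perm[OF that], of "Suc k" "dn x (Suc k)"] k unfolding X_def by simp
    have "mon (up x k) (z \<circ> \<sigma>) = z (\<sigma> k) * (z (\<sigma> (Suc k)) * X \<sigma>)"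
      using mon_up[OF assms(4) _ perm[OF that], of k x] k unfolding x by simp
    then show ?thesis unfolding hecke_scale x F_def by (simp add: X_def algebra_simps)
  qed
  have "sum F ?P = 0"
    by (rule sum_involution_zero[of _ "T k"]) (use F_T T_permutes k in auto)
  moreover have "sum F ?P = of_real p * Psi m (dn x (Suc k)) \<nu> \<pi> z + of_real q * Psi m (up x k) \<nu> \<pi> z
     - Psi m x \<nu> \<pi> z - hk k (\<lambda>\<pi>. Psi m x \<nu> \<pi> z) \<pi>"
    unfolding Psi_def hecke_sum
    by (subst sum.cong[OF refl F], assumption) (simp add: sum.distrib sum_subtractf sum_distrib_left mult.commute)
  ultimately show ?thesis by (simp add: algebra_simps)
qed

text \<open>The sum is reindexed by left multiplication with the transposition. In the monomials
  this merely permutes the variables, and the amplitudes transform by the cocycle property.\<close>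

lemma Psi_swap:
  assumes "m \<le> N" "\<nu> \<in> Sp" "\<pi> \<in> Sp" "z \<in> space TM" "1 \<le> k" "k < m"
  shows "Psi m x \<nu> \<pi> z = S_val p q (z (Suc k)) (z k) * Psi m x \<nu> \<pi> (z \<circ> adjswap k)
    + (1 + S_val p q (z (Suc k)) (z k)) * hkT k (\<lambda>\<nu>. Psi m x \<nu> \<pi> (z \<circ> adjswap k)) \<nu>"
proof -
  let ?P = "{\<sigma>. \<sigma> permutes {1..m}}" and ?z = "z \<circ> adjswap k"
  define s where "s = S_val p q (z (Suc k)) (z k)"
  have inv: "adjswap k \<circ> (adjswap k \<circ> \<sigma>) = \<sigma>" for \<sigma> :: "nat \<Rightarrow> nat"
    by (simp add: fun_eq_iff)
  have in_P: "adjswap k \<circ> \<sigma> \<in> ?P" if "\<sigma> \<in> ?P" for \<sigma>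
    using permutes_compose[OF _ adjswap_permutes[OF assms(5,6)]] that by simp
  have "Psi m x \<nu> \<pi> z = (\<Sum>\<sigma>\<in>?P. amp \<nu> (adjswap k \<circ> \<sigma>) \<pi> z * mon x (z \<circ> (adjswap k \<circ> \<sigma>)))"
    unfolding Psi_def
    by (rule sum.reindex_bij_witness[of _ "\<lambda>\<sigma>. adjswap k \<circ> \<sigma>" "\<lambda>\<sigma>. adjswap k \<circ> \<sigma>"]) (simp_all only: inv in_P)
  also have "\<dots> = (\<Sum>\<sigma>\<in>?P. s * (amp \<nu> \<sigma> \<pi> ?z * mon x (?z \<circ> \<sigma>))
      + (1 + s) * hkT k (\<lambda>\<nu>. mon x (?z \<circ> \<sigma>) * amp \<nu> \<sigma> \<pi> ?z) \<nu>)"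
  proof (rule sum.cong[OF refl])
    fix \<sigma> assume "\<sigma> \<in> ?P"
    then have "\<sigma> permutes {1..N}" using permutes_le assms(1) by blast
    from amp_cocycle[OF this assms(2,3) TM_polydisc[OF assms(4)] assms(5)] assms(1,6)
    have "amp \<nu> (adjswap k \<circ> \<sigma>) \<pi> z = s * amp \<nu> \<sigma> \<pi> ?z + (1 + s) * hkT k (\<lambda>\<nu>. amp \<nu> \<sigma> \<pi> ?z) \<nu>"
      unfolding s_def by linarith
    then show "amp \<nu> (adjswap k \<circ> \<sigma>) \<pi> z * mon x (z \<circ> (adjswap k \<circ> \<sigma>)) = s * (amp \<nu> \<sigma> \<pi> ?z * mon x (?z \<circ> \<sigma>))
      + (1 + s) * hkT k (\<lambda>\<nu>. mon x (?z \<circ> \<sigma>) * amp \<nu> \<sigma> \<pi> ?z) \<nu>"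
      unfolding hecke_transpose_scale comp_assoc by (simp only: ring_distribs ac_simps)
  qed
  also have "\<dots> = s * Psi m x \<nu> \<pi> ?z + (1 + s) * hkT k (\<lambda>\<nu>. Psi m x \<nu> \<pi> ?z) \<nu>"
    unfolding Psi_def hecke_transpose_sum sum.distrib sum_distrib_left by (simp only: mult.commute)
  finally show ?thesis unfolding s_def .
qed

end

section \<open>Boundary conditions\<close>

context bethe
begin

lemma CT_hkT:
  assumes "\<And>\<nu>. \<nu> \<in> Sp \<Longrightarrow> nice (F \<nu>)" "\<nu> \<in> Sp" "1 \<le> k" "k < N"
  shows "CT (\<lambda>z. hkT k (\<lambda>\<nu>. F \<nu> z) \<nu>) = hkT k (\<lambda>\<nu>. CT (F \<nu>)) \<nu>"
  using assms(1)[OF assms(2)] assms(1)[OF T_Sp[OF assms(2-4)]]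
  by (simp add: hecke_transpose_def CT_diff CT_mult nice_mult nice_const)

lemma CT_hk:
  assumes "\<And>\<pi>. \<pi> \<in> Sp \<Longrightarrow> nice (F \<pi>)" "\<pi> \<in> Sp" "1 \<le> k" "k < N"
  shows "CT (\<lambda>z. hk k (\<lambda>\<pi>. F \<pi> z) \<pi>) = hk k (\<lambda>\<pi>. CT (F \<pi>)) \<pi>"
  using assms(1)[OF assms(2)] assms(1)[OF T_Sp[OF assms(2-4)]]
  by (simp add: hecke_def CT_diff CT_mult nice_mult nice_const)

lemma coef_x_boundary:
  assumes g: "nice g" and "m \<le> N" "\<nu> \<in> Sp" "\<pi> \<in> Sp" "k \<in> adj m x"
  shows "of_real p * coef g m (dn x (Suc k)) y \<nu> \<pi> + of_real q * coef g m (up x k) y \<nu> \<pi>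
    = coef g m x y \<nu> \<pi> + hk k (\<lambda>\<pi>. coef g m x y \<nu> \<pi>) \<pi>"
proof -
  have k: "1 \<le> k" "k < N" using assms by (auto simp: adj_def)
  note n = nice_integrand[OF g assms(2,3)]
  let ?m = "mon (\<lambda>i. - y i)"
  have "of_real p * coef g m (dn x (Suc k)) y \<nu> \<pi> + of_real q * coef g m (up x k) y \<nu> \<pi>
    = CT (\<lambda>z. of_real p * (g z * Psi m (dn x (Suc k)) \<nu> \<pi> z * ?m z) + of_real q * (g z * Psi m (up x k) \<nu> \<pi> z * ?m z))"
    unfolding coef_def using assms(4) by (subst CT_add) (auto intro!: nice_mult nice_const n simp: CT_mult)
  also have "\<dots> = CT (\<lambda>z. g z * Psi m x \<nu> \<pi> z * ?m z + hk k (\<lambda>\<pi>. g z * Psi m x \<nu> \<pi> z * ?m z) \<pi>)"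
  proof (rule CT_cong)
    fix z assume z: "z \<in> space TM"
    have h: "hk k (\<lambda>\<pi>. g z * Psi m x \<nu> \<pi> z * ?m z) \<pi> = (g z * ?m z) * hk k (\<lambda>\<pi>. Psi m x \<nu> \<pi> z) \<pi>"
      by (subst fun_cong[OF hecke_scale[symmetric]]) (simp only: mult_ac)
    have "of_real p * (g z * Psi m (dn x (Suc k)) \<nu> \<pi> z * ?m z) + of_real q * (g z * Psi m (up x k) \<nu> \<pi> z * ?m z)
      = (g z * ?m z) * (of_real p * Psi m (dn x (Suc k)) \<nu> \<pi> z + of_real q * Psi m (up x k) \<nu> \<pi> z)"
      by (simp add: algebra_simps)
    then show "of_real p * (g z * Psi m (dn x (Suc k)) \<nu> \<pi> z * ?m z) + of_real q * (g z * Psi m (up x k) \<nu> \<pi> z * ?m z)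
      = g z * Psi m x \<nu> \<pi> z * ?m z + hk k (\<lambda>\<pi>. g z * Psi m x \<nu> \<pi> z * ?m z) \<pi>"
      unfolding Psi_x_boundary[OF assms(2-4) z assms(5)] h by (simp add: algebra_simps)
  qed
  also have "\<dots> = coef g m x y \<nu> \<pi> + hk k (\<lambda>\<pi>. coef g m x y \<nu> \<pi>) \<pi>"
  proof -
    let ?I = "\<lambda>\<pi> z. g z * Psi m x \<nu> \<pi> z * ?m z"
    have "CT (\<lambda>z. hk k (\<lambda>\<pi>. ?I \<pi> z) \<pi>) = hk k (\<lambda>\<pi>. CT (?I \<pi>)) \<pi>"
      by (rule CT_hk[where F = "\<lambda>\<pi> z. ?I \<pi> z"]) (use n assms k in auto)
    moreover have "nice (\<lambda>z. hk k (\<lambda>\<pi>. ?I \<pi> z) \<pi>)"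
      by (rule nice_hk[where f = "\<lambda>\<pi> z. ?I \<pi> z"]) (use n assms k in auto)
    ultimately show ?thesis
      unfolding coef_def using n[OF assms(4)] by (simp only: CT_add)
  qed
  finally show ?thesis .
qed

text \<open>Unlike the condition in x, this one is not pointwise. The difference \<Phi> of the two
  integrands is antisymmetric under the exchange of \<xi>_k and \<xi>_(k+1), under which the measure
  is invariant; the factor g must be symmetric for that.\<close>

lemma coef_y_boundary:
  assumes g: "nice g" and "m \<le> N" "\<nu> \<in> Sp" "\<pi> \<in> Sp" "k \<in> adj m y"
    and sym: "\<And>z. z \<in> space TM \<Longrightarrow> g (z \<circ> adjswap k) = g z"
  shows "of_real p * coef g m x (up y k) \<nu> \<pi> + of_real q * coef g m x (dn y (Suc k)) \<nu> \<pi>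
    = coef g m x y \<nu> \<pi> + hkT k (\<lambda>\<nu>. coef g m x y \<nu> \<pi>) \<nu>"
proof -
  have k: "1 \<le> k" "k < m" "k < N" "y (Suc k) = y k + 1" using assms by (auto simp: adj_def)
  note n = nice_integrand[OF g assms(2)]
  let ?I = "\<lambda>y \<nu> z. g z * Psi m x \<nu> \<pi> z * mon (\<lambda>i. - y i) z"
  define \<Phi> where "\<Phi> z = of_real p * ?I (up y k) \<nu> z + of_real q * ?I (dn y (Suc k)) \<nu> z
     - ?I y \<nu> z - hkT k (\<lambda>\<nu>. ?I y \<nu> z) \<nu>" for z
  have nh: "nice (\<lambda>z. hkT k (\<lambda>\<nu>. ?I y \<nu> z) \<nu>)"
    by (rule nice_hkT[where f = "\<lambda>\<nu> z. ?I y \<nu> z"]) (use n assms k in auto)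
  have ni: "nice (?I y' \<nu>)" for y' using n assms(3,4) by blast
  have n\<Phi>: "nice \<Phi>"
    unfolding \<Phi>_def[abs_def] by (intro nice_diff nice_add nice_mult[OF nice_const] ni nh)
  have CT\<Phi>: "CT \<Phi> = of_real p * coef g m x (up y k) \<nu> \<pi> + of_real q * coef g m x (dn y (Suc k)) \<nu> \<pi>
    - coef g m x y \<nu> \<pi> - hkT k (\<lambda>\<nu>. coef g m x y \<nu> \<pi>) \<nu>"
  proof -
    have "CT (\<lambda>z. hkT k (\<lambda>\<nu>. ?I y \<nu> z) \<nu>) = hkT k (\<lambda>\<nu>. CT (?I y \<nu>)) \<nu>"
      by (rule CT_hkT[where F = "\<lambda>\<nu> z. ?I y \<nu> z"]) (use n assms k in auto)
    then show ?thesis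
      unfolding \<Phi>_def[abs_def] coef_def
      by (simp only: CT_diff CT_add CT_mult nice_diff nice_add nice_mult[OF nice_const] ni nh)
  qed
  have pair: "\<Phi> z + \<Phi> (z \<circ> adjswap k) = 0" if z: "z \<in> space TM" for z
  proof -
    let ?z = "z \<circ> adjswap k"
    have kN: "k \<in> {1..N}" "Suc k \<in> {1..N}" using k by auto
    have z': "?z \<in> space TM"
    proof -
      have "?z i \<in> sphere 0 r" if "i \<in> {1..N}" for i
        using norm_TM[OF z] permutes_in_image[OF adjswap_permutes[OF k(1,3)], of i] that by simp
      moreover have "?z i = undefined" if "i \<notin> {1..N}" for i
        using permutes_not_in[OF adjswap_permutes[OF k(1,3)] that] z that by (auto simp: space_TM)
      ultimately show ?thesis unfolding space_TM by blast
    qed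
    \<comment> \<open>Both exponents equal -(y_k + 1), so this monomial is symmetric in \<xi>_k and
      \<xi>_(k+1).\<close>
    define \<mu> where "\<mu> = mon (\<lambda>i. - up y k i) z"
    have upk: "up y k k = y k + 1" "up y k (Suc k) = y k + 1" by (auto simp: up_def k)
    have \<mu>': "mon (\<lambda>i. - up y k i) ?z = \<mu>"
    proof -
      have "(\<Prod>i\<in>{1..N} - {k, Suc k}. ?z i powi - up y k i) = (\<Prod>i\<in>{1..N} - {k, Suc k}. z i powi - up y k i)"
        by (rule prod.cong) auto
      then show ?thesis unfolding \<mu>_def mon_def prod_split_adjacent[OF k(1,3)] upk by (simp add: mult_ac)
    qed
    have \<Phi>: "\<Phi> w = g w * mon (\<lambda>i. - up y k i) w * ((of_real p + of_real q * w k * w (Suc k) - w k) * Psi m x \<nu> \<pi> w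
        - w k * hkT k (\<lambda>\<nu>. Psi m x \<nu> \<pi> w) \<nu>)" if w: "w \<in> space TM" for w
    proof -
      have 1: "mon (\<lambda>i. - y i) w = w k * mon (\<lambda>i. - up y k i) w"
        using mon_uminus_up[OF w kN(1)] TM_nonzero[OF w kN(1)] by simp
      have 2: "mon (\<lambda>i. - dn y (Suc k) i) w = w (Suc k) * mon (\<lambda>i. - y i) w"
        using mon_uminus_dn[OF w kN(2)] .
      have "hkT k (\<lambda>\<nu>. ?I y \<nu> w) \<nu> = (g w * mon (\<lambda>i. - y i) w) * hkT k (\<lambda>\<nu>. Psi m x \<nu> \<pi> w) \<nu>"
        by (subst hecke_transpose_scale[symmetric]) (simp only: mult_ac)
      then show ?thesis unfolding \<Phi>_def 2 1 by (simp add: algebra_simps)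
    qed
    define u v W s where "u = z k" "v = z (Suc k)" "W = of_real p + of_real q * u * v" "s = S_val p q v u"
    note uv = this
    define \<Psi> H where "\<Psi> = Psi m x \<nu> \<pi> ?z" "H = hkT k (\<lambda>\<nu>. Psi m x \<nu> \<pi> ?z) \<nu>"
    have swap: "Psi m x \<kappa> \<pi> z = s * Psi m x \<kappa> \<pi> ?z + (1 + s) * hkT k (\<lambda>\<nu>. Psi m x \<nu> \<pi> ?z) \<kappa>" if "\<kappa> \<in> Sp" for \<kappa>
      unfolding uv using Psi_swap[OF assms(2) that assms(4) z k(1,2)] .
    have "hkT k (\<lambda>\<nu>. Psi m x \<nu> \<pi> z) \<nu> = hkT k (\<lambda>\<kappa>. s * Psi m x \<kappa> \<pi> ?z + (1 + s) * hkT k (\<lambda>\<nu>. Psi m x \<nu> \<pi> ?z) \<kappa>) \<nu>"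
      by (rule hecke_transpose_cong) (use swap assms(3) T_Sp[OF assms(3) k(1,3)] in blast)+
    also have "\<dots> = - H"
      unfolding hecke_transpose_add hecke_transpose_scale hecke_transpose_square[OF pqC] \<Psi>_H_def
      by (simp add: algebra_simps)
    finally have H: "hkT k (\<lambda>\<nu>. Psi m x \<nu> \<pi> z) \<nu> = - H" .
    have "cmod u < p / 4" "cmod v < p / 4" using norm_TM[OF z] kN r_less by (auto simp: uv)
    from S_val_identities[OF this] have s: "(W - u) * s = v - W" "(W - u) * (1 + s) = v - u"
      unfolding uv by auto
    have "(W - u) * (s * \<Psi> + (1 + s) * H) = ((W - u) * s) * \<Psi> + ((W - u) * (1 + s)) * H"
      by (simp add: algebra_simps)
    then have key: "(W - u) * (s * \<Psi> + (1 + s) * H) + u * H + ((W - v) * \<Psi> - v * H) = 0"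
      unfolding s by (simp add: algebra_simps)
    have "\<Phi> z = g z * \<mu> * ((W - u) * (s * \<Psi> + (1 + s) * H) + u * H)"
      unfolding \<Phi>[OF z] H swap[OF assms(3)] \<mu>_def[symmetric] uv(1,2)[symmetric] uv(3)[symmetric] \<Psi>_H_def[symmetric] by simp
    moreover have "\<Phi> ?z = g z * \<mu> * ((W - v) * \<Psi> - v * H)"
      unfolding \<Phi>[OF z'] \<mu>' sym[OF z] \<Psi>_H_def[symmetric] uv by (simp add: mult_ac)
    ultimately have "\<Phi> z + \<Phi> ?z = g z * \<mu> * ((W - u) * (s * \<Psi> + (1 + s) * H) + u * H + ((W - v) * \<Psi> - v * H))"
      by (simp only: distrib_left)
    then show ?thesis unfolding key by simp
  qed
  have "CT \<Phi> = CT (\<lambda>z. \<Phi> (z \<circ> adjswap k))"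
    using CT_permute[OF adjswap_permutes[OF k(1,3)] n\<Phi>] by simp
  also have "\<dots> = CT (\<lambda>z. - 1 * \<Phi> z)"
    by (rule CT_cong) (use pair in \<open>auto simp: add_eq_0_iff\<close>)
  also have "\<dots> = - CT \<Phi>" unfolding CT_mult by simp
  finally have "CT \<Phi> = 0" by simp
  then show ?thesis unfolding CT\<Phi> by (simp add: algebra_simps)
qed

section \<open>The free equations in x and in y\<close>

definition energy :: "nat \<Rightarrow> (nat \<Rightarrow> complex) \<Rightarrow> complex" where
  "energy m z = (\<Sum>i\<in>{1..m}. of_real p * inverse (z i) + of_real q * z i)"

lemma nice_energy: "m \<le> N \<Longrightarrow> nice (energy m)"
  unfolding energy_def[abs_def]
  by (intro nice_sum nice_add nice_mult nice_const nice_coord nice_inverse_coord) auto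

lemma energy_permute: "\<sigma> permutes {1..m} \<Longrightarrow> energy m (z \<circ> \<sigma>) = energy m z"
  unfolding energy_def comp_def
  using sum.permute[of \<sigma> "{1..m}" "\<lambda>i. of_real p * inverse (z i) + of_real q * z i"] by (simp add: comp_def)

text \<open>Shifting x_i multiplies the term of \<sigma> by \<xi>_(\<sigma>(i)) or its inverse.
  Summed over i with their weights these factors form \<open>energy m\<close>, which is symmetric
  and therefore common to all \<sigma>.\<close>

lemma coef_free_x:
  assumes g: "nice g" and "m \<le> N" "\<nu> \<in> Sp" "\<pi> \<in> Sp"
  shows "(\<Sum>i\<in>{1..m}. of_real p * coef g m (dn x i) y \<nu> \<pi> + of_real q * coef g m (up x i) y \<nu> \<pi>)
    = coef (\<lambda>z. g z * energy m z) m x y \<nu> \<pi>"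
proof -
  note n = nice_integrand[OF assms]
  let ?m = "mon (\<lambda>i. - y i)"
  have Psi: "(\<Sum>i\<in>{1..m}. of_real p * Psi m (dn x i) \<nu> \<pi> z + of_real q * Psi m (up x i) \<nu> \<pi> z) = energy m z * Psi m x \<nu> \<pi> z"
    if z: "z \<in> space TM" for z
  proof -
    have "(\<Sum>i\<in>{1..m}. of_real p * Psi m (dn x i) \<nu> \<pi> z + of_real q * Psi m (up x i) \<nu> \<pi> z)
      = (\<Sum>i\<in>{1..m}. \<Sum>\<sigma> | \<sigma> permutes {1..m}. amp \<nu> \<sigma> \<pi> z * mon x (z \<circ> \<sigma>) * (of_real p * inverse ((z \<circ> \<sigma>) i) + of_real q * (z \<circ> \<sigma>) i))"
    proof (rule sum.cong[OF refl])
      fix i assume "i \<in> {1..m}"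
      then have i: "i \<in> {1..N}" using assms(2) by auto
      show "of_real p * Psi m (dn x i) \<nu> \<pi> z + of_real q * Psi m (up x i) \<nu> \<pi> z =
        (\<Sum>\<sigma> | \<sigma> permutes {1..m}. amp \<nu> \<sigma> \<pi> z * mon x (z \<circ> \<sigma>) * (of_real p * inverse ((z \<circ> \<sigma>) i) + of_real q * (z \<circ> \<sigma>) i))"
        unfolding Psi_def sum_distrib_left sum.distrib[symmetric]
        by (rule sum.cong[OF refl])
          (simp add: mon_up[OF z i permutes_le[OF _ assms(2)]] mon_dn[OF z i permutes_le[OF _ assms(2)]] algebra_simps del: One_nat_def)
    qed
    also have "\<dots> = (\<Sum>\<sigma> | \<sigma> permutes {1..m}. amp \<nu> \<sigma> \<pi> z * mon x (z \<circ> \<sigma>) * energy m (z \<circ> \<sigma>))"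
      unfolding energy_def sum_distrib_left by (rule sum.swap)
    also have "\<dots> = energy m z * Psi m x \<nu> \<pi> z"
      unfolding Psi_def sum_distrib_left by (rule sum.cong) (auto simp: energy_permute mult_ac simp del: One_nat_def)
    finally show ?thesis .
  qed
  have "(\<Sum>i\<in>{1..m}. of_real p * coef g m (dn x i) y \<nu> \<pi> + of_real q * coef g m (up x i) y \<nu> \<pi>)
    = CT (\<lambda>z. \<Sum>i\<in>{1..m}. of_real p * (g z * Psi m (dn x i) \<nu> \<pi> z * ?m z) + of_real q * (g z * Psi m (up x i) \<nu> \<pi> z * ?m z))"
    unfolding coef_def
    by (subst CT_sum, intro nice_add nice_mult[OF nice_const] n)
      (simp only: CT_add CT_mult nice_mult[OF nice_const] n)
  also have "\<dots> = coef (\<lambda>z. g z * energy m z) m x y \<nu> \<pi>"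
    unfolding coef_def
  proof (rule CT_cong)
    fix z assume z: "z \<in> space TM"
    have "(\<Sum>i\<in>{1..m}. of_real p * (g z * Psi m (dn x i) \<nu> \<pi> z * ?m z) + of_real q * (g z * Psi m (up x i) \<nu> \<pi> z * ?m z))
      = (g z * ?m z) * (\<Sum>i\<in>{1..m}. of_real p * Psi m (dn x i) \<nu> \<pi> z + of_real q * Psi m (up x i) \<nu> \<pi> z)"
      unfolding sum_distrib_left by (rule sum.cong) (auto simp: algebra_simps)
    then show "(\<Sum>i\<in>{1..m}. of_real p * (g z * Psi m (dn x i) \<nu> \<pi> z * ?m z) + of_real q * (g z * Psi m (up x i) \<nu> \<pi> z * ?m z))
      = g z * energy m z * Psi m x \<nu> \<pi> z * ?m z"
      unfolding Psi[OF z] by (simp add: mult_ac)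
  qed
  finally show ?thesis .
qed

lemma coef_free_y:
  assumes g: "nice g" and "m \<le> N" "\<nu> \<in> Sp" "\<pi> \<in> Sp"
  shows "(\<Sum>i\<in>{1..m}. of_real q * coef g m x (dn y i) \<nu> \<pi> + of_real p * coef g m x (up y i) \<nu> \<pi>)
    = coef (\<lambda>z. g z * energy m z) m x y \<nu> \<pi>"
proof -
  note n = nice_integrand[OF assms]
  let ?I = "\<lambda>y z. g z * Psi m x \<nu> \<pi> z * mon (\<lambda>i. - y i) z"
  have "(\<Sum>i\<in>{1..m}. of_real q * coef g m x (dn y i) \<nu> \<pi> + of_real p * coef g m x (up y i) \<nu> \<pi>)
    = CT (\<lambda>z. \<Sum>i\<in>{1..m}. of_real q * ?I (dn y i) z + of_real p * ?I (up y i) z)"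
    unfolding coef_def
    by (subst CT_sum, intro nice_add nice_mult[OF nice_const] n)
      (simp only: CT_add CT_mult nice_mult[OF nice_const] n)
  also have "\<dots> = coef (\<lambda>z. g z * energy m z) m x y \<nu> \<pi>"
    unfolding coef_def
  proof (rule CT_cong)
    fix z assume z: "z \<in> space TM"
    have "(\<Sum>i\<in>{1..m}. of_real q * ?I (dn y i) z + of_real p * ?I (up y i) z)
      = (\<Sum>i\<in>{1..m}. ?I y z * (of_real p * inverse (z i) + of_real q * z i))"
    proof (rule sum.cong[OF refl])
      fix i assume "i \<in> {1..m}"
      then have i: "i \<in> {1..N}" using assms(2) by auto
      show "of_real q * ?I (dn y i) z + of_real p * ?I (up y i) z = ?I y z * (of_real p * inverse (z i) + of_real q * z i)"
        unfolding mon_uminus_up[OF z i] mon_uminus_dn[OF z i] by (simp add: algebra_simps)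
    qed
    then show "(\<Sum>i\<in>{1..m}. of_real q * ?I (dn y i) z + of_real p * ?I (up y i) z)
      = g z * energy m z * Psi m x \<nu> \<pi> z * mon (\<lambda>i. - y i) z"
      unfolding sum_distrib_left[symmetric] energy_def[symmetric] by (simp add: mult_ac)
  qed
  finally show ?thesis .
qed

text \<open>The free equation contains moves onto a wall, which correspond to no configuration; the
  boundary condition expresses each pair of them through values inside the chamber.\<close>

lemma coef_backward:
  assumes g: "nice g" and "m \<le> N" "\<nu> \<in> Sp" "\<pi> \<in> Sp" and y: "incr m y"
    and sym: "\<And>z k. z \<in> space TM \<Longrightarrow> k \<in> {1..<m} \<Longrightarrow> g (z \<circ> adjswap k) = g z"
  shows "coef (\<lambda>z. g z * energy m z) m x y \<nu> \<pi> =
    (\<Sum>i\<in>{1..m}. (if incr m (dn y i) then of_real q * coef g m x (dn y i) \<nu> \<pi> else 0)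
       + (if incr m (up y i) then of_real p * coef g m x (up y i) \<nu> \<pi> else 0))
    + (\<Sum>k\<in>adj m y. coef g m x y \<nu> \<pi> + hkT k (\<lambda>\<nu>. coef g m x y \<nu> \<pi>) \<nu>)"
proof -
  have "(\<Sum>k\<in>adj m y. of_real q * coef g m x (dn y (Suc k)) \<nu> \<pi> + of_real p * coef g m x (up y k) \<nu> \<pi>)
    = (\<Sum>k\<in>adj m y. coef g m x y \<nu> \<pi> + hkT k (\<lambda>\<nu>. coef g m x y \<nu> \<pi>) \<nu>)"
  proof (rule sum.cong[OF refl])
    fix k assume k: "k \<in> adj m y"
    then have "\<And>z. z \<in> space TM \<Longrightarrow> g (z \<circ> adjswap k) = g z" using sym by (auto simp: adj_def)
    from coef_y_boundary[OF assms(1-4) k this, of x]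
    show "of_real q * coef g m x (dn y (Suc k)) \<nu> \<pi> + of_real p * coef g m x (up y k) \<nu> \<pi>
      = coef g m x y \<nu> \<pi> + hkT k (\<lambda>\<nu>. coef g m x y \<nu> \<pi>) \<nu>" by (simp add: add.commute)
  qed
  then show ?thesis
    unfolding coef_free_y[OF assms(1-4), symmetric] sum_free_split[OF y, of _ "\<lambda>y. coef g m x y \<nu> \<pi>"] by simp
qed

lemma coef_forward:
  assumes g: "nice g" and "m \<le> N" "\<nu> \<in> Sp" "\<pi> \<in> Sp" and x: "incr m x"
  shows "coef (\<lambda>z. g z * energy m z) m x y \<nu> \<pi> =
    (\<Sum>i\<in>{1..m}. (if incr m (dn x i) then of_real p * coef g m (dn x i) y \<nu> \<pi> else 0)
       + (if incr m (up x i) then of_real q * coef g m (up x i) y \<nu> \<pi> else 0))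
    + (\<Sum>k\<in>adj m x. coef g m x y \<nu> \<pi> + hk k (\<lambda>\<pi>. coef g m x y \<nu> \<pi>) \<pi>)"
proof -
  have "(\<Sum>k\<in>adj m x. of_real p * coef g m (dn x (Suc k)) y \<nu> \<pi> + of_real q * coef g m (up x k) y \<nu> \<pi>)
    = (\<Sum>k\<in>adj m x. coef g m x y \<nu> \<pi> + hk k (\<lambda>\<pi>. coef g m x y \<nu> \<pi>) \<pi>)"
    by (rule sum.cong[OF refl]) (rule coef_x_boundary[OF assms(1-4)])
  then show ?thesis
    unfolding coef_free_x[OF assms(1-4), symmetric] sum_free_split[OF x, of _ "\<lambda>x. coef g m x y \<nu> \<pi>"] by simp
qed

end

section \<open>The initial condition\<close>

context bethe
begin

definition mode :: "(nat \<Rightarrow> nat) \<Rightarrow> (nat \<Rightarrow> int) \<Rightarrow> (nat \<Rightarrow> int) \<Rightarrow> (nat \<Rightarrow> nat) \<Rightarrow> (nat \<Rightarrow> nat) \<Rightarrow> complex" where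
  "mode \<sigma> x y \<nu> \<pi> = CT (\<lambda>z. amp \<nu> \<sigma> \<pi> z * (mon x (z \<circ> \<sigma>) * mon (\<lambda>i. - y i) z))"

lemma nice_mode:
  "\<sigma> permutes {1..N} \<Longrightarrow> \<nu> \<in> Sp \<Longrightarrow> \<pi> \<in> Sp \<Longrightarrow> nice (\<lambda>z. amp \<nu> \<sigma> \<pi> z * (mon x (z \<circ> \<sigma>) * mon (\<lambda>i. - y i) z))"
  by (intro nice_mult nice_amp nice_mon nice_mon_comp)

lemma coef_eq_sum_mode:
  assumes "m \<le> N" "\<nu> \<in> Sp" "\<pi> \<in> Sp"
  shows "coef (\<lambda>_. 1) m x y \<nu> \<pi> = (\<Sum>\<sigma> | \<sigma> permutes {1..m}. mode \<sigma> x y \<nu> \<pi>)"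
proof -
  have "coef (\<lambda>_. 1) m x y \<nu> \<pi> = CT (\<lambda>z. \<Sum>\<sigma> | \<sigma> permutes {1..m}. amp \<nu> \<sigma> \<pi> z * (mon x (z \<circ> \<sigma>) * mon (\<lambda>i. - y i) z))"
    unfolding coef_def Psi_def by (simp add: sum_distrib_right mult.assoc)
  also have "\<dots> = (\<Sum>\<sigma> | \<sigma> permutes {1..m}. mode \<sigma> x y \<nu> \<pi>)"
    unfolding mode_def by (rule CT_sum) (use nice_mode permutes_le assms in blast)
  finally show ?thesis .
qed

lemma mon_decomp:
  assumes "\<sigma> permutes {1..N}" "i \<in> {1..N}" "\<zeta> \<noteq> 0"
  shows "mon x ((z(\<sigma> i := \<zeta>)) \<circ> \<sigma>) * mon (\<lambda>i. - y i) (z(\<sigma> i := \<zeta>)) =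
    \<zeta> powi (x i - y (\<sigma> i)) * ((\<Prod>l\<in>{1..N} - {i}. z (\<sigma> l) powi x l) * (\<Prod>l\<in>{1..N} - {\<sigma> i}. z l powi - y l))"
proof -
  have \<sigma>i: "\<sigma> i \<in> {1..N}" using permutes_in_image[OF assms(1)] assms(2) by blast
  have ne: "\<sigma> l \<noteq> \<sigma> i" if "l \<noteq> i" for l using that permutes_inj[OF assms(1)] by (auto dest: injD)
  have "mon x ((z(\<sigma> i := \<zeta>)) \<circ> \<sigma>) = \<zeta> powi x i * (\<Prod>l\<in>{1..N} - {i}. z (\<sigma> l) powi x l)"
    unfolding mon_def by (subst prod.remove[OF _ assms(2)]) (auto intro!: prod.cong simp: ne)
  moreover have "mon (\<lambda>i. - y i) (z(\<sigma> i := \<zeta>)) = \<zeta> powi - y (\<sigma> i) * (\<Prod>l\<in>{1..N} - {\<sigma> i}. z l powi - y l)"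
    unfolding mon_def by (subst prod.remove[OF _ \<sigma>i]) (auto intro!: prod.cong)
  ultimately show ?thesis using assms(3) by (simp add: power_int_diff power_int_minus divide_inverse mult_ac)
qed

text \<open>In the variable \<xi>_(\<sigma>(i)) the amplitude has no pole, so on the circle the
  integrand agrees with a holomorphic function that vanishes at the origin to order at least x_i -
  y_(\<sigma>(i)).\<close>

lemma mode_eq_0:
  assumes \<sigma>: "\<sigma> permutes {1..N}" and "\<nu> \<in> Sp" "\<pi> \<in> Sp" and i: "i \<in> {1..N}" "x i > y (\<sigma> i)"
  shows "mode \<sigma> x y \<nu> \<pi> = 0"
  unfolding mode_def
proof (rule CT_eq_0_coord[OF nice_mode[OF assms(1-3)]])
  show "\<sigma> i \<in> {1..N}" using permutes_in_image[OF \<sigma>] i(1) by blast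
  fix z assume z: "z \<in> space TM"
  define C where "C = (\<Prod>l\<in>{1..N} - {i}. z (\<sigma> l) powi x l) * (\<Prod>l\<in>{1..N} - {\<sigma> i}. z l powi - y l)"
  define n where "n = nat (x i - y (\<sigma> i))"
  have n: "n > 0" "x i - y (\<sigma> i) = int n" using i(2) by (auto simp: n_def)
  let ?g = "\<lambda>\<zeta>. amp \<nu> \<sigma> \<pi> (z(\<sigma> i := \<zeta>)) * (\<zeta> ^ n * C)"
  have "(\<integral>\<zeta>. amp \<nu> \<sigma> \<pi> (z(\<sigma> i := \<zeta>)) * (mon x ((z(\<sigma> i := \<zeta>)) \<circ> \<sigma>) * mon (\<lambda>i. - y i) (z(\<sigma> i := \<zeta>))) \<partial>circle_measure r) = ?g 0"
  proof (rule integral_circle_holomorphic[OF r_pos r_less])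
    show "?g holomorphic_on ball 0 (p / 4)"
      by (intro holomorphic_intros amp_holomorphic assms(1-3) TM_polydisc z)
    fix \<zeta> assume "cmod \<zeta> = r"
    then have "\<zeta> \<noteq> 0" using r_pos by auto
    from mon_decomp[OF \<sigma> i(1) this, of x z y]
    show "amp \<nu> \<sigma> \<pi> (z(\<sigma> i := \<zeta>)) * (mon x ((z(\<sigma> i := \<zeta>)) \<circ> \<sigma>) * mon (\<lambda>i. - y i) (z(\<sigma> i := \<zeta>))) = ?g \<zeta>"
      unfolding n(2) C_def by simp
  qed
  then show "(\<integral>\<zeta>. amp \<nu> \<sigma> \<pi> (z(\<sigma> i := \<zeta>)) * (mon x ((z(\<sigma> i := \<zeta>)) \<circ> \<sigma>) * mon (\<lambda>i. - y i) (z(\<sigma> i := \<zeta>))) \<partial>circle_measure r) = 0"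
    using n(1) by simp
qed

lemma mode_id:
  assumes "\<nu> \<in> Sp" "\<pi> \<in> Sp"
  shows "mode id x y \<nu> \<pi> = (if (\<forall>i\<in>{1..N}. x i = y i) \<and> \<pi> = \<nu> then 1 else 0)"
proof -
  have mon: "mon x z * mon (\<lambda>i. - y i) z = (\<Prod>i\<in>{1..N}. z i powi (x i - y i))" if "z \<in> space TM" for z
    unfolding mon_def prod.distrib[symmetric]
    by (rule prod.cong) (use TM_nonzero[OF that] in \<open>auto simp: power_int_diff power_int_minus divide_inverse\<close>)
  have "mode id x y \<nu> \<pi> = CT (\<lambda>z. (if \<pi> = \<nu> then 1 else 0) * (\<Prod>i\<in>{1..N}. z i powi (x i - y i)))"
    unfolding mode_def by (rule CT_cong) (simp only: amp_id[OF assms] comp_id mon)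
  also have "\<dots> = (if (\<forall>i\<in>{1..N}. x i = y i) \<and> \<pi> = \<nu> then 1 else 0)"
  proof (cases "\<forall>i\<in>{1..N}. x i = y i")
    case True
    then have "(\<Prod>i\<in>{1..N}. z i powi (x i - y i)) = 1" for z :: "nat \<Rightarrow> complex"
      by (intro prod.neutral) auto
    then show ?thesis using True by simp
  next
    case False
    then obtain i where i: "i \<in> {1..N}" "x i - y i \<noteq> 0" by auto
    show ?thesis unfolding CT_monomial[of "\<lambda>i. x i - y i", OF i(2,1)] using False by simp
  qed
  finally show ?thesis .
qed

text \<open>The K of the overview, with permutations of the first m indices only. For every m,
  \<open>mode id\<close> is the delta in all N coordinates and in the species.\<close>

definition defect :: "nat \<Rightarrow> (nat \<Rightarrow> int) \<Rightarrow> (nat \<Rightarrow> int) \<Rightarrow> (nat \<Rightarrow> nat) \<Rightarrow> (nat \<Rightarrow> nat) \<Rightarrow> complex" where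
  "defect m x y \<nu> \<pi> = coef (\<lambda>_. 1) m x y \<nu> \<pi> - mode id x y \<nu> \<pi>"

lemma defect_eq_sum:
  assumes "m \<le> N" "\<nu> \<in> Sp" "\<pi> \<in> Sp"
  shows "defect m x y \<nu> \<pi> = (\<Sum>\<sigma> | \<sigma> permutes {1..m} \<and> \<sigma> \<noteq> id. mode \<sigma> x y \<nu> \<pi>)"
proof -
  have "{\<sigma>. \<sigma> permutes {1..m}} = insert id {\<sigma>. \<sigma> permutes {1..m} \<and> \<sigma> \<noteq> id}"
    using permutes_id by blast
  moreover have "finite {\<sigma>. \<sigma> permutes {1..m} \<and> \<sigma> \<noteq> id}"
    using finite_permutations[of "{1..m}"] by (rule finite_subset[rotated]) auto
  ultimately show ?thesis unfolding defect_def coef_eq_sum_mode[OF assms] by simp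
qed

text \<open>Pigeonhole principle: {i..m} does not inject into {i+1..m}.\<close>

lemma permutes_small_image:
  fixes i m :: nat
  assumes "\<sigma> permutes {1..m}" "1 \<le> i" "i \<le> m"
  obtains l where "i \<le> l" "l \<le> m" "\<sigma> l \<le> i"
proof (rule ccontr)
  assume "\<not> thesis"
  then have "\<sigma> ` {i..m} \<subseteq> {Suc i..m}"
    using that permutes_in_image[OF assms(1)] assms(2) by (fastforce simp: not_le Suc_le_eq)
  then have "card (\<sigma> ` {i..m}) \<le> card {Suc i..m}" by (intro card_mono) auto
  moreover have "card (\<sigma> ` {i..m}) = card {i..m}"
    using permutes_inj_on[OF assms(1)] by (rule card_image)
  ultimately show False using assms(3) by simp
qed

text \<open>Every \<sigma> maps some l >= i to a value <= i, and then x_l >= x_i > y_i >=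
  y_(\<sigma>(l)) kills its term.\<close>

lemma defect_eq_0_gt:
  assumes "m \<le> N" "\<nu> \<in> Sp" "\<pi> \<in> Sp" and x: "incr m x" and y: "incr m y" and i: "i \<in> {1..m}" "x i > y i"
  shows "defect m x y \<nu> \<pi> = 0"
  unfolding defect_eq_sum[OF assms(1-3)]
proof (rule sum.neutral, clarify)
  fix \<sigma> assume \<sigma>: "\<sigma> permutes {1..m}"
  obtain l where l: "i \<le> l" "l \<le> m" "\<sigma> l \<le> i" using permutes_small_image[OF \<sigma>] i by auto
  have "1 \<le> \<sigma> l" using permutes_range[OF \<sigma>, of l] l i by auto
  then have "y (\<sigma> l) \<le> y i" using incr_le[OF y _ l(3)] i by auto
  moreover have "x i \<le> x l" using incr_le[OF x _ l(1,2)] i by auto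
  ultimately show "mode \<sigma> x y \<nu> \<pi> = 0"
    using i l assms(1) by (intro mode_eq_0[where i = l] permutes_le[OF \<sigma>] assms(2,3)) auto
qed

text \<open>A permutation that moves m + 1 sends it to some j <= m, and the positive exponent
  x_(m+1) - y_j kills its term.\<close>

lemma defect_far:
  assumes "Suc m \<le> N" "\<nu> \<in> Sp" "\<pi> \<in> Sp" and far: "\<And>j. j \<in> {1..m} \<Longrightarrow> y j < x (Suc m)"
  shows "defect (Suc m) x y \<nu> \<pi> = defect m x y \<nu> \<pi>"
proof -
  have "(\<Sum>\<sigma> | \<sigma> permutes {1..m} \<and> \<sigma> \<noteq> id. mode \<sigma> x y \<nu> \<pi>) = (\<Sum>\<sigma> | \<sigma> permutes {1..Suc m} \<and> \<sigma> \<noteq> id. mode \<sigma> x y \<nu> \<pi>)"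
  proof (rule sum.mono_neutral_left)
    show "finite {\<sigma>. \<sigma> permutes {1..Suc m} \<and> \<sigma> \<noteq> id}"
      using finite_permutations[of "{1..Suc m}"] by (rule finite_subset[rotated]) auto
    show "{\<sigma>. \<sigma> permutes {1..m} \<and> \<sigma> \<noteq> id} \<subseteq> {\<sigma>. \<sigma> permutes {1..Suc m} \<and> \<sigma> \<noteq> id}"
      using permutes_le[of _ m "Suc m"] by auto
    show "\<forall>\<sigma>\<in>{\<sigma>. \<sigma> permutes {1..Suc m} \<and> \<sigma> \<noteq> id} - {\<sigma>. \<sigma> permutes {1..m} \<and> \<sigma> \<noteq> id}. mode \<sigma> x y \<nu> \<pi> = 0"
    proof
      fix \<sigma> assume \<sigma>: "\<sigma> \<in> {\<sigma>. \<sigma> permutes {1..Suc m} \<and> \<sigma> \<noteq> id} - {\<sigma>. \<sigma> permutes {1..m} \<and> \<sigma> \<noteq> id}"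
      then have perm: "\<sigma> permutes {1..Suc m}" by blast
      have "\<sigma> (Suc m) \<noteq> Suc m"
      proof
        assume "\<sigma> (Suc m) = Suc m"
        then have "\<sigma> permutes {1..m}"
          by (intro permutes_superset[OF perm]) (auto simp: le_Suc_eq)
        then show False using \<sigma> by blast
      qed
      moreover have "\<sigma> (Suc m) \<in> {1..Suc m}" using permutes_range[OF perm] by auto
      ultimately have "y (\<sigma> (Suc m)) < x (Suc m)" by (intro far) auto
      then show "mode \<sigma> x y \<nu> \<pi> = 0"
        using assms(1) by (intro mode_eq_0[where i = "Suc m"] permutes_le[OF perm] assms(2,3)) auto
    qed
  qed
  then show ?thesis using assms defect_eq_sum[of m] defect_eq_sum[of "Suc m"] by simp
qed

text \<open>One attempt of each of the m particles, weighted by its probability and seen from the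
  target. The sum over \<open>adj\<close> gathers the attempts across adjacent pairs, exchanges and
  blocked attempts alike. The diagonal part -m of the generator is left out.\<close>

definition forward :: "nat \<Rightarrow> ((nat \<Rightarrow> int) \<Rightarrow> (nat \<Rightarrow> nat) \<Rightarrow> complex) \<Rightarrow> (nat \<Rightarrow> int) \<Rightarrow> (nat \<Rightarrow> nat) \<Rightarrow> complex" where
  "forward m F x \<pi> = (\<Sum>i\<in>{1..m}. (if incr m (dn x i) then of_real p * F (dn x i) \<pi> else 0)
       + (if incr m (up x i) then of_real q * F (up x i) \<pi> else 0))
    + (\<Sum>k\<in>adj m x. F x \<pi> + hk k (F x) \<pi>)"

definition backward :: "nat \<Rightarrow> ((nat \<Rightarrow> int) \<Rightarrow> (nat \<Rightarrow> nat) \<Rightarrow> complex) \<Rightarrow> (nat \<Rightarrow> int) \<Rightarrow> (nat \<Rightarrow> nat) \<Rightarrow> complex" where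
  "backward m F y \<nu> = (\<Sum>i\<in>{1..m}. (if incr m (dn y i) then of_real q * F (dn y i) \<nu> else 0)
       + (if incr m (up y i) then of_real p * F (up y i) \<nu> else 0))
    + (\<Sum>k\<in>adj m y. F y \<nu> + hkT k (F y) \<nu>)"

lemma forward_diff: "forward m (\<lambda>x \<pi>. F x \<pi> - G x \<pi>) x \<pi> = forward m F x \<pi> - forward m G x \<pi>"
proof -
  let ?t = "\<lambda>F i. (if incr m (dn x i) then of_real p * F (dn x i) \<pi> else 0)
       + (if incr m (up x i) then of_real q * F (up x i) \<pi> else 0)"
  have "(\<Sum>i\<in>{1..m}. ?t (\<lambda>x \<pi>. F x \<pi> - G x \<pi>) i) = (\<Sum>i\<in>{1..m}. ?t F i) - (\<Sum>i\<in>{1..m}. ?t G i)"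
    unfolding sum_subtractf[symmetric] by (rule sum.cong) (auto simp: algebra_simps)
  moreover have "(\<Sum>k\<in>adj m x. (F x \<pi> - G x \<pi>) + hk k (\<lambda>\<pi>. F x \<pi> - G x \<pi>) \<pi>)
    = (\<Sum>k\<in>adj m x. F x \<pi> + hk k (F x) \<pi>) - (\<Sum>k\<in>adj m x. G x \<pi> + hk k (G x) \<pi>)"
    unfolding sum_subtractf[symmetric] by (rule sum.cong) (auto simp: hecke_def algebra_simps)
  ultimately show ?thesis unfolding forward_def by simp
qed

lemma backward_diff: "backward m (\<lambda>x \<pi>. F x \<pi> - G x \<pi>) x \<pi> = backward m F x \<pi> - backward m G x \<pi>"
proof -
  let ?t = "\<lambda>F i. (if incr m (dn x i) then of_real q * F (dn x i) \<pi> else 0)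
       + (if incr m (up x i) then of_real p * F (up x i) \<pi> else 0)"
  have "(\<Sum>i\<in>{1..m}. ?t (\<lambda>x \<pi>. F x \<pi> - G x \<pi>) i) = (\<Sum>i\<in>{1..m}. ?t F i) - (\<Sum>i\<in>{1..m}. ?t G i)"
    unfolding sum_subtractf[symmetric] by (rule sum.cong) (auto simp: algebra_simps)
  moreover have "(\<Sum>k\<in>adj m x. (F x \<pi> - G x \<pi>) + hkT k (\<lambda>\<pi>. F x \<pi> - G x \<pi>) \<pi>)
    = (\<Sum>k\<in>adj m x. F x \<pi> + hkT k (F x) \<pi>) - (\<Sum>k\<in>adj m x. G x \<pi> + hkT k (G x) \<pi>)"
    unfolding sum_subtractf[symmetric] by (rule sum.cong) (auto simp: hecke_transpose_def algebra_simps)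
  ultimately show ?thesis unfolding backward_def by simp
qed

text \<open>The delta kernel is an identity matrix, and \<open>forward\<close> and
  \<open>backward\<close> are transposes of each other.\<close>

lemma mode_id_intertwines:
  assumes "m \<le> N" and Sp: "\<nu> \<in> Sp" "\<pi> \<in> Sp" and x: "incr m x" and y: "incr m y"
  shows "forward m (\<lambda>x \<pi>. mode id x y \<nu> \<pi>) x \<pi> = backward m (\<lambda>y \<nu>. mode id x y \<nu> \<pi>) y \<nu>"
proof -
  define eq :: "(nat \<Rightarrow> int) \<Rightarrow> (nat \<Rightarrow> int) \<Rightarrow> bool" where "eq x y \<longleftrightarrow> (\<forall>i\<in>{1..N}. x i = y i)" for x y
  have D: "mode id x y \<nu> \<pi> = (if eq x y \<and> \<pi> = \<nu> then 1 else 0)" if "\<nu> \<in> Sp" "\<pi> \<in> Sp" for x y \<nu> \<pi>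
    using mode_id[OF that] by (simp add: eq_def)
  have incr_eq: "incr m x \<longleftrightarrow> incr m y" if "eq x y" for x y
    using that assms(1) unfolding incr_def eq_def by auto
  have shift: "eq (dn x i) y \<longleftrightarrow> eq x (up y i)" "eq (up x i) y \<longleftrightarrow> eq x (dn y i)" for i
    unfolding eq_def up_def dn_def by (auto split: if_splits; fastforce)+
  have 1: "(if incr m (dn x i) then of_real p * mode id (dn x i) y \<nu> \<pi> else 0)
     + (if incr m (up x i) then of_real q * mode id (up x i) y \<nu> \<pi> else 0)
    = (if incr m (dn y i) then of_real q * mode id x (dn y i) \<nu> \<pi> else 0)
     + (if incr m (up y i) then of_real p * mode id x (up y i) \<nu> \<pi> else 0)" for i
    using incr_eq[of "dn x i" y] incr_eq[of "up x i" y] incr_eq[of x "dn y i"] incr_eq[of x "up y i"] x y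
    unfolding D[OF Sp] by (auto simp: shift)
  have 2: "(\<Sum>k\<in>adj m x. mode id x y \<nu> \<pi> + hk k (\<lambda>\<pi>. mode id x y \<nu> \<pi>) \<pi>)
    = (\<Sum>k\<in>adj m y. mode id x y \<nu> \<pi> + hkT k (\<lambda>\<nu>. mode id x y \<nu> \<pi>) \<nu>)"
  proof -
    have h: "hk k (\<lambda>\<pi>. mode id x y \<nu> \<pi>) \<pi> = (if eq x y then hk k (\<lambda>\<pi>. if \<pi> = \<nu> then 1 else 0) \<pi> else 0)"
      "hkT k (\<lambda>\<nu>. mode id x y \<nu> \<pi>) \<nu> = (if eq x y then hkT k (\<lambda>\<nu>. if \<pi> = \<nu> then 1 else 0) \<nu> else 0)"
      if "1 \<le> k" "k < m" for k
    proof -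
      have kN: "k < N" using that assms(1) by simp
      note T = T_Sp[OF Sp(1) that(1) kN] T_Sp[OF Sp(2) that(1) kN]
      show "hk k (\<lambda>\<pi>. mode id x y \<nu> \<pi>) \<pi> = (if eq x y then hk k (\<lambda>\<pi>. if \<pi> = \<nu> then 1 else 0) \<pi> else 0)"
        unfolding hecke_def D[OF Sp(1) Sp(2)] D[OF Sp(1) T(2)] by simp
      show "hkT k (\<lambda>\<nu>. mode id x y \<nu> \<pi>) \<nu> = (if eq x y then hkT k (\<lambda>\<nu>. if \<pi> = \<nu> then 1 else 0) \<nu> else 0)"
        unfolding hecke_transpose_def D[OF Sp(1) Sp(2)] D[OF T(1) Sp(2)] by simp
    qed
    show ?thesis
    proof (cases "eq x y")
      case True
      then have "adj m x = adj m y" using assms(1) unfolding adj_def eq_def by auto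
      then show ?thesis using True h by (intro sum.cong) (auto simp: adj_def hecke_delta)
    next
      case False
      have "(\<Sum>k\<in>adj m x. mode id x y \<nu> \<pi> + hk k (\<lambda>\<pi>. mode id x y \<nu> \<pi>) \<pi>) = 0"
        by (rule sum.neutral) (use False h in \<open>auto simp: D[OF Sp] adj_def\<close>)
      moreover have "(\<Sum>k\<in>adj m y. mode id x y \<nu> \<pi> + hkT k (\<lambda>\<nu>. mode id x y \<nu> \<pi>) \<nu>) = 0"
        by (rule sum.neutral) (use False h in \<open>auto simp: D[OF Sp] adj_def\<close>)
      ultimately show ?thesis by simp
    qed
  qed
  show ?thesis unfolding forward_def backward_def 2 by (simp only: 1)
qed

text \<open>For g = 1 both recursions compute the same quantity, the constant term with the factor
  \<open>energy m\<close>.\<close>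

lemma defect_intertwines:
  assumes "m \<le> N" "\<nu> \<in> Sp" "\<pi> \<in> Sp" "incr m x" "incr m y"
  shows "forward m (\<lambda>x \<pi>. defect m x y \<nu> \<pi>) x \<pi> = backward m (\<lambda>y \<nu>. defect m x y \<nu> \<pi>) y \<nu>"
proof -
  have "forward m (\<lambda>x \<pi>. coef (\<lambda>_. 1) m x y \<nu> \<pi>) x \<pi> = backward m (\<lambda>y \<nu>. coef (\<lambda>_. 1) m x y \<nu> \<pi>) y \<nu>"
    unfolding forward_def backward_def
    by (simp only: coef_forward[OF nice_const assms(1-4), symmetric] coef_backward[OF nice_const assms(1-3,5) refl, symmetric])
  then show ?thesis
    unfolding defect_def forward_diff backward_diff mode_id_intertwines[OF assms] by simp
qed

section \<open>Displacement orders and the vanishing of the defect\<close>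

definition shape :: "nat \<Rightarrow> (nat \<Rightarrow> int) \<Rightarrow> (nat \<Rightarrow> int) \<Rightarrow> (nat \<Rightarrow> int) \<Rightarrow> int" where
  "shape m c x y = (\<Sum>l\<in>{1..m}. c l * (y l - x l))"

abbreviation "grade m \<equiv> shape m (\<lambda>_. 1)"
text \<open>The weights fall to 0 at the last particle. Transferring a unit of displacement from
  particle m to an earlier one keeps the grade and raises the tilt, while a change at particle m
  alone does not affect the tilt.\<close>

abbreviation "tilt m \<equiv> shape m (\<lambda>i. int (m - i))"

lemma shape_shift:
  assumes "i \<in> {1..m}"
  shows "shape m c (up x i) y = shape m c x y - c i" "shape m c (dn x i) y = shape m c x y + c i"
    "shape m c x (up y i) = shape m c x y + c i" "shape m c x (dn y i) = shape m c x y - c i"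
  using assms
  by (simp_all add: shape_def sum.remove[of "{1..m}" i] up_def dn_def algebra_simps del: One_nat_def)

text \<open>At (x + e_n, y) the grade is one less than at (x, y). Raising x or lowering y lowers it
  further; the wall terms keep it; lowering x_i or raising y_i with i \<noteq> n restores the grade
  and raises the tilt by n - i. Only the move of particle n survives on each side, with the same
  factor p > 0.\<close>

lemma defect_eq_0_step:
  assumes n: "n \<in> {1..N}" and Sp: "\<nu> \<in> Sp" "\<pi> \<in> Sp" and x: "incr n x" and y: "incr n y"
    and less: "\<And>x' y' \<nu> \<pi>. incr n x' \<Longrightarrow> incr n y' \<Longrightarrow> \<nu> \<in> Sp \<Longrightarrow> \<pi> \<in> Sp \<Longrightarrow> grade n x' y' < grade n x y \<Longrightarrow> defect n x' y' \<nu> \<pi> = 0"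
    and tilted: "\<And>x' y' \<nu> \<pi>. incr n x' \<Longrightarrow> incr n y' \<Longrightarrow> \<nu> \<in> Sp \<Longrightarrow> \<pi> \<in> Sp \<Longrightarrow> grade n x' y' = grade n x y \<Longrightarrow>
      tilt n x' y' > tilt n x y \<Longrightarrow> defect n x' y' \<nu> \<pi> = 0"
  shows "defect n x y \<nu> \<pi> = defect n (up x n) (up y n) \<nu> \<pi>"
proof -
  let ?x = "up x n"
  have nn: "n \<in> {1..n}" "n \<le> N" using n by auto
  have top: "n \<notin> adj n z" for z by (simp add: adj_def)
  have x': "incr n ?x" and y': "incr n (up y n)" using incr_up_iff x y top by auto
  note sh = shape_shift[OF nn(1)] shape_shift
  have zero: "defect n ?x y \<nu>' \<pi>' = 0" if "\<nu>' \<in> Sp" "\<pi>' \<in> Sp" for \<nu>' \<pi>'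
    by (rule less[OF x' y that]) (simp add: sh(1))
  have "forward n (\<lambda>x \<pi>. defect n x y \<nu> \<pi>) ?x \<pi> = of_real p * defect n x y \<nu> \<pi>"
  proof -
    have "(if incr n (dn ?x i) then of_real p * defect n (dn ?x i) y \<nu> \<pi> else 0)
       + (if incr n (up ?x i) then of_real q * defect n (up ?x i) y \<nu> \<pi> else 0)
       = (if i = n then of_real p * defect n x y \<nu> \<pi> else 0)" if i: "i \<in> {1..n}" for i
    proof -
      have "defect n (up ?x i) y \<nu> \<pi> = 0" if "incr n (up ?x i)"
        by (rule less[OF that y Sp]) (simp add: sh(1) shape_shift[OF i])
      moreover have "defect n (dn ?x i) y \<nu> \<pi> = 0" if "incr n (dn ?x i)" "i \<noteq> n"
        by (rule tilted[OF that(1) y Sp]) (use i that in \<open>auto simp: sh(1) shape_shift[OF i]\<close>)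
      ultimately show ?thesis using x by auto
    qed
    moreover have "(\<Sum>k\<in>adj n ?x. defect n ?x y \<nu> \<pi> + hk k (defect n ?x y \<nu>) \<pi>) = 0"
    proof (rule sum.neutral, rule ballI)
      fix k assume "k \<in> adj n ?x"
      then have k: "1 \<le> k" "k < N" using n by (auto simp: adj_def)
      show "defect n ?x y \<nu> \<pi> + hk k (defect n ?x y \<nu>) \<pi> = 0"
        unfolding hecke_def zero[OF Sp] zero[OF Sp(1) T_Sp[OF Sp(2) k]] by simp
    qed
    ultimately show ?thesis unfolding forward_def using n by simp
  qed
  moreover have "backward n (\<lambda>y \<nu>. defect n ?x y \<nu> \<pi>) y \<nu> = of_real p * defect n ?x (up y n) \<nu> \<pi>"
  proof -
    have "(if incr n (dn y i) then of_real q * defect n ?x (dn y i) \<nu> \<pi> else 0)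
       + (if incr n (up y i) then of_real p * defect n ?x (up y i) \<nu> \<pi> else 0)
       = (if i = n then of_real p * defect n ?x (up y n) \<nu> \<pi> else 0)" if i: "i \<in> {1..n}" for i
    proof -
      have "defect n ?x (dn y i) \<nu> \<pi> = 0" if "incr n (dn y i)"
        by (rule less[OF x' that Sp]) (simp add: sh(1) shape_shift[OF i])
      moreover have "defect n ?x (up y i) \<nu> \<pi> = 0" if "incr n (up y i)" "i \<noteq> n"
        by (rule tilted[OF x' that(1) Sp]) (use i that in \<open>auto simp: sh(1) shape_shift[OF i]\<close>)
      ultimately show ?thesis using y' by auto
    qed
    moreover have "(\<Sum>k\<in>adj n y. defect n ?x y \<nu> \<pi> + hkT k (\<lambda>\<nu>. defect n ?x y \<nu> \<pi>) \<nu>) = 0"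
    proof (rule sum.neutral, rule ballI)
      fix k assume "k \<in> adj n y"
      then have k: "1 \<le> k" "k < N" using n by (auto simp: adj_def)
      show "defect n ?x y \<nu> \<pi> + hkT k (\<lambda>\<nu>. defect n ?x y \<nu> \<pi>) \<nu> = 0"
        unfolding hecke_transpose_def zero[OF Sp] zero[OF T_Sp[OF Sp(1) k] Sp(2)] by simp
    qed
    ultimately show ?thesis unfolding backward_def using n by simp
  qed
  ultimately show ?thesis
    using defect_intertwines[OF nn(2) Sp x' y] p_pos by simp
qed

lemma defect_eq_0:
  assumes "m \<le> N" "incr m x" "incr m y" "\<nu> \<in> Sp" "\<pi> \<in> Sp"
  shows "defect m x y \<nu> \<pi> = 0"
  using assms
proof (induction m arbitrary: x y \<nu> \<pi>)
  case 0
  then show ?case unfolding defect_eq_sum[OF 0(1,4,5)] by simp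
next
  case (Suc m)
  let ?n = "Suc m"
  \<comment> \<open>Outer induction on the grade, inner induction on n * grade - tilt. With
    displacements d_l >= 0 the tilt, the sum of (n - l) d_l, is at most n times the grade, so
    maximality of the tilt becomes well-founded descent.\<close>
  have "\<forall>x y \<nu> \<pi>. incr ?n x \<longrightarrow> incr ?n y \<longrightarrow> \<nu> \<in> Sp \<longrightarrow> \<pi> \<in> Sp \<longrightarrow> nat (grade ?n x y) = g \<longrightarrow>
      nat (int ?n * grade ?n x y - tilt ?n x y) = h \<longrightarrow> defect ?n x y \<nu> \<pi> = 0" for g h
  proof (induction g arbitrary: h rule: less_induct)
    case (less g)
    note IH1 = less.IH
    show ?case
    proof (induction h rule: less_induct)
      case (less h)
      note IH2 = less.IH
      \<comment> \<open>\<open>nat\<close> truncates both measures at 0. This is harmless, since a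
        nonzero defect forces all displacements, and hence both measures, to be nonnegative.\<close>
      have pos: "defect ?n x y \<nu> \<pi> = 0 \<or> 0 \<le> grade ?n x y \<and> tilt ?n x y \<le> int ?n * grade ?n x y"
        if "incr ?n x" "incr ?n y" "\<nu> \<in> Sp" "\<pi> \<in> Sp" for x y \<nu> \<pi>
      proof (cases "\<exists>i\<in>{1..?n}. x i > y i")
        case True
        then show ?thesis using defect_eq_0_gt[OF Suc.prems(1) that(3,4,1,2)] by blast
      next
        case False
        then have d: "0 \<le> y i - x i" if "i \<in> {1..?n}" for i
          using that by (metis diff_ge_0_iff_ge not_le)
        have "tilt ?n x y \<le> (\<Sum>l\<in>{1..?n}. int ?n * (1 * (y l - x l)))"
          unfolding shape_def using d by (intro sum_mono) (auto intro!: mult_right_mono)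
        moreover have "0 \<le> grade ?n x y" unfolding shape_def using d by (intro sum_nonneg) auto
        ultimately show ?thesis by (simp only: shape_def sum_distrib_left simp_thms)
      qed
      show ?case
      proof (intro allI impI)
        fix x y :: "nat \<Rightarrow> int" and \<nu> \<pi> :: "nat \<Rightarrow> nat"
        assume *: "incr ?n x" "incr ?n y" "\<nu> \<in> Sp" "\<pi> \<in> Sp" "nat (grade ?n x y) = g"
          "nat (int ?n * grade ?n x y - tilt ?n x y) = h"
        \<comment> \<open>Translating x_n and y_n together preserves grade and tilt, so the step can
          be iterated with the same induction hypotheses.\<close>
        have step: "defect ?n x' y' \<nu> \<pi> = defect ?n (up x' ?n) (up y' ?n) \<nu> \<pi>"
          if "incr ?n x'" "incr ?n y'" "grade ?n x' y' = grade ?n x y" "tilt ?n x' y' = tilt ?n x y" for x' y'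
        proof (rule defect_eq_0_step)
          fix a b \<mu> \<kappa> assume ab: "incr ?n a" "incr ?n b" "\<mu> \<in> Sp" "\<kappa> \<in> Sp" "grade ?n a b < grade ?n x' y'"
          show "defect ?n a b \<mu> \<kappa> = 0"
          proof (rule ccontr)
            assume nz: "defect ?n a b \<mu> \<kappa> \<noteq> 0"
            then have "0 \<le> grade ?n a b" using pos[OF ab(1-4)] by blast
            then have "nat (grade ?n a b) < g" using ab(5) that(3) *(5) by linarith
            from IH1[OF this] nz ab show False by blast
          qed
        next
          fix a b \<mu> \<kappa> assume ab: "incr ?n a" "incr ?n b" "\<mu> \<in> Sp" "\<kappa> \<in> Sp" "grade ?n a b = grade ?n x' y'"
            "tilt ?n a b > tilt ?n x' y'"
          show "defect ?n a b \<mu> \<kappa> = 0"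
          proof (rule ccontr)
            assume nz: "defect ?n a b \<mu> \<kappa> \<noteq> 0"
            then have "tilt ?n a b \<le> int ?n * grade ?n a b" using pos[OF ab(1-4)] by blast
            then have "nat (int ?n * grade ?n a b - tilt ?n a b) < h"
              using ab(5,6) that(3,4) *(6) by (simp only: ab(5) that(3))
            from IH2[OF this] nz ab that(3) *(5) show False by metis
          qed
        qed (use that * Suc.prems(1) in auto)
        have inc: "incr ?n (z(?n := z ?n + int k))" if "incr ?n z" for z k
          unfolding incr_def
        proof
          fix i assume "i \<in> {1..<?n}"
          moreover from this that have "z i < z (Suc i)" by (simp add: incr_def)
          ultimately show "(z(?n := z ?n + int k)) i < (z(?n := z ?n + int k)) (Suc i)" by auto
        qed
        have up: "up (z(?n := z ?n + int k)) ?n = z(?n := z ?n + int (Suc k))" for z k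
          by (auto simp: up_def fun_eq_iff)
        have iter: "defect ?n x y \<nu> \<pi> = defect ?n (x(?n := x ?n + int k)) (y(?n := y ?n + int k)) \<nu> \<pi>" for k
        proof (induction k)
          case (Suc k)
          let ?x = "x(?n := x ?n + int k)" and ?y = "y(?n := y ?n + int k)"
          have "incr ?n ?x" "incr ?n ?y" using *(1,2) inc by blast+
          moreover have "shape ?n c ?x ?y = shape ?n c x y" for c
            unfolding shape_def by (rule sum.cong) auto
          ultimately have "defect ?n ?x ?y \<nu> \<pi> = defect ?n (up ?x ?n) (up ?y ?n) \<nu> \<pi>" by (intro step) auto
          then show ?case unfolding up using Suc by (rule trans[rotated])
        next
          case 0
          have "z(?n := z ?n + int 0) = z" for z :: "nat \<Rightarrow> int" by (simp add: fun_eq_iff)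
          then show ?case by (simp only:)
        qed
        \<comment> \<open>Once x_n has been moved beyond the old y_n it exceeds every y_j with j <=
          m, because y increases.\<close>
        obtain k :: nat where k: "\<And>j. j \<in> {1..m} \<Longrightarrow> y j < x ?n + int k"
        proof
          fix j assume "j \<in> {1..m}"
          then have "y j \<le> y ?n" using incr_le[OF *(2), of j ?n] by auto
          then show "y j < x ?n + int (nat (y ?n - x ?n + 1))" by linarith
        qed
        let ?x = "x(?n := x ?n + int k)" and ?y = "y(?n := y ?n + int k)"
        have "defect ?n ?x ?y \<nu> \<pi> = defect m ?x ?y \<nu> \<pi>"
          using k by (intro defect_far Suc.prems(1) *(3,4)) auto
        also have "\<dots> = 0"
          using *(1,2) Suc.prems(1) by (intro Suc.IH *(3,4)) (auto simp: incr_def)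
        finally show "defect ?n x y \<nu> \<pi> = 0" using iter by simp
      qed
    qed
  qed
  then show ?case using Suc.prems by blast
qed

theorem initial_condition:
  assumes "incr N x" "incr N y" "\<nu> \<in> Sp" "\<pi> \<in> Sp"
  shows "coef (\<lambda>_. 1) N x y \<nu> \<pi> = (if (\<forall>i\<in>{1..N}. x i = y i) \<and> \<pi> = \<nu> then 1 else 0)"
  using defect_eq_0[OF order.refl assms] mode_id[OF assms(3,4)] unfolding defect_def by simp

lemma coef_backward_power:
  assumes "incr N y" "\<nu> \<in> Sp" "\<pi> \<in> Sp"
  shows "coef (\<lambda>z. energy N z ^ Suc n) N x y \<nu> \<pi> = backward N (\<lambda>y \<nu>. coef (\<lambda>z. energy N z ^ n) N x y \<nu> \<pi>) y \<nu>"
  unfolding power_Suc2 backward_def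
  by (rule coef_backward) (use assms in \<open>auto intro!: nice_power nice_energy energy_permute adjswap_permutes arg_cong[of _ _ "\<lambda>a. a ^ n"] simp del: One_nat_def\<close>)

end

section \<open>Expansion in time\<close>

text \<open>Points of the product space are \<open>undefined\<close> outside {1..n}, whereas the
  iterated integral keeps the coordinates of its base point there.\<close>

definition override :: "nat \<Rightarrow> (nat \<Rightarrow> complex) \<Rightarrow> (nat \<Rightarrow> complex) \<Rightarrow> (nat \<Rightarrow> complex)" where
  "override n \<xi> x = (\<lambda>i. if i \<in> {1..n} then x i else \<xi> i)"

text \<open>Each contour integral is 2 \<pi> i times the mean over the circle of the integrand
  multiplied by its variable. Boundedness and measurability pass through the induction by way of
  Fubini's theorem.\<close>

lemma torus_integral_eq:
  assumes r: "r > 0"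
    and m: "(\<lambda>x. f (override n \<xi> x)) \<in> borel_measurable (PiM {1..n} (\<lambda>_. circle_measure r))"
    and b: "\<And>x. x \<in> space (PiM {1..n} (\<lambda>_. circle_measure r)) \<Longrightarrow> cmod (f (override n \<xi> x)) \<le> B"
  shows "torus_integral r n f \<xi> =
    (2 * pi * \<i>) ^ n * (\<integral>x. f (override n \<xi> x) * (\<Prod>i\<in>{1..n}. x i) \<partial>PiM {1..n} (\<lambda>_. circle_measure r))"
  using m b
proof (induction n arbitrary: \<xi>)
  case 0
  have "override 0 \<xi> x = \<xi>" for x by (simp add: override_def)
  then show ?case using prob_space.prob_space[OF prob_space_PiM[of "{} :: nat set" "\<lambda>_. circle_measure r"]]
    by simp
next
  case (Suc n)
  let ?C = "circle_measure r"
  let ?P = "PiM {1..n} (\<lambda>_. ?C)" and ?P' = "PiM {1..Suc n} (\<lambda>_. ?C)"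
  interpret C: prob_space ?C using prob_space_circle_measure r by simp
  interpret P: prob_space ?P by (rule prob_space_PiM) (use prob_space_circle_measure r in auto)
  interpret P': prob_space ?P' by (rule prob_space_PiM) (use prob_space_circle_measure r in auto)
  interpret PS: pair_sigma_finite ?P ?C ..
  interpret PP: pair_prob_space ?P ?C ..
  interpret T: product_sigma_finite "\<lambda>_. ?C" by standard
  have ins: "insert (Suc n) {1..n} = {1..Suc n}" by auto
  define F where "F = (\<lambda>x. f (override (Suc n) \<xi> x))"
  define G where "G = (\<lambda>x z. F (x(Suc n := z)) * (\<Prod>i\<in>{1..n}. x i))"
  have F_m: "F \<in> borel_measurable ?P'" using Suc.prems(1) by (simp add: F_def)
  have add: "(\<lambda>(x, z). x(Suc n := z)) \<in> measurable (?P \<Otimes>\<^sub>M ?C) ?P'"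
    using measurable_add_dim[of "Suc n" "{1..n}" "\<lambda>_. ?C"] unfolding ins by simp
  have coord: "(\<lambda>x. x i) \<in> borel_measurable (PiM {1..k} (\<lambda>_. ?C))" if "i \<in> {1..k}" for i k
    using measurable_compose[OF measurable_component_singleton[OF that, of "\<lambda>_. ?C"] id_measurable_circle] .
  have norm: "cmod (x i) = r" if "x \<in> space (PiM {1..k} (\<lambda>_. ?C))" "i \<in> {1..k}" for x i k
    using that by (auto simp: space_PiM dest: PiE_mem)
  have upd: "x(Suc n := z) \<in> space ?P'" if "x \<in> space ?P" "z \<in> space ?C" for x z
    using measurable_space[OF add, of "(x, z)"] that by (simp add: space_pair_measure)
  have F_b: "cmod (F x) \<le> B" if "x \<in> space ?P'" for x using Suc.prems(2) that by (simp add: F_def)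
  have G_m: "(\<lambda>(x, z). G x z) \<in> borel_measurable (?P \<Otimes>\<^sub>M ?C)"
  proof -
    have "(\<lambda>w. F ((fst w)(Suc n := snd w))) \<in> borel_measurable (?P \<Otimes>\<^sub>M ?C)"
      using measurable_compose[OF add F_m] by (simp only: split_beta')
    moreover have "(\<lambda>w. \<Prod>i\<in>{1..n}. fst w i) \<in> borel_measurable (?P \<Otimes>\<^sub>M ?C)"
      by (rule borel_measurable_prod) (rule measurable_compose[OF measurable_fst coord])
    ultimately show ?thesis unfolding G_def split_beta' by (rule borel_measurable_times)
  qed
  have G_b: "cmod (G x z) \<le> B * r ^ n" if "x \<in> space ?P" "z \<in> space ?C" for x z
  proof -
    have "cmod (\<Prod>i\<in>{1..n}. x i) = r ^ n" using norm[OF that(1)] by (simp add: prod_norm[symmetric])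
    then show ?thesis unfolding G_def norm_mult using F_b[OF upd[OF that]] r by (simp add: mult_right_mono)
  qed
  have IH: "torus_integral r n f (\<xi>(Suc n := z)) = (2 * pi * \<i>) ^ n * (\<integral>x. G x z \<partial>?P)" if z: "z \<in> space ?C" for z
  proof -
    have o: "override n (\<xi>(Suc n := z)) x = override (Suc n) \<xi> (x(Suc n := z))" for x
      by (auto simp: override_def fun_eq_iff)
    have "(\<lambda>x. x(Suc n := z)) \<in> measurable ?P ?P'"
      using measurable_compose[OF measurable_Pair2'[OF z] add] by simp
    then show ?thesis
      using upd[OF _ z] F_b measurable_compose[OF _ F_m]
      by (subst Suc.IH) (auto simp: o G_def F_def)
  qed
  have "torus_integral r (Suc n) f \<xi> = contour_integral (circlepath 0 r) (\<lambda>z. ((2 * pi * \<i>) ^ n * (\<integral>x. G x z \<partial>?P) * z) / z)"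
    unfolding torus_integral.simps
    by (rule contour_integral_eq) (use IH r in auto)
  also have "\<dots> = 2 * pi * \<i> * (\<integral>z. (2 * pi * \<i>) ^ n * (\<integral>x. G x z \<partial>?P) * z \<partial>?C)"
  proof (subst integral_circle_measure[OF r])
    show "(\<lambda>z. (2 * pi * \<i>) ^ n * (\<integral>x. G x z \<partial>?P) * z) \<in> borel_measurable ?C"
      using P.borel_measurable_lebesgue_integral[of "\<lambda>z x. G x z" ?C] G_m measurable_pair_swap_iff[of "\<lambda>(x, z). G x z" ?P ?C borel]
      by (intro borel_measurable_times id_measurable_circle) (auto simp: split_beta')
    fix z :: complex assume z: "cmod z = r"
    have "cmod (\<integral>x. G x z \<partial>?P) \<le> (\<integral>x. cmod (G x z) \<partial>?P)" by (rule integral_norm_bound)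
    also have "\<dots> \<le> B * r ^ n"
    proof (cases "integrable ?P (\<lambda>x. cmod (G x z))")
      case True
      then show ?thesis using G_b z by (intro P.integral_le_const) (auto intro!: AE_I2)
    next
      case False
      \<comment> \<open>In this case the integral is 0 by convention, and it only remains to see
        that the bound is nonnegative; any point of the space shows it.\<close>
      obtain x where "x \<in> space ?P" using P.not_empty by blast
      from order.trans[OF norm_ge_zero G_b[OF this, of z]] z have "0 \<le> B * r ^ n" by simp
      then show ?thesis using False by (simp add: not_integrable_integral_eq)
    qed
    finally show "cmod ((2 * pi * \<i>) ^ n * (\<integral>x. G x z \<partial>?P) * z) \<le> (2 * pi) ^ n * (B * r ^ n) * r"
      using z r by (simp add: norm_mult norm_power mult_left_mono)
  qed simp
  also have "\<dots> = (2 * pi * \<i>) ^ Suc n * (\<integral>z. (\<integral>x. G x z * z \<partial>?P) \<partial>?C)"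
    by (simp add: mult.assoc)
  \<comment> \<open>The recursion of \<open>torus_integral\<close> makes the new variable outermost,
    \<open>product_integral_insert\<close> makes it innermost.\<close>
  also have "(\<integral>z. (\<integral>x. G x z * z \<partial>?P) \<partial>?C) = (\<integral>x. (\<integral>z. G x z * z \<partial>?C) \<partial>?P)"
  proof (rule PS.Fubini_integral)
    have "AE w in ?P \<Otimes>\<^sub>M ?C. cmod (case w of (x, z) \<Rightarrow> G x z * z) \<le> B * r ^ n * r"
      using G_b r by (intro AE_I2) (auto simp: space_pair_measure norm_mult)
    moreover have "(\<lambda>(x, z). G x z * z) \<in> borel_measurable (?P \<Otimes>\<^sub>M ?C)"
      unfolding split_beta' using G_m
      by (intro borel_measurable_times measurable_compose[OF measurable_snd id_measurable_circle]) (simp add: split_beta')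
    ultimately show "integrable (?P \<Otimes>\<^sub>M ?C) (\<lambda>(x, z). G x z * z)"
      by (intro PP.P.integrable_const_bound)
  qed
  also have "\<dots> = (\<integral>x. F x * (\<Prod>i\<in>{1..Suc n}. x i) \<partial>?P')"
  proof -
    have "integrable ?P' (\<lambda>x. F x * (\<Prod>i\<in>{1..Suc n}. x i))"
    proof (rule P'.integrable_const_bound)
      show "AE x in ?P'. cmod (F x * (\<Prod>i\<in>{1..Suc n}. x i)) \<le> B * r ^ Suc n"
      proof (rule AE_I2)
        fix x assume x: "x \<in> space ?P'"
        have "cmod (\<Prod>i\<in>{1..Suc n}. x i) = r ^ Suc n" 
        proof -
          have "cmod (\<Prod>i\<in>{1..Suc n}. x i) = (\<Prod>i\<in>{1..Suc n}. r)"
            unfolding prod_norm[symmetric] by (rule prod.cong[OF refl norm[OF x]])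
          then show ?thesis by (simp only: prod_constant card_atLeastAtMost diff_Suc_1)
        qed
        then show "cmod (F x * (\<Prod>i\<in>{1..Suc n}. x i)) \<le> B * r ^ Suc n"
          unfolding norm_mult using F_b[OF x] r by (simp add: mult_right_mono)
      qed
      show "(\<lambda>x. F x * (\<Prod>i\<in>{1..Suc n}. x i)) \<in> borel_measurable ?P'"
        by (rule borel_measurable_times[OF F_m borel_measurable_prod]) (rule coord)
    qed
    then have "(\<integral>x. F x * (\<Prod>i\<in>{1..Suc n}. x i) \<partial>?P') =
        (\<integral>x. (\<integral>z. F (x(Suc n := z)) * (\<Prod>i\<in>{1..Suc n}. (x(Suc n := z)) i) \<partial>?C) \<partial>?P)"
      using T.product_integral_insert[of "{1..n}" "Suc n" "\<lambda>x. F x * (\<Prod>i\<in>{1..Suc n}. x i)"] unfolding ins by simp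
    moreover have "(\<Prod>i\<in>{1..Suc n}. (x(Suc n := z)) i) = (\<Prod>i\<in>{1..n}. x i) * z" for x z
    proof -
      have "(\<Prod>i\<in>{1..n}. (x(Suc n := z)) i) = (\<Prod>i\<in>{1..n}. x i)" by (rule prod.cong) auto
      then show ?thesis unfolding ins[symmetric] by (subst prod.insert) (simp_all add: mult.commute)
    qed
    ultimately show ?thesis by (simp add: G_def mult.assoc)
  qed
  finally show ?case by (simp add: F_def)
qed

section \<open>The contour integral as a power series in time\<close>

context bethe
begin

lemma nice_exp_energy: "nice (\<lambda>z. exp (of_real t * energy N z))"
proof -
  obtain B where B: "\<And>z. z \<in> space TM \<Longrightarrow> cmod (energy N z) \<le> B" and m: "energy N \<in> borel_measurable TM"
    using nice_energy[OF order.refl] unfolding nice_def by blast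
  have "cmod (exp (of_real t * energy N z)) \<le> exp (\<bar>t\<bar> * B)" if "z \<in> space TM" for z
  proof -
    have "Re (of_real t * energy N z) \<le> cmod (of_real t * energy N z)" by (rule complex_Re_le_cmod)
    also have "\<dots> \<le> \<bar>t\<bar> * B" using B[OF that] by (simp add: norm_mult mult_left_mono)
    finally show ?thesis by simp
  qed
  then show ?thesis unfolding nice_def using m by auto
qed

lemma integral_formula_term:
  assumes "\<sigma> permutes {1..N}" "\<nu> \<in> Sp" "\<pi> \<in> Sp"
  shows "torus_integral r N (\<lambda>\<xi>. amp \<nu> \<sigma> \<pi> \<xi> * (\<Prod>i = 1..N. \<xi> (\<sigma> i) powi x i) *
      (\<Prod>i = 1..N. \<xi> i powi (- y i - 1) * exp (\<epsilon> p q (\<xi> i) * complex_of_real t))) (\<lambda>_. 0) =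
    (2 * pi * \<i>) ^ N * exp (- real N * t) * CT (\<lambda>z. exp (of_real t * energy N z) * (amp \<nu> \<sigma> \<pi> z * mon x (z \<circ> \<sigma>)) * mon (\<lambda>i. - y i) z)"
    (is "torus_integral r N ?f _ = _")
proof -
  let ?g = "\<lambda>z. exp (- real N * t) * (exp (of_real t * energy N z) * (amp \<nu> \<sigma> \<pi> z * mon x (z \<circ> \<sigma>)) * mon (\<lambda>i. - y i) z)"
  let ?o = "override N (\<lambda>_. 0)"
  have o: "?o z i = z i" if "i \<in> {1..N}" for z i using that by (simp add: override_def)
  have \<sigma>: "\<sigma> i \<in> {1..N}" if "i \<in> {1..N}" for i using permutes_in_image[OF assms(1)] that by blast
  have g: "?f (?o z) * (\<Prod>i\<in>{1..N}. z i) = ?g z" if z: "z \<in> space TM" for z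
  proof -
    have "?o z \<in> polydisc N (p / 4)" using TM_polydisc[OF z] p_pos by (auto simp: polydisc_def override_def)
    then have 1: "amp \<nu> \<sigma> \<pi> (?o z) = amp \<nu> \<sigma> \<pi> z"
      using amp_cong[OF assms(1) order.refl assms(2,3) _ TM_polydisc[OF z]] o by blast
    have 2: "(\<Prod>i = 1..N. ?o z (\<sigma> i) powi x i) = mon x (z \<circ> \<sigma>)"
      unfolding mon_def by (rule prod.cong) (auto simp: o[OF \<sigma>] simp del: One_nat_def)
    \<comment> \<open>The summand -1 in each \<epsilon> produces the factor e^(-Nt), which on the
      probabilistic side comes from N clocks of rate one.\<close>
    have "(\<Sum>i\<in>{1..N}. \<epsilon> p q (z i)) = energy N z - of_nat N"
      unfolding energy_def \<epsilon>_def by (simp add: sum_subtractf)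
    then have "(\<Sum>i\<in>{1..N}. \<epsilon> p q (z i)) * complex_of_real t = of_real (- real N * t) + of_real t * energy N z"
      by (simp only: left_diff_distrib) (simp add: mult.commute)
    then have e: "exp ((\<Sum>i\<in>{1..N}. \<epsilon> p q (z i)) * complex_of_real t) = exp (- real N * t) * exp (of_real t * energy N z)"
      by (simp only: exp_add exp_of_real)
    have "(\<Prod>i = 1..N. ?o z i powi (- y i - 1) * exp (\<epsilon> p q (?o z i) * complex_of_real t)) * (\<Prod>i\<in>{1..N}. z i)
      = (\<Prod>i\<in>{1..N}. z i powi - y i * exp (\<epsilon> p q (z i) * complex_of_real t))"
      unfolding prod.distrib[symmetric]
      by (rule prod.cong) (use TM_nonzero[OF z] o in \<open>auto simp: power_int_diff\<close>)
    also have "\<dots> = mon (\<lambda>i. - y i) z * exp ((\<Sum>i\<in>{1..N}. \<epsilon> p q (z i)) * complex_of_real t)"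
      unfolding mon_def prod.distrib sum_distrib_right by (simp add: exp_sum)
    finally show ?thesis unfolding 1 2 e by (simp add: mult_ac)
  qed
  have n_g: "nice ?g"
    by (intro nice_mult nice_const nice_exp_energy nice_amp assms nice_mon nice_mon_comp)
  have n_f: "nice (\<lambda>z. ?f (?o z))"
  proof (rule nice_cong)
    show "nice (\<lambda>z. ?g z * (\<Prod>i\<in>{1..N}. inverse (z i)))"
      by (intro nice_mult[OF n_g] nice_prod nice_inverse_coord)
    fix z assume z: "z \<in> space TM"
    have "(\<Prod>i\<in>{1..N}. z i) * (\<Prod>i\<in>{1..N}. inverse (z i)) = 1"
      unfolding prod.distrib[symmetric] by (rule prod.neutral) (use TM_nonzero[OF z] in auto)
    then show "?f (?o z) = ?g z * (\<Prod>i\<in>{1..N}. inverse (z i))"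
      unfolding g[OF z, symmetric] by (simp add: mult.assoc)
  qed
  have "torus_integral r N ?f (\<lambda>_. 0) = (2 * pi * \<i>) ^ N * CT (\<lambda>z. ?f (?o z) * (\<Prod>i\<in>{1..N}. z i))"
  proof -
    obtain B where "\<And>z. z \<in> space TM \<Longrightarrow> cmod (?f (?o z)) \<le> B" and "(\<lambda>z. ?f (?o z)) \<in> borel_measurable TM"
      using n_f unfolding nice_def by blast
    then show ?thesis unfolding CT_def TM_def by (intro torus_integral_eq r_pos) blast+
  qed
  also have "CT (\<lambda>z. ?f (?o z) * (\<Prod>i\<in>{1..N}. z i)) = CT ?g" by (rule CT_cong[OF g])
  finally show ?thesis unfolding CT_mult by simp
qed

text \<open>The energy is bounded on the torus, so the exponential series has a summable majorant
  independent of z and may be integrated term by term.\<close>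

lemma coef_exp_sums:
  assumes "\<nu> \<in> Sp" "\<pi> \<in> Sp"
  shows "(\<lambda>n. t ^ n / fact n * coef (\<lambda>z. energy N z ^ n) N x y \<nu> \<pi>) sums coef (\<lambda>z. exp (of_real t * energy N z)) N x y \<nu> \<pi>"
proof -
  let ?h = "\<lambda>z. Psi N x \<nu> \<pi> z * mon (\<lambda>i. - y i) z"
  have n: "nice (\<lambda>z. energy N z ^ n * ?h z)" for n
    using assms by (intro nice_mult nice_power nice_energy nice_Psi nice_mon) auto
  obtain B where B: "\<And>z. z \<in> space TM \<Longrightarrow> cmod (energy N z) \<le> B"
    using nice_energy[OF order.refl] unfolding nice_def by blast
  obtain D where D: "\<And>z. z \<in> space TM \<Longrightarrow> cmod (?h z) \<le> D"
    using n[of 0] unfolding nice_def by auto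
  obtain z where z: "z \<in> space TM" using TM.not_empty by blast
  have B0: "0 \<le> B" and D0: "0 \<le> D" using B[OF z] D[OF z] norm_ge_zero order_trans by blast+
  define F where "F n z = of_real t ^ n / fact n * (energy N z ^ n * ?h z)" for n z
  have nF: "nice (F n)" for n unfolding F_def[abs_def] by (intro nice_mult[OF nice_const] n)
  have F_norm: "cmod (F n z) \<le> (\<bar>t\<bar> * B) ^ n / fact n * D" if "z \<in> space TM" for n z
  proof -
    have "cmod (F n z) = \<bar>t\<bar> ^ n / fact n * (cmod (energy N z) ^ n * cmod (?h z))"
      by (simp add: F_def norm_mult norm_divide norm_power)
    also have "\<dots> \<le> \<bar>t\<bar> ^ n / fact n * (B ^ n * D)"
      using B[OF that] D[OF that] B0 D0 by (intro mult_left_mono mult_mono power_mono) auto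
    finally show ?thesis by (simp add: power_mult_distrib mult_ac)
  qed
  have summ: "summable (\<lambda>n. (\<bar>t\<bar> * B) ^ n / fact n * D)"
    using summable_exp[of "\<bar>t\<bar> * B"] by (intro summable_mult2) (simp add: field_simps)
  have "(\<lambda>n. \<integral>z. F n z \<partial>TM) sums (\<integral>z. suminf (\<lambda>n. F n z) \<partial>TM)"
  proof (rule sums_integral)
    show "integrable TM (F n)" for n by (rule nice_integrable[OF nF])
    show "AE z in TM. summable (\<lambda>n. norm (F n z))"
      by (rule AE_I2, rule summable_comparison_test'[OF summ]) (use F_norm in auto)
    show "summable (\<lambda>n. \<integral>z. norm (F n z) \<partial>TM)"
    proof (rule summable_comparison_test'[OF summ])
      fix n
      have "(\<integral>z. norm (F n z) \<partial>TM) \<le> (\<bar>t\<bar> * B) ^ n / fact n * D"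
        using nice_integrable[OF nF] F_norm by (intro TM.integral_le_const) (auto intro!: AE_I2)
      then show "norm (\<integral>z. norm (F n z) \<partial>TM) \<le> (\<bar>t\<bar> * B) ^ n / fact n * D" by simp
    qed
  qed
  moreover have "(\<integral>z. F n z \<partial>TM) = t ^ n / fact n * coef (\<lambda>z. energy N z ^ n) N x y \<nu> \<pi>" for n
    unfolding F_def CT_def[symmetric] CT_mult coef_def by (simp add: mult.assoc)
  moreover have "(\<integral>z. suminf (\<lambda>n. F n z) \<partial>TM) = coef (\<lambda>z. exp (of_real t * energy N z)) N x y \<nu> \<pi>"
  proof -
    have "(\<lambda>n. F n z) sums (exp (of_real t * energy N z) * ?h z)" for z
    proof -
      have "(\<lambda>n. (of_real t * energy N z) ^ n /\<^sub>R fact n * ?h z) sums (exp (of_real t * energy N z) * ?h z)"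
        by (intro sums_mult2 exp_converges)
      then show ?thesis by (simp add: F_def power_mult_distrib scaleR_conv_of_real field_simps)
    qed
    then have "suminf (\<lambda>n. F n z) = exp (of_real t * energy N z) * Psi N x \<nu> \<pi> z * mon (\<lambda>i. - y i) z" for z
      by (simp add: sums_iff mult.assoc)
    then show ?thesis unfolding coef_def CT_def by simp
  qed
  ultimately show ?thesis by simp
qed

lemma integral_formula:
  assumes "\<nu> \<in> Sp" "\<pi> \<in> Sp"
  shows "(\<lambda>n. exp (- real N * t) * (t ^ n / fact n) * coef (\<lambda>z. energy N z ^ n) N x y \<nu> \<pi>) sums
    (\<Sum>\<sigma> | \<sigma> permutes {1..N}. 1 / (2 * complex_of_real pi * \<i>) ^ N *
      torus_integral r N (\<lambda>\<xi>. amp \<nu> \<sigma> \<pi> \<xi> * (\<Prod>i = 1..N. \<xi> (\<sigma> i) powi x i) *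
        (\<Prod>i = 1..N. \<xi> i powi (- y i - 1) * exp (\<epsilon> p q (\<xi> i) * complex_of_real t))) (\<lambda>_. 0))"
proof -
  let ?e = "\<lambda>z. exp (of_real t * energy N z)"
  have n_exp: "nice (\<lambda>z. ?e z * (amp \<nu> \<sigma> \<pi> z * mon x (z \<circ> \<sigma>)) * mon (\<lambda>i. - y i) z)" if "\<sigma> permutes {1..N}" for \<sigma>
    using that by (intro nice_mult nice_exp_energy nice_amp assms nice_mon nice_mon_comp)
  have "(\<Sum>\<sigma> | \<sigma> permutes {1..N}. 1 / (2 * complex_of_real pi * \<i>) ^ N *
      torus_integral r N (\<lambda>\<xi>. amp \<nu> \<sigma> \<pi> \<xi> * (\<Prod>i = 1..N. \<xi> (\<sigma> i) powi x i) *
        (\<Prod>i = 1..N. \<xi> i powi (- y i - 1) * exp (\<epsilon> p q (\<xi> i) * complex_of_real t))) (\<lambda>_. 0))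
    = (\<Sum>\<sigma> | \<sigma> permutes {1..N}. exp (- real N * t) * CT (\<lambda>z. ?e z * (amp \<nu> \<sigma> \<pi> z * mon x (z \<circ> \<sigma>)) * mon (\<lambda>i. - y i) z))"
    by (rule sum.cong) (auto simp: integral_formula_term[OF _ assms] simp del: One_nat_def)
  also have "\<dots> = exp (- real N * t) * coef ?e N x y \<nu> \<pi>"
    unfolding coef_def Psi_def sum_distrib_left[symmetric] sum_distrib_right
    by (subst CT_sum[symmetric]) (use n_exp in \<open>auto simp: sum_distrib_left sum_distrib_right\<close>)
  finally show ?thesis
    using sums_mult[OF coef_exp_sums[OF assms, of t x y], of "exp (- real N * t)"] by (simp add: mult.assoc)
qed

end

section \<open>The probability of a sequence of attempts\<close>

text \<open>\<open>rings N t w s k \<tau> \<omega>\<close>: the attempts in $(s, t]$ are those of \<open>w\<close>, in this order, when label \<open>i\<close>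
  last rang at the time \<open>\<tau> i\<close> and next uses the waiting time number \<open>k i\<close>. With these offsets kept as
  parameters, the probability of a word is computed by integrating over one waiting time at a time.\<close>

primrec rings :: "nat \<Rightarrow> real \<Rightarrow> (nat \<times> bool) list \<Rightarrow> real \<Rightarrow> (nat \<Rightarrow> nat) \<Rightarrow> (nat \<Rightarrow> real) \<Rightarrow>
    (nat \<times> nat \<Rightarrow> real \<times> bool) \<Rightarrow> bool" where
  "rings N t [] s k \<tau> \<omega> \<longleftrightarrow> (\<forall>i\<in>{1..N}. t < \<tau> i + fst (\<omega> (i, k i)))"
| "rings N t (a # w) s k \<tau> \<omega> \<longleftrightarrow> s < \<tau> (fst a) + fst (\<omega> (fst a, k (fst a))) \<and>
     \<tau> (fst a) + fst (\<omega> (fst a, k (fst a))) \<le> t \<and> snd (\<omega> (fst a, k (fst a))) = snd a \<and>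
     rings N t w (\<tau> (fst a) + fst (\<omega> (fst a, k (fst a)))) (k(fst a := Suc (k (fst a))))
       (\<tau>(fst a := \<tau> (fst a) + fst (\<omega> (fst a, k (fst a))))) \<omega>"

primrec weight :: "real \<Rightarrow> (nat \<times> bool) list \<Rightarrow> real" where
  "weight p [] = 1"
| "weight p (a # w) = (if snd a then p else 1 - p) * weight p w"

definition clock :: "real \<Rightarrow> (real \<times> bool) measure" where
  "clock p = density lborel (exponential_density 1) \<Otimes>\<^sub>M measure_pmf (bernoulli_pmf p)"

lemma clocks_eq: "clocks N p = PiM ({1..N} \<times> UNIV) (\<lambda>_. clock p)"
  by (simp add: clocks_def clock_def)

lemma prob_space_clock: "prob_space (clock p)"
proof -
  interpret E: prob_space "density lborel (exponential_density 1)"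
    by (rule prob_space_exponential_density) simp
  interpret B: prob_space "measure_pmf (bernoulli_pmf p)" by (rule measure_pmf.prob_space_axioms)
  interpret pair_prob_space "density lborel (exponential_density 1)" "measure_pmf (bernoulli_pmf p)" ..
  show ?thesis unfolding clock_def by (rule P.prob_space_axioms)
qed

lemma sets_clock: "sets (clock p) = sets (borel \<Otimes>\<^sub>M count_space UNIV)"
  unfolding clock_def by (intro sets_pair_measure_cong) auto

lemma fst_clock [measurable]: "fst \<in> borel_measurable (clock p)"
  and snd_clock [measurable]: "snd \<in> measurable (clock p) (count_space UNIV)"
  unfolding measurable_cong_sets[OF sets_clock refl] by measurable

lemma space_clock [simp]: "space (clock p) = UNIV"
  by (simp add: clock_def space_pair_measure)

text \<open>Only waiting times numbered from \<open>k i\<close> on are read. Hence the waiting time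
  consumed by the head of a word does not enter the event described by its tail.\<close>

lemma rings_cong:
  assumes "\<And>i m. i \<in> {1..N} \<Longrightarrow> k i \<le> m \<Longrightarrow> \<omega> (i, m) = \<omega>' (i, m)" "fst ` set w \<subseteq> {1..N}"
  shows "rings N t w s k \<tau> \<omega> = rings N t w s k \<tau> \<omega>'"
  using assms
proof (induction w arbitrary: s k \<tau>)
  case (Cons a w)
  have "\<omega> (fst a, k (fst a)) = \<omega>' (fst a, k (fst a))" using Cons.prems by auto
  moreover have "rings N t w s (k(fst a := Suc (k (fst a)))) \<tau> \<omega> = rings N t w s (k(fst a := Suc (k (fst a)))) \<tau> \<omega>'" for s \<tau>
    using Cons.prems by (intro Cons.IH) (auto split: if_splits)
  ultimately show ?case by simp
qed auto

text \<open>The start time and the offsets are functions of the sample point, because the recursion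
  replaces them by random ring times; the counters \<open>k\<close> remain deterministic.\<close>

lemma rings_measurable:
  fixes X :: "'x \<Rightarrow> nat \<times> nat \<Rightarrow> real \<times> bool"
  assumes s: "s \<in> borel_measurable A" and \<tau>: "\<And>i. (\<lambda>x. \<tau> x i) \<in> borel_measurable A"
    and X1: "\<And>i m. i \<in> {1..N} \<Longrightarrow> k i \<le> m \<Longrightarrow> (\<lambda>x. fst (X x (i, m))) \<in> borel_measurable A"
    and X2: "\<And>i m. i \<in> {1..N} \<Longrightarrow> k i \<le> m \<Longrightarrow> (\<lambda>x. snd (X x (i, m))) \<in> measurable A (count_space UNIV)"
    and w: "fst ` set w \<subseteq> {1..N}"
  shows "Measurable.pred A (\<lambda>x. rings N t w (s x) k (\<tau> x) (X x))"
  using assms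
proof (induction w arbitrary: s k \<tau>)
  case Nil
  have *: "\<And>i. i \<in> {1..N} \<Longrightarrow> (\<lambda>x. \<tau> x i + fst (X x (i, k i))) \<in> borel_measurable A"
    using Nil.prems(2,3) by (intro borel_measurable_add) blast+
  show ?case unfolding rings.simps by (intro pred_intros_finite borel_measurable_pred_less borel_measurable_const *) simp_all
next
  case (Cons a w)
  define u where "u x = \<tau> x (fst a) + fst (X x (fst a, k (fst a)))" for x
  have a: "fst a \<in> {1..N}" using Cons.prems by auto
  have u [measurable]: "u \<in> borel_measurable A"
    unfolding u_def[abs_def] using Cons.prems a by (intro borel_measurable_add) auto
  note [measurable] = Cons.prems(1)
  have d: "(\<lambda>x. snd (X x (fst a, k (fst a)))) \<in> measurable A (count_space UNIV)"
    using Cons.prems a by auto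
  have 1: "Measurable.pred A (\<lambda>x. snd (X x (fst a, k (fst a))) = snd a)"
    using measurable_compose[OF d, of "\<lambda>b. b = snd a" "count_space UNIV"] by simp
  have 2: "Measurable.pred A (\<lambda>x. rings N t w (u x) (k(fst a := Suc (k (fst a)))) ((\<tau> x)(fst a := u x)) (X x))"
  proof (rule Cons.IH)
    show "(\<lambda>x. ((\<tau> x)(fst a := u x)) i) \<in> borel_measurable A" for i
      using u Cons.prems(2)[of i] by (cases "i = fst a") auto
  qed (use u Cons.prems in \<open>auto split: if_splits\<close>)
  show ?case
    unfolding rings.simps u_def[symmetric]
    by (intro pred_intros_logic 1 2) measurable
qed

lemma PiM_coord_measurable:
  assumes "x \<in> I"
  shows "(\<lambda>\<omega>. fst (\<omega> x)) \<in> borel_measurable (PiM I (\<lambda>_. clock p))"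
    "(\<lambda>\<omega>. snd (\<omega> x)) \<in> measurable (PiM I (\<lambda>_. clock p)) (count_space UNIV)"
  using measurable_compose[OF measurable_component_singleton[OF assms] fst_clock]
    measurable_compose[OF measurable_component_singleton[OF assms] snd_clock] by auto

lemma emeasure_clock_gt:
  assumes "a \<ge> 0"
  shows "emeasure (clock p) {x. a < fst x} = ennreal (exp (- a))"
proof -
  let ?E = "density lborel (exponential_density 1)"
  interpret E: prob_space ?E by (rule prob_space_exponential_density) simp
  have d: "distributed ?E lborel (\<lambda>x. x) (exponential_density 1)"
    by (auto simp: distributed_def exponential_density_nonneg distr_id2 cong: distr_cong)
  have "{x. a < fst x} = {a<..} \<times> (UNIV :: bool set)" by auto
  then have "emeasure (clock p) {x. a < fst x} = emeasure ?E {a<..}"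
    unfolding clock_def by (simp add: measure_pmf.emeasure_pair_measure_Times)
  also have "\<dots> = ennreal (exp (- a))"
    using E.exponential_distributedD_gt[OF d assms] by (simp add: E.emeasure_eq_measure greaterThan_def)
  finally show ?thesis .
qed

text \<open>Label i contributes e^(-(t - \<tau>_i)), the probability of no further ring up to t. If
  j rings next after waiting v, the density e^(-v) cancels the factor e^v gained by moving \<tau>_j
  to \<tau>_j + v; what remains is the integral of (t - u)^n / n! over u in (s, t].\<close>

lemma emeasure_rings:
  assumes t: "s \<le> t" and \<tau>: "\<And>i. i \<in> {1..N} \<Longrightarrow> \<tau> i \<le> s" and w: "fst ` set w \<subseteq> {1..N}"
    and I: "\<And>i m. i \<in> {1..N} \<Longrightarrow> k i \<le> m \<Longrightarrow> (i, m) \<in> I" and p: "0 \<le> p" "p \<le> 1"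
  shows "emeasure (PiM I (\<lambda>_. clock p)) {\<omega> \<in> space (PiM I (\<lambda>_. clock p)). rings N t w s k \<tau> \<omega>}
    = ennreal (weight p w * exp (- real N * t + (\<Sum>i\<in>{1..N}. \<tau> i)) * (t - s) ^ length w / fact (length w))"
  using assms(1-4)
proof (induction w arbitrary: s k \<tau> I)
  case Nil
  interpret product_prob_space "\<lambda>_. clock p" I
    by (intro product_prob_space.intro product_sigma_finite.intro product_prob_space_axioms.intro)
      (auto intro: prob_space_clock prob_space_imp_sigma_finite)
  let ?J = "(\<lambda>i. (i, k i)) ` {1..N}"
  let ?X = "\<lambda>x. {y. t - \<tau> (fst x) < fst y}"
  have "{\<omega> \<in> space (PiM I (\<lambda>_. clock p)). rings N t [] s k \<tau> \<omega>}
    = {\<omega> \<in> space (PiM I (\<lambda>_. clock p)). \<forall>x\<in>?J. \<omega> x \<in> ?X x}"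
    by (auto simp: algebra_simps)
  also have "emeasure (PiM I (\<lambda>_. clock p)) \<dots> = (\<Prod>x\<in>?J. emeasure (clock p) (?X x))"
  proof (rule emeasure_PiM_Collect)
    show "?X x \<in> sets (clock p)" for x
      using measurable_sets[OF fst_clock[of p], of "{t - \<tau> (fst x)<..}"] by (simp add: vimage_def)
  qed (use Nil in auto)
  also have "\<dots> = (\<Prod>i\<in>{1..N}. emeasure (clock p) (?X (i, k i)))"
    by (subst prod.reindex) (auto simp: inj_on_def)
  also have "\<dots> = (\<Prod>i\<in>{1..N}. ennreal (exp (- (t - \<tau> i))))"
  proof (rule prod.cong[OF refl])
    fix i assume "i \<in> {1..N}"
    then have "0 \<le> t - \<tau> i" using Nil.prems(1) Nil.prems(2)[of i] by auto
    from emeasure_clock_gt[OF this] show "emeasure (clock p) (?X (i, k i)) = ennreal (exp (- (t - \<tau> i)))" by simp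
  qed
  also have "\<dots> = ennreal (exp (\<Sum>i\<in>{1..N}. - (t - \<tau> i)))"
    by (subst prod_ennreal) (auto simp: exp_sum)
  also have "(\<Sum>i\<in>{1..N}. - (t - \<tau> i)) = - real N * t + (\<Sum>i\<in>{1..N}. \<tau> i)"
    by (simp add: sum_subtractf)
  finally show ?case by simp
next
  case (Cons a w)
  obtain j d where a: "a = (j, d)" by fastforce
  let ?P = "\<lambda>I. PiM I (\<lambda>_. clock p)"
  define x where "x = (j, k j)"
  define I' where "I' = I - {x}"
  define k' where "k' = k(j := Suc (k j))"
  define \<tau>' where "\<tau>' u = \<tau>(j := u)" for u :: real
  define S where "S = (\<Sum>i\<in>{1..N}. \<tau> i)"
  define n where "n = length w"
  define C where "C = weight p w * exp (- real N * t + S)"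
  have j: "j \<in> {1..N}" and w: "fst ` set w \<subseteq> {1..N}" using Cons.prems(3) a by auto
  have xI: "x \<in> I" using Cons.prems(4) j by (auto simp: x_def)
  have ins: "insert x I' = I" using xI by (auto simp: I'_def)
  interpret Q: prob_space "?P I'" by (rule prob_space_PiM) (rule prob_space_clock)
  have wt: "0 \<le> weight p w" using p by (induction w) auto
  then have C0: "0 \<le> C" by (simp add: C_def)
  let ?f = "\<lambda>(y, \<omega>). fun_upd \<omega> x y"
  have f: "?f \<in> measurable (clock p \<Otimes>\<^sub>M ?P I') (?P I)"
    using measurable_fun_upd[of I I' x "\<lambda>z. snd z" "clock p \<Otimes>\<^sub>M ?P I'" "\<lambda>_. clock p" fst] ins
    by (simp add: split_beta')
  let ?R = "{\<omega> \<in> space (?P I). rings N t (a # w) s k \<tau> \<omega>}"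
  have R: "?R \<in> sets (?P I)"
  proof -
    have "Measurable.pred (?P I) (\<lambda>\<omega>. rings N t (a # w) s k \<tau> \<omega>)"
      by (rule rings_measurable[where s = "\<lambda>_. s" and \<tau> = "\<lambda>_. \<tau>" and X = "\<lambda>\<omega>. \<omega>"])
        (intro borel_measurable_const PiM_coord_measurable Cons.prems(3,4); assumption)+
    then show ?thesis by (simp only: pred_def)
  qed
  have "emeasure (?P I) ?R = emeasure (clock p \<Otimes>\<^sub>M ?P I') (?f -` ?R \<inter> space (clock p \<Otimes>\<^sub>M ?P I'))"
    using distr_pair_PiM_eq_PiM[of I' "\<lambda>_. clock p" x] prob_space_clock emeasure_distr[OF f R] unfolding ins by simp
  also have "\<dots> = (\<integral>\<^sup>+y. emeasure (?P I') (Pair y -` (?f -` ?R \<inter> space (clock p \<Otimes>\<^sub>M ?P I'))) \<partial>clock p)"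
    by (rule Q.emeasure_pair_measure_alt) (rule measurable_sets[OF f R])
  also have "\<dots> = (\<integral>\<^sup>+y. (ennreal (C * exp (fst y) * (t - (\<tau> j + fst y)) ^ n / fact n) * indicator {s - \<tau> j<..t - \<tau> j} (fst y))
      * indicator {d} (snd y) \<partial>clock p)"
  proof (rule nn_integral_cong)
    fix y :: "real \<times> bool"
    define u where "u = \<tau> j + fst y"
    have up: "fun_upd \<omega> x y \<in> space (?P I)" if "\<omega> \<in> space (?P I')" for \<omega>
      using that unfolding ins[symmetric] space_PiM by (intro PiE_fun_upd) auto
    \<comment> \<open>The tail starts from the counter \<open>Suc (k j)\<close> for label j, so it
      never reads the coordinate x that has been split off.\<close>
    have rc: "rings N t w u k' (\<tau>' u) (fun_upd \<omega> x y) = rings N t w u k' (\<tau>' u) \<omega>" for \<omega>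
      by (rule rings_cong[OF _ w]) (auto simp: k'_def x_def split: if_splits)
    have "Pair y -` (?f -` ?R \<inter> space (clock p \<Otimes>\<^sub>M ?P I')) =
      (if s < u \<and> u \<le> t \<and> snd y = d then {\<omega> \<in> space (?P I'). rings N t w u k' (\<tau>' u) \<omega>} else {})"
      using up rc by (auto simp: space_pair_measure a x_def[symmetric] u_def[symmetric] k'_def[symmetric] \<tau>'_def[symmetric])
    moreover have "emeasure (?P I') {\<omega> \<in> space (?P I'). rings N t w u k' (\<tau>' u) \<omega>}
      = ennreal (C * exp (fst y) * (t - u) ^ n / fact n)" if u: "s < u" "u \<le> t"
    proof -
      have "(\<Sum>i\<in>{1..N}. \<tau>' u i) = S + fst y"
        using j by (simp add: \<tau>'_def S_def u_def sum.remove[of "{1..N}" j] del: One_nat_def)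
      moreover have "\<tau>' u i \<le> u" if "i \<in> {1..N}" for i
        using u Cons.prems(2)[OF that] by (auto simp: \<tau>'_def)
      moreover have "(i, m) \<in> I'" if "i \<in> {1..N}" "k' i \<le> m" for i m
        using Cons.prems(4)[OF that(1), of m] that by (auto simp: I'_def x_def k'_def split: if_splits)
      moreover have "exp (- real N * t + (S + fst y)) = exp (- real N * t + S) * exp (fst y)"
        by (simp only: exp_add[symmetric] add.assoc)
      ultimately show ?thesis
        using Cons.IH[OF u(2) _ w, of "\<tau>' u" k' I'] by (simp only: C_def n_def mult_ac)
    qed
    ultimately show "emeasure (?P I') (Pair y -` (?f -` ?R \<inter> space (clock p \<Otimes>\<^sub>M ?P I'))) =
      (ennreal (C * exp (fst y) * (t - (\<tau> j + fst y)) ^ n / fact n) * indicator {s - \<tau> j<..t - \<tau> j} (fst y)) * indicator {d} (snd y)"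
      unfolding u_def by (auto simp: indicator_def algebra_simps)
  qed
  also have "\<dots> = (\<integral>\<^sup>+v. (\<integral>\<^sup>+b. (ennreal (C * exp v * (t - (\<tau> j + v)) ^ n / fact n) * indicator {s - \<tau> j<..t - \<tau> j} v)
      * indicator {d} b \<partial>measure_pmf (bernoulli_pmf p)) \<partial>density lborel (exponential_density 1))"
  proof -
    have "(\<lambda>y. (ennreal (C * exp (fst y) * (t - (\<tau> j + fst y)) ^ n / fact n) * indicator {s - \<tau> j<..t - \<tau> j} (fst y))
      * indicator {d} (snd y)) \<in> borel_measurable (clock p)"
    proof (rule borel_measurable_times_ennreal)
      show "(\<lambda>y. ennreal (C * exp (fst y) * (t - (\<tau> j + fst y)) ^ n / fact n) * indicator {s - \<tau> j<..t - \<tau> j} (fst y))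
          \<in> borel_measurable (clock p)"
        by (rule measurable_compose[OF fst_clock]) measurable
      show "(\<lambda>y. indicator {d} (snd y) :: ennreal) \<in> borel_measurable (clock p)"
        by (rule measurable_compose[OF snd_clock]) simp
    qed
    from measure_pmf.nn_integral_fst[OF this[unfolded clock_def]] show ?thesis
      unfolding clock_def by simp
  qed
  also have "\<dots> = (\<integral>\<^sup>+v. (ennreal (C * exp v * (t - (\<tau> j + v)) ^ n / fact n) * indicator {s - \<tau> j<..t - \<tau> j} v)
      * ennreal (if d then p else 1 - p) \<partial>density lborel (exponential_density 1))"
  proof -
    have "emeasure (measure_pmf (bernoulli_pmf p)) {d} = ennreal (if d then p else 1 - p)"
      using p by (cases d) (auto simp: emeasure_pmf_single)
    then show ?thesis by (simp add: nn_integral_cmult)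
  qed
  also have "\<dots> = (\<integral>\<^sup>+v. ennreal ((if d then p else 1 - p) * C * (t - (\<tau> j + v)) ^ n / fact n) * indicator {s - \<tau> j..t - \<tau> j} v \<partial>lborel)"
  proof (subst nn_integral_density)
    \<comment> \<open>Discarding one point replaces the half-open interval by the closed one of the
      fundamental theorem of calculus.\<close>
    have "AE v in lborel. v \<noteq> s - \<tau> j" by (rule AE_lborel_singleton)
    then show "(\<integral>\<^sup>+v. ennreal (exponential_density 1 v) * ((ennreal (C * exp v * (t - (\<tau> j + v)) ^ n / fact n) * indicator {s - \<tau> j<..t - \<tau> j} v)
        * ennreal (if d then p else 1 - p)) \<partial>lborel) =
      (\<integral>\<^sup>+v. ennreal ((if d then p else 1 - p) * C * (t - (\<tau> j + v)) ^ n / fact n) * indicator {s - \<tau> j..t - \<tau> j} v \<partial>lborel)"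
    proof (intro nn_integral_cong_AE, eventually_elim)
      case (elim v)
      show ?case
      proof (cases "v \<in> {s - \<tau> j<..t - \<tau> j}")
        case True
        then have v: "0 \<le> v" "0 \<le> t - (\<tau> j + v)" using Cons.prems(2)[OF j] by auto
        have "exp (- v) * exp v = 1" by (simp add: exp_minus)
        then have "exp (- v) * (C * exp v * (t - (\<tau> j + v)) ^ n / fact n) * (if d then p else 1 - p)
          = (if d then p else 1 - p) * C * (t - (\<tau> j + v)) ^ n / fact n" by (simp add: field_simps)
        then show ?thesis using True v C0 p
          by (simp add: exponential_density_def ennreal_mult[symmetric] mult.assoc[symmetric])
      next
        case False
        then have "v \<notin> {s - \<tau> j..t - \<tau> j}" using elim by auto
        then show ?thesis using False by simp
      qed
    qed
  qed auto
  also have "\<dots> = ennreal (- ((if d then p else 1 - p) * C * (t - (\<tau> j + (t - \<tau> j))) ^ Suc n / fact (Suc n))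
      - - ((if d then p else 1 - p) * C * (t - (\<tau> j + (s - \<tau> j))) ^ Suc n / fact (Suc n)))"
  proof (rule nn_integral_FTC_Icc[where F = "\<lambda>v. - ((if d then p else 1 - p) * C * (t - (\<tau> j + v)) ^ Suc n / fact (Suc n))"])
    fix v assume v: "v \<in> {s - \<tau> j..t - \<tau> j}"
    show "DERIV (\<lambda>v. - ((if d then p else 1 - p) * C * (t - (\<tau> j + v)) ^ Suc n / fact (Suc n))) v :>
      (if d then p else 1 - p) * C * (t - (\<tau> j + v)) ^ n / fact n"
      by (rule derivative_eq_intros refl | simp)+
    show "0 \<le> (if d then p else 1 - p) * C * (t - (\<tau> j + v)) ^ n / fact n" using C0 p v by simp
  qed (use Cons.prems(1) in auto)
  finally show ?case
    using a by (simp add: C_def S_def n_def mult_ac)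
qed

section \<open>From words of attempts to the chronological list\<close>

primrec labels :: "(nat \<times> bool) list \<Rightarrow> (nat \<Rightarrow> nat) \<Rightarrow> (nat \<times> nat) list" where
  "labels [] k = []"
| "labels (a # w) k = (fst a, k (fst a)) # labels w (k(fst a := Suc (k (fst a))))"

lemma ring_time_eq: "ring_time \<omega> (i, m) = (\<Sum>j<m. fst (\<omega> (i, j))) + fst (\<omega> (i, m))"
  by (simp add: ring_time_def lessThan_Suc_atMost[symmetric])

text \<open>With positive waiting times the ring times of one label increase, so a label whose next
  ring comes after t has no later one before t. Hence the word exhausts all attempts up to
  t.\<close>

lemma rings_labels:
  assumes pos: "\<And>i m. i \<in> {1..N} \<Longrightarrow> 0 < fst (\<omega> (i, m))"
    and "rings N t w s k (\<lambda>i. \<Sum>m<k i. fst (\<omega> (i, m))) \<omega>" "fst ` set w \<subseteq> {1..N}"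
  shows "sorted_wrt (<) (map (ring_time \<omega>) (labels w k)) \<and> (\<forall>x\<in>set (labels w k). s < ring_time \<omega> x) \<and>
    set (labels w k) = {(i, m). i \<in> {1..N} \<and> k i \<le> m \<and> ring_time \<omega> (i, m) \<le> t} \<and>
    map (\<lambda>x. (fst x, snd (\<omega> x))) (labels w k) = w"
  using assms(2,3)
proof (induction w arbitrary: s k)
  case Nil
  have "\<not> ring_time \<omega> (i, m) \<le> t" if i: "i \<in> {1..N}" and m: "k i \<le> m" for i m
  proof -
    have "t < (\<Sum>m<k i. fst (\<omega> (i, m))) + fst (\<omega> (i, k i))" using Nil i by simp
    also have "\<dots> = (\<Sum>m<Suc (k i). fst (\<omega> (i, m)))" by simp
    also have "\<dots> \<le> (\<Sum>j<Suc m. fst (\<omega> (i, j)))"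
      using pos[OF i] m by (intro sum_mono2) (auto intro: less_imp_le)
    also have "\<dots> = ring_time \<omega> (i, m)" by (simp add: ring_time_eq)
    finally show ?thesis by simp
  qed
  then show ?case by auto
next
  case (Cons a w)
  obtain j d where a: "a = (j, d)" by fastforce
  let ?T = "\<lambda>k i. \<Sum>m<k i. fst (\<omega> (i, m))"
  define k' where "k' = k(j := Suc (k j))"
  define v where "v = ring_time \<omega> (j, k j)"
  have v: "?T k j + fst (\<omega> (j, k j)) = v" by (simp add: v_def ring_time_eq)
  have T: "(?T k)(j := v) = ?T k'" by (auto simp: k'_def fun_eq_iff v[symmetric])
  have prem: "s < v" "v \<le> t" "snd (\<omega> (j, k j)) = d" "rings N t w v k' (?T k') \<omega>"
    using Cons.prems(1) by (simp_all add: a v T k'_def[symmetric])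
  have j: "j \<in> {1..N}" and w: "fst ` set w \<subseteq> {1..N}" using Cons.prems(2) a by auto
  note IH = Cons.IH[OF prem(4) w]
  have "set (labels w k') = {(i, m). i \<in> {1..N} \<and> k' i \<le> m \<and> ring_time \<omega> (i, m) \<le> t}"
    using IH by blast
  moreover have "set (labels (a # w) k) = insert (j, k j) (set (labels w k'))"
    by (simp add: a k'_def)
  ultimately have "set (labels (a # w) k) = insert (j, k j) {(i, m). i \<in> {1..N} \<and> k' i \<le> m \<and> ring_time \<omega> (i, m) \<le> t}"
    by (simp only:)
  also have "\<dots> = {(i, m). i \<in> {1..N} \<and> k i \<le> m \<and> ring_time \<omega> (i, m) \<le> t}"
    using j prem(2) by (auto simp: k'_def v_def Suc_le_eq le_less split: if_splits)
  finally have set: "set (labels (a # w) k) = \<dots>" .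
  have L: "labels (a # w) k = (j, k j) # labels w k'" by (simp add: a k'_def)
  have f: "sorted_wrt (<) (map (ring_time \<omega>) (labels w k'))" "\<forall>x\<in>set (labels w k'). v < ring_time \<omega> x"
    "map (\<lambda>x. (fst x, snd (\<omega> x))) (labels w k') = w" using IH by blast+
  have "\<forall>x\<in>set (labels (a # w) k). s < ring_time \<omega> x" unfolding L using f(2) prem(1) v_def by auto
  moreover have "sorted_wrt (<) (map (ring_time \<omega>) (labels (a # w) k))" unfolding L using f(1,2) v_def by simp
  moreover have "map (\<lambda>x. (fst x, snd (\<omega> x))) (labels (a # w) k) = a # w" unfolding L using f(3) prem(3) a by simp
  ultimately show ?case using set by blast
qed

text \<open>Strictly increasing keys are injective on the list, so insertions commute there and the
  fold may be evaluated in the order of the list itself.\<close>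

lemma sorted_key_list_of_set_eqI:
  assumes "sorted_wrt (<) (map f xs)"
  shows "sorted_key_list_of_set f (set xs) = (xs :: 'a list)"
proof -
  have xs: "sorted (map f xs)" "distinct xs" "inj_on f (set xs)"
    using assms by (auto simp: strict_sorted_iff distinct_map)
  interpret folding_on "set xs" "insort_key f" "[]"
  proof
    fix x y assume "x \<in> set xs" "y \<in> set xs"
    then show "insort_key f y \<circ> insort_key f x = insort_key f x \<circ> insort_key f y"
      using xs(3) by (cases "x = y") (auto simp: fun_eq_iff inj_on_def intro!: insort_key_left_comm)
  qed
  have "F (set ys) = ys" if "set ys \<subseteq> set xs" "sorted (map f ys)" "distinct ys" for ys
    using that by (induction ys) (auto simp: insort_is_Cons)
  then show ?thesis unfolding sorted_key_list_of_set_def using xs by blast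
qed

text \<open>The second part recovers the word from the sample point; this makes the events of
  different words disjoint.\<close>

lemma positions_rings:
  assumes pos: "\<And>i m. i \<in> {1..N} \<Longrightarrow> 0 < fst (\<omega> (i, m))"
    and w: "rings N t w 0 (\<lambda>_. 0) (\<lambda>_. 0) \<omega>" "fst ` set w \<subseteq> {1..N}"
  shows "positions N s y t \<omega> = fold (\<lambda>(i, d). attempt N s i d) w y"
    "w = map (\<lambda>x. (fst x, snd (\<omega> x))) (sorted_key_list_of_set (ring_time \<omega>) {(i, k). i \<in> {1..N} \<and> ring_time \<omega> (i, k) \<le> t})"
proof -
  let ?L = "labels w (\<lambda>_. 0)"
  have "sorted_wrt (<) (map (ring_time \<omega>) ?L) \<and> (\<forall>x\<in>set ?L. 0 < ring_time \<omega> x) \<and>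
    set ?L = {(i, m). i \<in> {1..N} \<and> 0 \<le> m \<and> ring_time \<omega> (i, m) \<le> t} \<and> map (\<lambda>x. (fst x, snd (\<omega> x))) ?L = w"
    using rings_labels[where N = N and \<omega> = \<omega> and w = w and k = "\<lambda>_. 0" and s = 0 and t = t] pos w by simp
  then have L: "sorted_key_list_of_set (ring_time \<omega>) {(i, k). i \<in> {1..N} \<and> ring_time \<omega> (i, k) \<le> t} = ?L"
    and m: "map (\<lambda>x. (fst x, snd (\<omega> x))) ?L = w"
    using sorted_key_list_of_set_eqI[of "ring_time \<omega>" ?L] by auto
  show "w = map (\<lambda>x. (fst x, snd (\<omega> x))) (sorted_key_list_of_set (ring_time \<omega>) {(i, k). i \<in> {1..N} \<and> ring_time \<omega> (i, k) \<le> t})"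
    unfolding L m ..
  show "positions N s y t \<omega> = fold (\<lambda>(i, d). attempt N s i d) w y"
    unfolding positions_def L by (subst m[symmetric]) (simp add: fold_map comp_def split_beta')
qed

text \<open>On the null set where two attempts coincide, \<open>sorted_key_list_of_set\<close> is an unspecified list,
  but one that only depends on the order relation between the finitely many keys.\<close>

lemma sorted_key_list_of_set_cong:
  fixes f g :: "'b \<Rightarrow> real"
  assumes "\<And>a b. a \<in> A \<Longrightarrow> b \<in> A \<Longrightarrow> f a \<le> f b \<longleftrightarrow> g a \<le> g b"
  shows "sorted_key_list_of_set f A = sorted_key_list_of_set g A"
proof -
  have insort: "insort_key f x xs = insort_key g x xs"
    if "\<And>a b. a \<in> A \<Longrightarrow> b \<in> A \<Longrightarrow> f a \<le> f b \<longleftrightarrow> g a \<le> g b" "x \<in> A" "set xs \<subseteq> A" for f g :: "'b \<Rightarrow> real" and x xs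
    using that by (induction xs) auto
  have graph: "fold_graph (insort_key g) [] B xs \<and> set xs = B"
    if "fold_graph (insort_key f) [] B xs" "B \<subseteq> A" "\<And>a b. a \<in> A \<Longrightarrow> b \<in> A \<Longrightarrow> f a \<le> f b \<longleftrightarrow> g a \<le> g b"
    for f g :: "'b \<Rightarrow> real" and B xs
    using that
  proof (induction rule: fold_graph.induct)
    case (insertI x B xs)
    have "insort_key f x xs = insort_key g x xs" by (rule insort) (use insertI in auto)
    then show ?case using insertI by (auto simp: set_insort_key intro: fold_graph.insertI)
  qed (auto intro: fold_graph.emptyI)
  have "fold_graph (insort_key f) [] A = fold_graph (insort_key g) [] A"
    using graph[of f A _ g] graph[of g A _ f] assms by (auto simp: fun_eq_iff)
  moreover have "sorted_key_list_of_set h A = Finite_Set.fold (insort_key h) [] A" for h :: "'b \<Rightarrow> real"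
    unfolding sorted_key_list_of_set_def by (rule folding_on.eq_fold[of "{}"]) (simp add: folding_on_def)
  ultimately show ?thesis by (simp add: Finite_Set.fold_def)
qed

section \<open>Measurability of the positions at time t\<close>

lemma fold_attempt_measurable:
  fixes N p
  defines "C \<equiv> clocks N p"
  shows "{\<omega> \<in> space C. Q (fold (\<lambda>(i, k). attempt N s i (snd (\<omega> (i, k)))) L y)} \<in> sets C"
proof (induction L arbitrary: y)
  case (Cons x L)
  have dir: "{\<omega> \<in> space C. snd (\<omega> x) = b} \<in> sets C" for b
  proof (cases "x \<in> {1..N} \<times> UNIV")
    case True
    from PiM_coord_measurable(2)[OF this, of p]
    have "(\<lambda>\<omega>. snd (\<omega> x)) \<in> measurable C (count_space UNIV)" by (simp add: C_def clocks_eq)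
    from measurable_sets[OF this, of "{b}"] show ?thesis by (simp add: vimage_def Int_def conj_commute)
  next
    case False
    have u: "\<omega> x = undefined" if "\<omega> \<in> space C" for \<omega>
      using PiE_arb[OF _ False, of \<omega> "\<lambda>_. UNIV"] that by (simp add: C_def clocks_eq space_PiM)
    have "{\<omega> \<in> space C. snd (\<omega> x) = b} = {\<omega> \<in> space C. snd (undefined :: real \<times> bool) = b}"
      by (rule Collect_cong) (metis u)
    then show ?thesis by simp
  qed
  have "{\<omega> \<in> space C. Q (fold (\<lambda>(i, k). attempt N s i (snd (\<omega> (i, k)))) (x # L) y)}
    = (\<Union>b\<in>UNIV. {\<omega> \<in> space C. snd (\<omega> x) = b} \<inter>
        {\<omega> \<in> space C. Q (fold (\<lambda>(i, k). attempt N s i (snd (\<omega> (i, k)))) L (attempt N s (fst x) b y))})"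
    by (cases x) auto
  then show ?case using dir Cons.IH by (auto intro!: sets.finite_UN sets.Int)
qed auto

text \<open>The sample points with finitely many attempts up to t fall into countably many cells,
  given by the set of these attempts and the order relation of their ring times, ties included. On
  each cell the list of attempts is constant and only the directions vary; the remaining sample
  points form one further set.\<close>

lemma positions_measurable:
  fixes N p
  defines "C \<equiv> clocks N p"
  shows "{\<omega> \<in> space C. Q (positions N s y t \<omega>)} \<in> sets C"
proof -
  let ?I = "{1..N} \<times> (UNIV :: nat set)"
  define A where "A \<omega> = {(i, k). i \<in> {1..N} \<and> ring_time \<omega> (i, k) \<le> t}" for \<omega>
  define r where "r \<omega> = {(a, b) \<in> A \<omega> \<times> A \<omega>. ring_time \<omega> a \<le> ring_time \<omega> b}" for \<omega>
  have A_sub: "A \<omega> \<subseteq> ?I" for \<omega> by (auto simp: A_def)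
  have ring: "(\<lambda>\<omega>. ring_time \<omega> x) \<in> borel_measurable C" if "x \<in> ?I" for x
  proof -
    have "(\<lambda>\<omega>. fst (\<omega> (fst x, j))) \<in> borel_measurable C" for j
      unfolding C_def clocks_eq by (rule PiM_coord_measurable) (use that in auto)
    then show ?thesis unfolding ring_time_def split_beta by (intro borel_measurable_sum)
  qed
  have in_A: "{\<omega> \<in> space C. x \<in> A \<omega>} \<in> sets C" if "x \<in> ?I" for x
  proof -
    have "{\<omega> \<in> space C. x \<in> A \<omega>} = {\<omega> \<in> space C. ring_time \<omega> x \<le> t}" using that by (auto simp: A_def)
    then show ?thesis using ring[OF that] by simp
  qed
  have A_eq: "{\<omega> \<in> space C. A \<omega> = A0} \<in> sets C" if "A0 \<subseteq> ?I" for A0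
  proof -
    have "{\<omega> \<in> space C. A \<omega> = A0} = {\<omega> \<in> space C. \<forall>x\<in>?I. x \<in> A \<omega> \<longleftrightarrow> x \<in> A0}"
      using A_sub that by blast
    also have "\<dots> \<in> sets C"
    proof (rule sets.sets_Collect_countable_Ball)
      show "{\<omega> \<in> space C. x \<in> A \<omega> \<longleftrightarrow> x \<in> A0} \<in> sets C" for x
      proof (cases "x \<in> ?I")
        case True
        then show ?thesis using in_A[OF True] by (cases "x \<in> A0") (auto intro: sets.sets_Collect_neg)
      next
        case False
        then have "{\<omega> \<in> space C. x \<in> A \<omega> \<longleftrightarrow> x \<in> A0} = space C" using A_sub that by blast
        then show ?thesis by simp
      qed
    qed
    finally show ?thesis .
  qed
  have le: "{\<omega> \<in> space C. ring_time \<omega> a \<le> ring_time \<omega> b} \<in> sets C" if "a \<in> ?I" "b \<in> ?I" for a b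
    using ring[OF that(1)] ring[OF that(2)] by simp
  have r_eq: "{\<omega> \<in> space C. A \<omega> = A0 \<and> r \<omega> = r0} \<in> sets C" if A0: "A0 \<subseteq> ?I" and r0: "r0 \<subseteq> A0 \<times> A0" for A0 r0
  proof -
    have "{\<omega> \<in> space C. A \<omega> = A0 \<and> r \<omega> = r0} = {\<omega> \<in> space C. A \<omega> = A0} \<inter>
      {\<omega> \<in> space C. \<forall>x\<in>A0 \<times> A0. ring_time \<omega> (fst x) \<le> ring_time \<omega> (snd x) \<longleftrightarrow> x \<in> r0}"
      using r0 unfolding r_def by auto
    also have "\<dots> \<in> sets C"
      unfolding Ball_def
    proof (intro sets.Int A_eq A0 sets.sets_Collect_countable_All)
      fix x :: "(nat \<times> nat) \<times> (nat \<times> nat)"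
      show "{\<omega> \<in> space C. x \<in> A0 \<times> A0 \<longrightarrow> (ring_time \<omega> (fst x) \<le> ring_time \<omega> (snd x) \<longleftrightarrow> x \<in> r0)} \<in> sets C"
      proof (cases "x \<in> A0 \<times> A0")
        case True
        then have "{\<omega> \<in> space C. ring_time \<omega> (fst x) \<le> ring_time \<omega> (snd x)} \<in> sets C" using A0 by (intro le) auto
        from this sets.sets_Collect_neg[OF this] show ?thesis using True by (cases "x \<in> r0") simp_all
      qed simp
    qed
    finally show ?thesis .
  qed
  define \<F> where "\<F> = {(A0, r0). A0 \<subseteq> ?I \<and> finite A0 \<and> r0 \<subseteq> A0 \<times> A0}"
  have "countable \<F>"
  proof -
    have "countable {A0 :: (nat \<times> nat) set. finite A0}" "countable {r0 :: ((nat \<times> nat) \<times> (nat \<times> nat)) set. finite r0}"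
      using countable_Collect_finite by auto
    then have "countable ({A0 :: (nat \<times> nat) set. finite A0} \<times> {r0 :: ((nat \<times> nat) \<times> (nat \<times> nat)) set. finite r0})"
      by (rule countable_SIGMA)
    then show ?thesis
      by (rule countable_subset[rotated]) (auto simp: \<F>_def intro: finite_subset[OF _ finite_SigmaI])
  qed
  define E where "E F = {\<omega> \<in> space C. A \<omega> = fst F \<and> r \<omega> = snd F}" for F
  have E_sets: "E F \<in> sets C" if "F \<in> \<F>" for F
    using that r_eq[of "fst F" "snd F"] by (auto simp: E_def \<F>_def)
  let ?pos = "\<lambda>L \<omega>. fold (\<lambda>(i, k). attempt N s i (snd (\<omega> (i, k)))) L y"
  \<comment> \<open>Any sample point of the cell would do, by
    \<open>sorted_key_list_of_set_cong\<close>.\<close>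
  define L where "L F = sorted_key_list_of_set (ring_time (SOME \<omega>. \<omega> \<in> E F)) (fst F)" for F
  have pos_E: "positions N s y t \<omega> = ?pos (L F) \<omega>" if "\<omega> \<in> E F" for F \<omega>
  proof -
    define \<omega>' where "\<omega>' = (SOME \<omega>. \<omega> \<in> E F)"
    have \<omega>': "\<omega>' \<in> E F" unfolding \<omega>'_def by (rule someI[of "\<lambda>\<omega>. \<omega> \<in> E F", OF that])
    have "sorted_key_list_of_set (ring_time \<omega>) (fst F) = sorted_key_list_of_set (ring_time \<omega>') (fst F)"
    proof (rule sorted_key_list_of_set_cong)
      fix a b assume ab: "a \<in> fst F" "b \<in> fst F"
      have "ring_time \<zeta> a \<le> ring_time \<zeta> b \<longleftrightarrow> (a, b) \<in> snd F" if "\<zeta> \<in> E F" for \<zeta>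
        using that ab by (auto simp: E_def r_def)
      then show "ring_time \<omega> a \<le> ring_time \<omega> b \<longleftrightarrow> ring_time \<omega>' a \<le> ring_time \<omega>' b" using that \<omega>' by blast
    qed
    moreover have "A \<omega> = fst F" using that by (simp add: E_def)
    ultimately show ?thesis by (simp add: positions_def L_def A_def \<omega>'_def)
  qed
  \<comment> \<open>A fold over an infinite set returns its start value, here the empty list, so no
    attempt is carried out.\<close>
  have inf: "positions N s y t \<omega> = y" if "infinite (A \<omega>)" for \<omega>
  proof -
    have "sorted_key_list_of_set (ring_time \<omega>) (A \<omega>) = Finite_Set.fold (insort_key (ring_time \<omega>)) [] (A \<omega>)"
      unfolding sorted_key_list_of_set_def by (rule folding_on.eq_fold[of "{}"]) (simp add: folding_on_def)
    then show ?thesis using that by (simp add: positions_def A_def)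
  qed
  have cover: "(\<exists>F\<in>\<F>. \<omega> \<in> E F) \<longleftrightarrow> finite (A \<omega>)" if "\<omega> \<in> space C" for \<omega>
  proof
    assume "finite (A \<omega>)"
    then have "(A \<omega>, r \<omega>) \<in> \<F>" using A_sub by (auto simp: \<F>_def r_def)
    then show "\<exists>F\<in>\<F>. \<omega> \<in> E F" using that by (intro bexI[of _ "(A \<omega>, r \<omega>)"]) (auto simp: E_def)
  qed (auto simp: E_def \<F>_def)
  have "{\<omega> \<in> space C. Q (positions N s y t \<omega>)} =
    (\<Union>F\<in>\<F>. E F \<inter> {\<omega> \<in> space C. Q (?pos (L F) \<omega>)}) \<union> (if Q y then space C - (\<Union>F\<in>\<F>. E F) else {})"
  proof (rule set_eqI)
    fix \<omega>
    show "\<omega> \<in> {\<omega> \<in> space C. Q (positions N s y t \<omega>)} \<longleftrightarrow>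
      \<omega> \<in> (\<Union>F\<in>\<F>. E F \<inter> {\<omega> \<in> space C. Q (?pos (L F) \<omega>)}) \<union> (if Q y then space C - (\<Union>F\<in>\<F>. E F) else {})"
    proof (cases "\<omega> \<in> space C")
      case True
      show ?thesis
      proof (cases "finite (A \<omega>)")
        case fin: True
        then obtain F where "F \<in> \<F>" "\<omega> \<in> E F" using cover[OF True] by blast
        moreover have "Q (?pos (L F') \<omega>) \<longleftrightarrow> Q (positions N s y t \<omega>)" if "\<omega> \<in> E F'" for F'
          by (simp only: pos_E[OF that])
        ultimately have "\<omega> \<in> (\<Union>F\<in>\<F>. E F \<inter> {\<omega> \<in> space C. Q (?pos (L F) \<omega>)}) \<longleftrightarrow> Q (positions N s y t \<omega>)"
          "\<omega> \<in> (\<Union>F\<in>\<F>. E F)"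
          using True by blast+
        then show ?thesis using True by simp
      next
        case False
        then have "\<not> (\<exists>F\<in>\<F>. \<omega> \<in> E F)" using cover[OF True] by blast
        then show ?thesis using True inf[OF False] by auto
      qed
    qed (auto simp: E_def)
  qed
  also have "\<dots> \<in> sets C"
    using E_sets fold_attempt_measurable[of N p Q s _ y] \<open>countable \<F>\<close>
    by (intro sets.Un sets.countable_UN' sets.Int) (auto simp: C_def intro!: sets.countable_UN')
  finally show ?thesis .
qed


section \<open>Sums over words and the series for the probability\<close>

definition words :: "nat \<Rightarrow> nat \<Rightarrow> (nat \<times> bool) list set" where
  "words N n = {w. set w \<subseteq> {1..N} \<times> UNIV \<and> length w = n}"

lemma finite_words [simp]: "finite (words N n)"
  unfolding words_def by (rule finite_lists_length_eq) simp

lemma words_Suc: "words N (Suc n) = (\<lambda>(a, w). a # w) ` (({1..N} \<times> UNIV) \<times> words N n)"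
  unfolding words_def by (auto simp: length_Suc_conv image_iff)

abbreviation run :: "nat \<Rightarrow> (nat \<Rightarrow> nat) \<Rightarrow> (nat \<times> bool) list \<Rightarrow> (nat \<Rightarrow> int) \<Rightarrow> (nat \<Rightarrow> int)" where
  "run N s \<equiv> fold (\<lambda>(i, d). attempt N s i d)"

text \<open>Not normalised: each step sums over the N labels, so the total mass is N^n, in
  accordance with the weight e^(-Nt) t^n / n! of a single word.\<close>

primrec avg :: "nat \<Rightarrow> real \<Rightarrow> (nat \<Rightarrow> nat) \<Rightarrow> ((nat \<Rightarrow> int) \<Rightarrow> bool) \<Rightarrow> nat \<Rightarrow> (nat \<Rightarrow> int) \<Rightarrow> real" where
  "avg N p s Q 0 y = (if Q y then 1 else 0)"
| "avg N p s Q (Suc n) y =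
     (\<Sum>i\<in>{1..N}. p * avg N p s Q n (attempt N s i True y) + (1 - p) * avg N p s Q n (attempt N s i False y))"

lemma avg_eq_sum_words:
  "avg N p s Q n y = (\<Sum>w\<in>words N n. if Q (run N s w y) then weight p w else 0)"
proof (induction n arbitrary: y)
  case 0
  have "words N 0 = {[]}" by (auto simp: words_def)
  then show ?case by simp
next
  case (Suc n)
  have "(\<Sum>w\<in>words N (Suc n). if Q (run N s w y) then weight p w else 0)
    = (\<Sum>(a, w)\<in>({1..N} \<times> UNIV) \<times> words N n. if Q (run N s (a # w) y) then weight p (a # w) else 0)"
    unfolding words_Suc by (subst sum.reindex) (auto simp: inj_on_def split_beta')
  also have "\<dots> = (\<Sum>a\<in>{1..N} \<times> UNIV. \<Sum>w\<in>words N n. if Q (run N s (a # w) y) then weight p (a # w) else 0)"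
    by (rule sum.cartesian_product[symmetric])
  also have "\<dots> = (\<Sum>a\<in>{1..N} \<times> UNIV. (if snd a then p else 1 - p) * avg N p s Q n (attempt N s (fst a) (snd a) y))"
    unfolding Suc.IH sum_distrib_left by (intro sum.cong) (auto simp: split_beta')
  also have "\<dots> = (\<Sum>i\<in>{1..N}. \<Sum>d\<in>UNIV. (if d then p else 1 - p) * avg N p s Q n (attempt N s i d y))"
    by (subst sum.cartesian_product) (auto simp: split_beta')
  finally show ?case by (simp add: UNIV_bool add.commute)
qed

lemma avg_True: "avg N p s (\<lambda>_. True) n y = real N ^ n"
proof (induction n arbitrary: y)
  case (Suc n)
  have "p * real N ^ n + (1 - p) * real N ^ n = real N ^ n" by (simp add: algebra_simps)
  then show ?case by (simp add: Suc)
qed simp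

text \<open>Almost sure finiteness and absence of ties are not shown path by path. The events of the
  words of length n are disjoint and have total probability e^(-Nt) (Nt)^n / n!; these numbers add
  up to 1, so the events exhaust the space up to a null set.\<close>

theorem positions_prob_sums:
  assumes t: "0 \<le> t" and p: "0 \<le> p" "p \<le> 1"
  shows "(\<lambda>n. exp (- real N * t) * (t ^ n / fact n) * avg N p s Q n y) sums
    measure (clocks N p) {\<omega> \<in> space (clocks N p). Q (positions N s y t \<omega>)}"
proof -
  let ?I = "{1..N} \<times> (UNIV :: nat set)"
  let ?C = "clocks N p"
  interpret PP: product_prob_space "\<lambda>_. clock p" ?I
    by (intro product_prob_space.intro product_sigma_finite.intro product_prob_space_axioms.intro)
      (auto intro: prob_space_clock prob_space_imp_sigma_finite)
  interpret C: prob_space ?C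
    unfolding clocks_eq by (rule prob_space_PiM) (rule prob_space_clock)
  define Pos where "Pos = {\<omega> \<in> space ?C. \<forall>x\<in>?I. 0 < fst (\<omega> x)}"
  define R where "R w = {\<omega> \<in> Pos. rings N t w 0 (\<lambda>_. 0) (\<lambda>_. 0) \<omega>}" for w
  have coord: "(\<lambda>\<omega>. fst (\<omega> x)) \<in> borel_measurable ?C" if "x \<in> ?I" for x
    unfolding clocks_eq using that by (rule PiM_coord_measurable)
  have Pos_sets: "Pos \<in> sets ?C"
    unfolding Pos_def
    unfolding Ball_def
  proof (rule sets.sets_Collect_countable_All)
    fix x :: "nat \<times> nat"
    show "{\<omega> \<in> space ?C. x \<in> ?I \<longrightarrow> 0 < fst (\<omega> x)} \<in> sets ?C"
      using coord[of x] by (cases "x \<in> ?I") simp_all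
  qed
  have AE_Pos: "AE \<omega> in ?C. \<omega> \<in> Pos"
  proof -
    have "AE \<omega> in ?C. 0 < fst (\<omega> x)" if x: "x \<in> ?I" for x
    proof -
      have "emeasure ?C {\<omega> \<in> space ?C. \<omega> x \<in> {y. 0 < fst y}} = emeasure (clock p) {y. 0 < fst y}"
        unfolding clocks_eq
        using x measurable_sets[OF fst_clock[of p], of "{0<..}"] by (intro PP.emeasure_PiM_Collect_single) (auto simp: vimage_def)
      also have "\<dots> = 1" using emeasure_clock_gt[of 0 p] by simp
      finally have "C.prob {\<omega> \<in> space ?C. 0 < fst (\<omega> x)} = 1" by (simp add: measure_def)
      then show ?thesis using coord[OF x] by (subst (asm) C.prob_Collect_eq_1) auto
    qed
    then have "AE \<omega> in ?C. \<forall>x\<in>?I. 0 < fst (\<omega> x)" by (subst AE_ball_countable) auto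
    then show ?thesis by (rule AE_mp) (auto simp: Pos_def)
  qed
  have w_range: "fst ` set w \<subseteq> {1..N}" if "w \<in> words N n" for w n
    using that by (auto simp: words_def)
  have R_meas: "{\<omega> \<in> space ?C. rings N t w 0 (\<lambda>_. 0) (\<lambda>_. 0) \<omega>} \<in> sets ?C" if "w \<in> words N n" for w n
  proof -
    have "Measurable.pred ?C (\<lambda>\<omega>. rings N t w 0 (\<lambda>_. 0) (\<lambda>_. 0) \<omega>)"
      unfolding clocks_eq
      by (rule rings_measurable[where s = "\<lambda>_. 0" and \<tau> = "\<lambda>_ _. 0" and X = "\<lambda>\<omega>. \<omega>"])
        (use PiM_coord_measurable[of _ ?I p] w_range[OF that] in auto)
    then show ?thesis by (simp only: pred_def)
  qed
  have R_sets: "R w \<in> sets ?C" if "w \<in> words N n" for w n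
  proof -
    have "R w = Pos \<inter> {\<omega> \<in> space ?C. rings N t w 0 (\<lambda>_. 0) (\<lambda>_. 0) \<omega>}" by (auto simp: R_def Pos_def)
    then show ?thesis using Pos_sets R_meas[OF that] by auto
  qed
  have weight_nonneg: "0 \<le> weight p w" for w using p by (induction w) auto
  have R_prob: "C.prob (R w) = exp (- real N * t) * (t ^ n / fact n) * weight p w" if w: "w \<in> words N n" for w n
  proof -
    have "C.prob (R w) = C.prob {\<omega> \<in> space ?C. rings N t w 0 (\<lambda>_. 0) (\<lambda>_. 0) \<omega>}"
      using AE_Pos by (intro C.finite_measure_eq_AE R_sets[OF w] R_meas[OF w]) (auto simp: R_def Pos_def elim: AE_mp)
    also have "\<dots> = exp (- real N * t) * (t ^ n / fact n) * weight p w"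
    proof -
      have "length w = n" using w by (simp add: words_def)
      then show ?thesis
        using emeasure_rings[OF t _ w_range[OF w], of "\<lambda>_. 0" "\<lambda>_. 0" ?I p] p t weight_nonneg[of w]
        unfolding clocks_eq measure_def by (simp add: mult_ac)
    qed
    finally show ?thesis .
  qed
  have pos: "0 < fst (\<omega> (i, m))" if "\<omega> \<in> Pos" "i \<in> {1..N}" for \<omega> i m using that by (auto simp: Pos_def)
  have R_run: "positions N s y t \<omega> = run N s w y" if "\<omega> \<in> R w" "w \<in> words N n" for \<omega> w n
    by (rule positions_rings(1)) (use that pos w_range in \<open>auto simp: R_def\<close>)
  have R_unique: "w = w'" if "\<omega> \<in> R w" "w \<in> words N n" "\<omega> \<in> R w'" "w' \<in> words N n'" for \<omega> w w' n n'
  proof -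
    have "w = map (\<lambda>x. (fst x, snd (\<omega> x))) (sorted_key_list_of_set (ring_time \<omega>) {(i, k). i \<in> {1..N} \<and> ring_time \<omega> (i, k) \<le> t})"
      by (rule positions_rings(2)) (use that pos w_range in \<open>auto simp: R_def\<close>)
    also have "\<dots> = w'"
      by (rule positions_rings(2)[symmetric]) (use that pos w_range in \<open>auto simp: R_def\<close>)
    finally show ?thesis .
  qed
  define E where "E Q n = (\<Union>w\<in>{w \<in> words N n. Q (run N s w y)}. R w)" for Q n
  have E_sets: "E Q n \<in> sets ?C" for Q n
    unfolding E_def using R_sets by (intro sets.finite_UN) auto
  have E_prob: "C.prob (E Q n) = exp (- real N * t) * (t ^ n / fact n) * avg N p s Q n y" for Q n
  proof -
    have "C.prob (E Q n) = (\<Sum>w\<in>{w \<in> words N n. Q (run N s w y)}. C.prob (R w))"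
      unfolding E_def
      by (rule C.finite_measure_finite_Union) (use R_sets R_unique in \<open>auto simp: disjoint_family_on_def\<close>)
    also have "\<dots> = (\<Sum>w\<in>{w \<in> words N n. Q (run N s w y)}. exp (- real N * t) * (t ^ n / fact n) * weight p w)"
      by (rule sum.cong) (auto simp: R_prob)
    also have "\<dots> = (\<Sum>w\<in>words N n. if Q (run N s w y) then exp (- real N * t) * (t ^ n / fact n) * weight p w else 0)"
      by (rule sum.mono_neutral_cong_left) auto
    finally show ?thesis
      unfolding avg_eq_sum_words sum_distrib_left by (simp add: if_distrib cong: if_cong)
  qed
  have E_sums: "(\<lambda>n. C.prob (E Q n)) sums C.prob (\<Union>n. E Q n)" for Q
  proof (rule C.finite_measure_UNION)
    show "disjoint_family (E Q)"
      unfolding disjoint_family_on_def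
    proof (intro ballI impI, rule ccontr)
      fix m n :: nat assume "m \<noteq> n" "E Q m \<inter> E Q n \<noteq> {}"
      then obtain \<omega> w w' where "\<omega> \<in> R w" "w \<in> words N m" "\<omega> \<in> R w'" "w' \<in> words N n" unfolding E_def by blast
      moreover from R_unique[OF this] have "w = w'" .
      ultimately show False using \<open>m \<noteq> n\<close> by (auto simp: words_def)
    qed
  qed (use E_sets in auto)
  define U where "U = (\<Union>n. E (\<lambda>_. True) n)"
  have U: "U \<in> sets ?C" using E_sets by (auto simp: U_def)
  have "C.prob U = 1"
  proof -
    have "(\<lambda>n. exp (- real N * t) * ((real N * t) ^ n /\<^sub>R fact n)) sums (exp (- real N * t) * exp (real N * t))"
      by (intro sums_mult exp_converges)
    moreover have "C.prob (E (\<lambda>_. True) n) = exp (- real N * t) * ((real N * t) ^ n /\<^sub>R fact n)" for n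
      unfolding E_prob avg_True by (simp add: power_mult_distrib field_simps)
    ultimately have "(\<lambda>n. C.prob (E (\<lambda>_. True) n)) sums 1" by (simp add: exp_minus)
    then show ?thesis using E_sums[of "\<lambda>_. True"] unfolding U_def by (rule sums_unique2[rotated])
  qed
  then have "AE \<omega> in ?C. \<omega> \<in> U" using U by (simp add: C.prob_eq_1)
  then have "C.prob {\<omega> \<in> space ?C. Q (positions N s y t \<omega>)} = C.prob (\<Union>n. E Q n)"
  proof (intro C.finite_measure_eq_AE positions_measurable)
    show "AE \<omega> in ?C. \<omega> \<in> {\<omega> \<in> space ?C. Q (positions N s y t \<omega>)} \<longleftrightarrow> \<omega> \<in> (\<Union>n. E Q n)"
      using \<open>AE \<omega> in ?C. \<omega> \<in> U\<close>
    proof (rule AE_mp, intro AE_I2 impI)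
      fix \<omega> assume \<omega>: "\<omega> \<in> space ?C" "\<omega> \<in> U"
      then obtain n w where w: "w \<in> words N n" "\<omega> \<in> R w" unfolding U_def E_def by blast
      have "\<omega> \<in> (\<Union>n. E Q n) \<longleftrightarrow> Q (run N s w y)"
        using w R_unique[OF w(2,1)] unfolding E_def by blast
      then show "\<omega> \<in> {\<omega> \<in> space ?C. Q (positions N s y t \<omega>)} \<longleftrightarrow> \<omega> \<in> (\<Union>n. E Q n)"
        using \<omega> R_run[OF w(2,1)] by simp
    qed
  qed (use E_sets in auto)
  then show ?thesis using E_sums[of Q] unfolding E_prob by simp
qed

section \<open>The main theorem\<close>

lemma site_image:
  assumes "incr N y" "i \<in> {1..N}"
  shows "site (y ` {1..N}) i = y i"
proof -
  let ?xs = "map y [1..<Suc N]"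
  have "sorted_wrt (<) ?xs"
    by (auto simp: sorted_wrt_iff_nth_less nth_append intro!: incr_less[OF assms(1)])
  then have "sorted_list_of_set (set ?xs) = ?xs"
    by (intro sorted_list_of_set.idem_if_sorted_distinct) (auto simp: strict_sorted_iff)
  moreover have "set ?xs = y ` {1..N}" by (simp only: set_map set_upt) auto
  ultimately have "sorted_list_of_set (y ` {1..N}) = ?xs" by simp
  moreover have "?xs ! (i - 1) = y i"
  proof -
    have "[1..<Suc N] ! (i - 1) = i" using assms(2) by (subst nth_upt) auto
    moreover have "i - 1 < length [1..<Suc N]" using assms(2) by (simp del: upt_Suc) linarith
    ultimately show ?thesis by (simp only: nth_map)
  qed
  ultimately show ?thesis by (simp only: site_def)
qed

lemma configurations_site:
  assumes "(X, \<pi>) \<in> configurations N M"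
  shows "incr N (site X)" "site X ` {1..N} = X" "\<pi> \<in> {1..N} \<rightarrow>\<^sub>E {1..M}"
proof -
  have X: "finite X" "card X = N" "\<pi> \<in> {1..N} \<rightarrow>\<^sub>E {1..M}" using assms by (auto simp: configurations_def)
  let ?xs = "sorted_list_of_set X"
  have len: "length ?xs = N" using X by simp
  show "incr N (site X)"
    unfolding incr_def
  proof
    fix i assume i: "i \<in> {1..<N}"
    have "sorted_wrt (<) ?xs" by simp
    from sorted_wrt_nth_less[OF this, of "i - 1" i] show "site X i < site X (Suc i)"
      using i len by (simp add: site_def)
  qed
  have "site X ` {1..N} = (!) ?xs ` {..<N}"
  proof -
    have "(\<lambda>i. i - 1) ` {1..N} = {..<N}"
    proof
      show "{..<N} \<subseteq> (\<lambda>i. i - 1) ` {1..N}"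
      proof
        fix i assume "i \<in> {..<N}"
        then show "i \<in> (\<lambda>i. i - 1) ` {1..N}" by (intro image_eqI[of _ _ "Suc i"]) auto
      qed
    qed auto
    then show ?thesis unfolding site_def by (metis image_image)
  qed
  also have "\<dots> = set ?xs" using len by (auto simp: set_conv_nth)
  finally show "site X ` {1..N} = X" using X by simp
  show "\<pi> \<in> {1..N} \<rightarrow>\<^sub>E {1..M}" by fact
qed

text \<open>The label \<open>i\<close> has rank \<open>\<tau> i\<close> in the configuration \<open>(y, \<nu>)\<close>.\<close>

definition labelled :: "nat \<Rightarrow> (nat \<Rightarrow> nat) \<Rightarrow> (nat \<Rightarrow> int) \<Rightarrow> (nat \<Rightarrow> int) \<Rightarrow> (nat \<Rightarrow> nat) \<Rightarrow> (nat \<Rightarrow> nat) \<Rightarrow> bool" where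
  "labelled N s pos y \<nu> \<tau> \<longleftrightarrow> \<tau> permutes {1..N} \<and> incr N y \<and> (\<forall>i\<in>{1..N}. pos i = y (\<tau> i) \<and> s i = \<nu> (\<tau> i))"

lemma labelled_image:
  assumes "labelled N s pos y \<nu> \<tau>"
  shows "pos ` {1..N} = y ` {1..N}"
proof -
  have "pos ` {1..N} = y ` (\<tau> ` {1..N})"
    using assms unfolding labelled_def image_image by (intro image_cong) auto
  then show ?thesis using permutes_image assms unfolding labelled_def by metis
qed

lemma incr_inj: "incr N y \<Longrightarrow> a \<in> {1..N} \<Longrightarrow> b \<in> {1..N} \<Longrightarrow> y a = y b \<Longrightarrow> a = b"
  using incr_less[of N y a b] incr_less[of N y b a] by (cases a b rule: linorder_cases) auto

lemma labelled_inv_into: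
  assumes L: "labelled N s pos y \<nu> \<tau>" and l: "l \<in> {1..N}"
  shows "inv_into {1..N} pos (y l) = inv \<tau> l" "inv \<tau> l \<in> {1..N}" "\<tau> (inv \<tau> l) = l"
proof -
  have \<tau>: "\<tau> permutes {1..N}" and y: "incr N y" using L by (auto simp: labelled_def)
  show j: "inv \<tau> l \<in> {1..N}" using permutes_in_image[OF permutes_inv[OF \<tau>]] l by blast
  show e: "\<tau> (inv \<tau> l) = l" by (rule permutes_inverses(1)[OF \<tau>])
  have "inj_on pos {1..N}"
  proof (rule inj_onI)
    fix a b assume ab: "a \<in> {1..N}" "b \<in> {1..N}" "pos a = pos b"
    then have "y (\<tau> a) = y (\<tau> b)" using L by (simp add: labelled_def)
    then have "\<tau> a = \<tau> b" using incr_inj[OF y] permutes_in_image[OF \<tau>] ab by blast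
    then show "a = b" using permutes_inj[OF \<tau>] by (simp add: inj_eq)
  qed
  moreover have "pos (inv \<tau> l) = y l" using L j e by (simp add: labelled_def)
  ultimately show "inv_into {1..N} pos (y l) = inv \<tau> l" using j by (metis inv_into_f_f)
qed

lemma config_of_labelled:
  assumes L: "labelled N s pos y \<nu> \<tau>" and \<nu>: "\<nu> \<in> {1..N} \<rightarrow>\<^sub>E A"
  shows "config_of N s pos = (y ` {1..N}, \<nu>)"
proof -
  have y: "incr N y" using L by (simp add: labelled_def)
  have "(\<lambda>i\<in>{1..N}. s (inv_into {1..N} pos (site (y ` {1..N}) i))) = \<nu>"
  proof
    fix i show "(\<lambda>i\<in>{1..N}. s (inv_into {1..N} pos (site (y ` {1..N}) i))) i = \<nu> i"
    proof (cases "i \<in> {1..N}")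
      case True
      have "s (inv \<tau> i) = \<nu> i"
        using L labelled_inv_into(2,3)[OF L True] by (simp add: labelled_def)
      then show ?thesis using True site_image[OF y True] labelled_inv_into(1)[OF L True] by simp
    next
      case False
      show ?thesis using PiE_arb[OF \<nu> False] restrict_apply[of _ "{1..N}" i] False by (simp only: if_False)
    qed
  qed
  then show ?thesis unfolding config_of_def Let_def labelled_image[OF L] by simp
qed

text \<open>Positions increase with the rank, so a rank strictly between those of two neighbouring
  sites would need an integer strictly between the sites.\<close>

lemma mem_image_succ:
  assumes y: "incr N y" and k: "k \<in> {1..N}"
  shows "y k + 1 \<in> y ` {1..N} \<longleftrightarrow> k \<in> adj N y" "y k - 1 \<in> y ` {1..N} \<longleftrightarrow> k \<in> Suc ` adj N y"
proof -
  have succ: "l = Suc j" if "j \<in> {1..N}" "l \<in> {1..N}" "y l = y j + 1" for j l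
  proof (rule ccontr)
    assume "l \<noteq> Suc j"
    moreover have "j < l"
      using incr_le[OF y, of l j] that by (cases "l \<le> j") auto
    ultimately have "Suc j < l" by linarith
    have "y j < y (Suc j)" by (rule incr_less[OF y]) (use that \<open>Suc j < l\<close> in auto)
    moreover have "y (Suc j) < y l" by (rule incr_less[OF y]) (use that \<open>Suc j < l\<close> in auto)
    ultimately show False using that(3) by linarith
  qed
  show "y k + 1 \<in> y ` {1..N} \<longleftrightarrow> k \<in> adj N y"
  proof
    assume "y k + 1 \<in> y ` {1..N}"
    then obtain l where l: "l \<in> {1..N}" "y l = y k + 1" by auto
    then show "k \<in> adj N y" using succ[OF k l] k by (auto simp: adj_def)
  next
    assume "k \<in> adj N y"
    then show "y k + 1 \<in> y ` {1..N}" by (intro image_eqI[of _ _ "Suc k"]) (auto simp: adj_def)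
  qed
  show "y k - 1 \<in> y ` {1..N} \<longleftrightarrow> k \<in> Suc ` adj N y"
  proof
    assume "y k - 1 \<in> y ` {1..N}"
    then obtain l where l: "l \<in> {1..N}" "y k = y l + 1" by auto
    then show "k \<in> Suc ` adj N y" using succ[OF l(1) k l(2)] k by (auto simp: adj_def)
  next
    assume "k \<in> Suc ` adj N y"
    then obtain m where "k = Suc m" "m \<in> adj N y" by auto
    then show "y k - 1 \<in> y ` {1..N}" by (intro image_eqI[of _ _ m]) (auto simp: adj_def)
  qed
qed

text \<open>Every label keeps its species. An exchange of neighbours therefore leaves the occupied
  sites alone and appears as \<open>T m\<close> in the species read from the left and as a left
  factor in the ranks.\<close>

lemma labelled_swap:
  assumes L: "labelled N s pos y \<nu> \<tau>" and m: "m \<in> adj N y"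
    and i: "i = inv \<tau> m" and j: "j = inv \<tau> (Suc m)"
  shows "labelled N s (pos(i := y (Suc m), j := y m)) y (T m \<nu>) (adjswap m \<circ> \<tau>)"
proof -
  have mN: "1 \<le> m" "m < N" using m by (auto simp: adj_def)
  have \<tau>: "\<tau> permutes {1..N}" using L by (simp add: labelled_def)
  have eq: "\<tau> l = k \<longleftrightarrow> l = inv \<tau> k" for l k using permutes_inverses[OF \<tau>] by metis
  have ij: "i \<noteq> j" unfolding i j using eq by (metis n_not_Suc_n)
  have "adjswap m \<circ> \<tau> permutes {1..N}" using permutes_compose[OF \<tau> adjswap_permutes[OF mN]] .
  moreover have "(pos(i := y (Suc m), j := y m)) l = y ((adjswap m \<circ> \<tau>) l) \<and> s l = T m \<nu> ((adjswap m \<circ> \<tau>) l)"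
    if l: "l \<in> {1..N}" for l
  proof -
    have pl: "pos l = y (\<tau> l)" "s l = \<nu> (\<tau> l)" using L l by (auto simp: labelled_def)
    consider "l = i" | "l = j" | "l \<noteq> i" "l \<noteq> j" by blast
    then show ?thesis
    proof cases
      case 1
      then have "\<tau> l = m" using eq i by simp
      then show ?thesis using 1 ij pl by simp
    next
      case 2
      then have "\<tau> l = Suc m" using eq j by simp
      then show ?thesis using 2 pl by simp
    next
      case 3
      then have "\<tau> l \<noteq> m" "\<tau> l \<noteq> Suc m" using eq i j by auto
      then show ?thesis using 3 pl by simp
    qed
  qed
  ultimately show ?thesis using L unfolding labelled_def by blast
qed

lemma labelled_move:
  assumes L: "labelled N s pos y \<nu> \<tau>" and i: "i \<in> {1..N}" and y': "incr N (y(\<tau> i := v))"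
  shows "labelled N s (pos(i := v)) (y(\<tau> i := v)) \<nu> \<tau>"
proof -
  have "inj \<tau>" using L permutes_inj by (auto simp: labelled_def)
  then have "\<tau> l = \<tau> i \<longleftrightarrow> l = i" for l by (simp add: inj_eq)
  then show ?thesis using L y' by (simp add: labelled_def)
qed

lemma attempt_right:
  assumes L: "labelled N s pos y \<nu> \<tau>" and i: "i \<in> {1..N}"
  defines "k \<equiv> \<tau> i"
  shows "k \<notin> adj N y \<Longrightarrow> labelled N s (attempt N s i True pos) (up y k) \<nu> \<tau>"
    "k \<in> adj N y \<Longrightarrow> \<nu> (Suc k) < \<nu> k \<Longrightarrow> labelled N s (attempt N s i True pos) y (T k \<nu>) (adjswap k \<circ> \<tau>)"
    "k \<in> adj N y \<Longrightarrow> \<nu> k \<le> \<nu> (Suc k) \<Longrightarrow> attempt N s i True pos = pos"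
proof -
  have \<tau>: "\<tau> permutes {1..N}" and y: "incr N y" and pos: "pos i = y k" "s i = \<nu> k"
    using L i by (auto simp: labelled_def k_def)
  have k: "k \<in> {1..N}" using permutes_in_image[OF \<tau>] i unfolding k_def by blast
  have ik: "i = inv \<tau> k" unfolding k_def using permutes_inverses(2)[OF \<tau>] by simp
  note mem = mem_image_succ(1)[OF y k]
  {
    assume "k \<notin> adj N y"
    then have "attempt N s i True pos = pos(i := y k + 1)" "incr N (up y k)"
      using mem incr_up_iff[OF y] unfolding attempt_def Let_def labelled_image[OF L] pos by (simp_all del: One_nat_def)
    then show "labelled N s (attempt N s i True pos) (up y k) \<nu> \<tau>"
      using labelled_move[OF L i, of "y k + 1"] by (simp add: up_def k_def)
  }
  {
    assume a: "k \<in> adj N y"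
    then have Sk: "Suc k \<in> {1..N}" and yS: "y (Suc k) = y k + 1" by (auto simp: adj_def)
    define j where "j = inv \<tau> (Suc k)"
    have j: "inv_into {1..N} pos (y k + 1) = j" "s j = \<nu> (Suc k)"
      using labelled_inv_into[OF L Sk] L yS by (auto simp: j_def labelled_def)
    have att: "attempt N s i True pos = (if \<nu> (Suc k) < \<nu> k then pos(i := y (Suc k), j := y k) else pos)"
      using mem a unfolding attempt_def Let_def labelled_image[OF L] pos by (simp add: j yS del: One_nat_def)
    show "\<nu> (Suc k) < \<nu> k \<Longrightarrow> labelled N s (attempt N s i True pos) y (T k \<nu>) (adjswap k \<circ> \<tau>)"
      unfolding att using labelled_swap[OF L a ik j_def] by simp
    show "\<nu> k \<le> \<nu> (Suc k) \<Longrightarrow> attempt N s i True pos = pos" unfolding att by simp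
  }
qed

lemma attempt_left:
  assumes L: "labelled N s pos y \<nu> \<tau>" and i: "i \<in> {1..N}"
  defines "k \<equiv> \<tau> i"
  shows "k \<notin> Suc ` adj N y \<Longrightarrow> labelled N s (attempt N s i False pos) (dn y k) \<nu> \<tau>"
    "m \<in> adj N y \<Longrightarrow> k = Suc m \<Longrightarrow> \<nu> m < \<nu> (Suc m) \<Longrightarrow> labelled N s (attempt N s i False pos) y (T m \<nu>) (adjswap m \<circ> \<tau>)"
    "m \<in> adj N y \<Longrightarrow> k = Suc m \<Longrightarrow> \<nu> (Suc m) \<le> \<nu> m \<Longrightarrow> attempt N s i False pos = pos"
proof -
  have \<tau>: "\<tau> permutes {1..N}" and y: "incr N y" and pos: "pos i = y k" "s i = \<nu> k"
    using L i by (auto simp: labelled_def k_def)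
  have k: "k \<in> {1..N}" using permutes_in_image[OF \<tau>] i unfolding k_def by blast
  have ik: "i = inv \<tau> k" unfolding k_def using permutes_inverses(2)[OF \<tau>] by simp
  note mem = mem_image_succ(2)[OF y k]
  {
    assume "k \<notin> Suc ` adj N y"
    then have "attempt N s i False pos = pos(i := y k - 1)" "incr N (dn y k)"
      using mem incr_dn_iff[OF y] unfolding attempt_def Let_def labelled_image[OF L] pos by (simp_all del: One_nat_def)
    then show "labelled N s (attempt N s i False pos) (dn y k) \<nu> \<tau>"
      using labelled_move[OF L i, of "y k - 1"] by (simp add: dn_def k_def)
  }
  {
    assume a: "m \<in> adj N y" "k = Suc m"
    then have mN: "m \<in> {1..N}" and yS: "y k - 1 = y m" by (auto simp: adj_def)
    have mem': "y m \<in> y ` {1..N}" using mN by blast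
    define j where "j = inv \<tau> m"
    have j: "inv_into {1..N} pos (y m) = j" "s j = \<nu> m"
      using labelled_inv_into[OF L mN] L by (auto simp: j_def labelled_def)
    have ij: "i \<noteq> j" unfolding ik j_def using permutes_inverses(1)[OF \<tau>] a(2) by (metis n_not_Suc_n)
    have att: "attempt N s i False pos = (if \<nu> m < \<nu> k then pos(i := y m, j := y k) else pos)"
      using mem' yS unfolding attempt_def Let_def labelled_image[OF L] pos by (simp add: j del: One_nat_def)
    show "\<nu> m < \<nu> (Suc m) \<Longrightarrow> labelled N s (attempt N s i False pos) y (T m \<nu>) (adjswap m \<circ> \<tau>)"
      unfolding att using labelled_swap[OF L a(1) j_def ik[unfolded a(2)]] a(2) ij by (simp add: fun_upd_twist)
    show "\<nu> (Suc m) \<le> \<nu> m \<Longrightarrow> attempt N s i False pos = pos" unfolding att a(2) by simp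
  }
qed

section \<open>Comparison of the two expansions\<close>

context bethe
begin

text \<open>Conditioning on the first attempt is the backward recursion, so the induction runs over
  all labelled states. Labels enter only through their ranks: reindexing the sum by \<tau> removes
  them. The case n = 0 is the initial condition.\<close>

lemma avg_eq_coef:
  assumes X: "(X, \<pi>) \<in> configurations N M" and L: "labelled N s pos y \<nu> \<tau>" and \<nu>: "\<nu> \<in> Sp"
  shows "of_real (avg N p s (\<lambda>pos. config_of N s pos = (X, \<pi>)) n pos) = coef (\<lambda>z. energy N z ^ n) N (site X) y \<nu> \<pi>"
  using L \<nu>
proof (induction n arbitrary: pos y \<nu> \<tau>)
  case 0
  note X' = configurations_site[OF X]
  have y: "incr N y" using 0 by (simp add: labelled_def)
  have "y ` {1..N} = X \<longleftrightarrow> (\<forall>i\<in>{1..N}. site X i = y i)"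
  proof
    assume "y ` {1..N} = X"
    then show "\<forall>i\<in>{1..N}. site X i = y i" using site_image[OF y] by auto
  next
    assume "\<forall>i\<in>{1..N}. site X i = y i"
    then have "y ` {1..N} = site X ` {1..N}" by (intro image_cong) auto
    then show "y ` {1..N} = X" using X'(2) by simp
  qed
  then show ?case
    unfolding avg.simps power_0 config_of_labelled[OF 0] initial_condition[OF X'(1) y 0(2) X'(3)]
    by (auto simp del: atLeastAtMost_iff One_nat_def)
next
  case (Suc n)
  note X' = configurations_site[OF X]
  define F where "F = (\<lambda>y \<nu>. coef (\<lambda>z. energy N z ^ n) N (site X) y \<nu> \<pi>)"
  let ?avg = "\<lambda>pos. complex_of_real (avg N p s (\<lambda>pos. config_of N s pos = (X, \<pi>)) n pos)"
  have y: "incr N y" and \<tau>: "\<tau> permutes {1..N}" using Suc.prems by (auto simp: labelled_def)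
  have IH: "?avg pos = F y \<nu>" if "labelled N s pos y \<nu> \<tau>" "\<nu> \<in> Sp" for pos y \<nu> \<tau>
    unfolding F_def using Suc.IH[OF that] .
  have adjN: "1 \<le> k" "k < N" if "k \<in> adj N y" for k using that by (auto simp: adj_def)
  \<comment> \<open>\<open>G k\<close> is the outcome of the right attempt of rank k across the pair
    (k, k + 1), and \<open>H k\<close> that of the left attempt of rank k + 1 across the same pair,
    hence \<open>H (k - 1)\<close> for rank k below. Together, pG + qH is the identity plus the
    transposed Hecke operator.\<close>
  define G where "G k = (if \<nu> (Suc k) < \<nu> k then F y (T k \<nu>) else F y \<nu>)" for k
  define H where "H k = (if \<nu> k < \<nu> (Suc k) then F y (T k \<nu>) else F y \<nu>)" for k
  have right: "?avg (attempt N s i True pos) = (if \<tau> i \<in> adj N y then G (\<tau> i) else F (up y (\<tau> i)) \<nu>)" if i: "i \<in> {1..N}" for i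
    using IH[OF attempt_right(1)[OF Suc.prems(1) i] Suc.prems(2)]
      IH[OF attempt_right(2)[OF Suc.prems(1) i] T_Sp[OF Suc.prems(2) adjN]]
      IH[OF Suc.prems] attempt_right(3)[OF Suc.prems(1) i]
    unfolding G_def by (cases "\<tau> i \<in> adj N y"; cases "\<nu> (Suc (\<tau> i)) < \<nu> (\<tau> i)") (simp_all del: One_nat_def)
  have left: "?avg (attempt N s i False pos) = (if \<tau> i \<in> Suc ` adj N y then H (\<tau> i - 1) else F (dn y (\<tau> i)) \<nu>)" if i: "i \<in> {1..N}" for i
  proof (cases "\<tau> i \<in> Suc ` adj N y")
    case True
    then obtain m where m: "m \<in> adj N y" "\<tau> i = Suc m" by blast
    show ?thesis
    proof (cases "\<nu> m < \<nu> (Suc m)")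
      case less: True
      show ?thesis
        using IH[OF attempt_left(2)[OF Suc.prems(1) i m less] T_Sp[OF Suc.prems(2) adjN[OF m(1)]]] True less m
        by (simp add: H_def)
    next
      case False
      then show ?thesis
        using IH[OF Suc.prems] attempt_left(3)[OF Suc.prems(1) i m] True m by (simp add: H_def)
    qed
  next
    case False
    then show ?thesis using IH[OF attempt_left(1)[OF Suc.prems(1) i False] Suc.prems(2)] by simp
  qed
  define g where "g k = of_real p * (if k \<in> adj N y then G k else F (up y k) \<nu>)
      + of_real q * (if k \<in> Suc ` adj N y then H (k - 1) else F (dn y k) \<nu>)" for k
  have q: "1 - p = q" using pq by simp
  have "complex_of_real (avg N p s (\<lambda>pos. config_of N s pos = (X, \<pi>)) (Suc n) pos)
    = (\<Sum>i\<in>{1..N}. of_real p * ?avg (attempt N s i True pos) + of_real q * ?avg (attempt N s i False pos))"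
    unfolding avg.simps q by simp
  also have "\<dots> = (\<Sum>i\<in>{1..N}. g (\<tau> i))"
    by (rule sum.cong[OF refl]) (simp only: right left g_def)
  also have "\<dots> = (\<Sum>k\<in>{1..N}. g k)"
    using sum.permute[OF \<tau>, of g] by (simp add: comp_def)
  also have "\<dots> = backward N F y \<nu>"
  proof -
    have fin: "finite (adj N y)" "adj N y \<subseteq> {1..N}" "Suc ` adj N y \<subseteq> {1..N}" by (auto simp: adj_def)
    have "(\<Sum>k\<in>{1..N}. g k) = (\<Sum>k\<in>{1..N}. ((if incr N (dn y k) then of_real q * F (dn y k) \<nu> else 0)
        + (if incr N (up y k) then of_real p * F (up y k) \<nu> else 0))
      + ((if k \<in> adj N y then of_real p * G k else 0) + (if k \<in> Suc ` adj N y then of_real q * H (k - 1) else 0)))"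
      by (rule sum.cong[OF refl]) (simp add: g_def incr_up_iff[OF y] incr_dn_iff[OF y])
    also have "\<dots> = (\<Sum>k\<in>{1..N}. (if incr N (dn y k) then of_real q * F (dn y k) \<nu> else 0)
        + (if incr N (up y k) then of_real p * F (up y k) \<nu> else 0))
      + ((\<Sum>k\<in>{1..N}. if k \<in> adj N y then of_real p * G k else 0) + (\<Sum>k\<in>{1..N}. if k \<in> Suc ` adj N y then of_real q * H (k - 1) else 0))"
      by (simp only: sum.distrib)
    also have "(\<Sum>k\<in>{1..N}. if k \<in> adj N y then of_real p * G k else 0) = (\<Sum>k\<in>adj N y. of_real p * G k)"
      using fin by (subst sum.inter_restrict[symmetric]) (auto simp: Int_absorb1)
    also have "(\<Sum>k\<in>{1..N}. if k \<in> Suc ` adj N y then of_real q * H (k - 1) else 0) = (\<Sum>k\<in>Suc ` adj N y. of_real q * H (k - 1))"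
      using fin by (subst sum.inter_restrict[symmetric]) (auto simp: Int_absorb1)
    also have "\<dots> = (\<Sum>k\<in>adj N y. of_real q * H k)" by (subst sum.reindex) auto
    also have "(\<Sum>k\<in>adj N y. of_real p * G k) + (\<Sum>k\<in>adj N y. of_real q * H k) = (\<Sum>k\<in>adj N y. F y \<nu> + hkT k (F y) \<nu>)"
      unfolding sum.distrib[symmetric]
    proof (rule sum.cong[OF refl])
      fix k
      have Q: "complex_of_real q = 1 - of_real p" using pqC by (simp add: algebra_simps)
      show "of_real p * G k + of_real q * H k = F y \<nu> + hkT k (F y) \<nu>"
        unfolding G_def H_def hecke_transpose_def Q by (auto simp: algebra_simps)
    qed
    finally show ?thesis unfolding backward_def .
  qed
  also have "\<dots> = coef (\<lambda>z. energy N z ^ Suc n) N (site X) y \<nu> \<pi>"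
    unfolding F_def using coef_backward_power[OF y Suc.prems(2) X'(3)] by simp
  finally show ?case .
qed

lemma asep_prob_eq:
  assumes "(X, \<pi>) \<in> configurations N M" "(Y, \<nu>) \<in> configurations N M" "t \<ge> 0"
  shows "complex_of_real (asep_prob N p (Y, \<nu>) (X, \<pi>) t) =
    (\<Sum>\<sigma> | \<sigma> permutes {1..N}. 1 / (2 * complex_of_real pi * \<i>) ^ N *
      torus_integral r N (\<lambda>\<xi>. amp \<nu> \<sigma> \<pi> \<xi> * (\<Prod>i = 1..N. \<xi> (\<sigma> i) powi site X i) *
        (\<Prod>i = 1..N. \<xi> i powi (- site Y i - 1) * exp (\<epsilon> p q (\<xi> i) * complex_of_real t))) (\<lambda>_. 0))"
proof -
  note X = configurations_site[OF assms(1)] and Y = configurations_site[OF assms(2)]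
  have L: "labelled N \<nu> (site Y) (site Y) \<nu> id"
    using Y(1) permutes_id by (simp add: labelled_def)
  have "0 \<le> p" "p \<le> 1" using p_pos q_nonneg pq by auto
  from positions_prob_sums[OF assms(3) this, of N \<nu> "\<lambda>pos. config_of N \<nu> pos = (X, \<pi>)" "site Y"]
  have "(\<lambda>n. exp (- real N * t) * (t ^ n / fact n) * avg N p \<nu> (\<lambda>pos. config_of N \<nu> pos = (X, \<pi>)) n (site Y)) sums
    asep_prob N p (Y, \<nu>) (X, \<pi>) t"
    unfolding asep_prob_def by simp
  from sums_of_real[OF this, where 'a = complex]
  have "(\<lambda>n. exp (- real N * t) * (t ^ n / fact n) * coef (\<lambda>z. energy N z ^ n) N (site X) (site Y) \<nu> \<pi>) sums
    complex_of_real (asep_prob N p (Y, \<nu>) (X, \<pi>) t)"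
    by (simp add: avg_eq_coef[OF assms(1) L Y(3)] exp_of_real del: One_nat_def)
  from sums_unique2[OF this integral_formula[OF Y(3) X(3)]] show ?thesis .
qed

end

theorem mainTheorem1:
  fixes N M :: nat and p q :: real and Y :: "int set" and \<nu> :: "nat \<Rightarrow> nat"
  assumes "N \<ge> 1" and "M \<ge> 1"
    and "p \<ge> 0" and "q \<ge> 0" and "p + q = 1" and "p \<noteq> 0"
    and "(Y, \<nu>) \<in> configurations N M"
  shows "(\<exists>!h. is_h_family N M p q \<nu> h) \<and>
    (\<forall>h. is_h_family N M p q \<nu> h \<longrightarrow>
      (\<exists>r\<^sub>0 > 0. \<forall>r. 0 < r \<and> r < r\<^sub>0 \<longrightarrow>
        (\<forall>\<xi> \<in> cball 0 r. \<forall>\<xi>' \<in> cball 0 r.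
           complex_of_real p + complex_of_real q * \<xi> * \<xi>' - \<xi>' \<noteq> 0) \<and>
        (\<forall>t \<ge> 0. \<forall>X \<pi>. (X, \<pi>) \<in> configurations N M \<longrightarrow>
           complex_of_real (asep_prob N p (Y, \<nu>) (X, \<pi>) t) =
             (\<Sum>\<sigma> | \<sigma> permutes {1..N}.
                1 / (2 * complex_of_real pi * \<i>) ^ N *
                torus_integral r N
                  (\<lambda>\<xi>. ratfun_eval (h \<sigma> \<pi> * A_coeff p q N \<sigma>) \<xi> *
                       (\<Prod>i = 1..N. \<xi> (\<sigma> i) powi site X i) *
                       (\<Prod>i = 1..N. \<xi> i powi (- site Y i - 1) * exp (\<epsilon> p q (\<xi> i) * complex_of_real t)))
                  (\<lambda>_. 0)))))"
proof (intro conjI allI impI)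
  show "\<exists>!h. is_h_family N M p q \<nu> h"
    using h_family_exists[OF assms(5,6)] h_family_unique by metis
  fix h assume h: "is_h_family N M p q \<nu> h"
  \<comment> \<open>The locale asks for amplitudes of every initial species, so a family is chosen
    for each of them; uniqueness identifies the one of \<nu> with the given h.\<close>
  define family where "family \<mu> = (SOME h. is_h_family N M p q \<mu> h)" for \<mu>
  have family: "is_h_family N M p q \<mu> (family \<mu>)" for \<mu>
    unfolding family_def using h_family_exists[OF assms(5,6)] by (metis someI)
  have "family \<nu> = h" by (rule h_family_unique[OF family h])
  show "\<exists>r\<^sub>0>0. \<forall>r. 0 < r \<and> r < r\<^sub>0 \<longrightarrow>
        (\<forall>\<xi> \<in> cball 0 r. \<forall>\<xi>' \<in> cball 0 r.
           complex_of_real p + complex_of_real q * \<xi> * \<xi>' - \<xi>' \<noteq> 0) \<and>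
        (\<forall>t \<ge> 0. \<forall>X \<pi>. (X, \<pi>) \<in> configurations N M \<longrightarrow>
           complex_of_real (asep_prob N p (Y, \<nu>) (X, \<pi>) t) =
             (\<Sum>\<sigma> | \<sigma> permutes {1..N}.
                1 / (2 * complex_of_real pi * \<i>) ^ N *
                torus_integral r N
                  (\<lambda>\<xi>. ratfun_eval (h \<sigma> \<pi> * A_coeff p q N \<sigma>) \<xi> *
                       (\<Prod>i = 1..N. \<xi> (\<sigma> i) powi site X i) *
                       (\<Prod>i = 1..N. \<xi> i powi (- site Y i - 1) * exp (\<epsilon> p q (\<xi> i) * complex_of_real t)))
                  (\<lambda>_. 0)))"
  proof (rule exI[of _ "p / 4"], intro conjI allI impI ballI)
    show "0 < p / 4" using assms(3,6) by simp
    fix r assume r: "0 < r \<and> r < p / 4"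
    show "complex_of_real p + complex_of_real q * \<xi> * \<xi>' - \<xi>' \<noteq> 0" if "\<xi> \<in> cball 0 r" "\<xi>' \<in> cball 0 r" for \<xi> \<xi>'
      using that r assms(3-6) by (intro S_den_val_nonzero) auto
    interpret bethe N r M p q "\<lambda>\<mu>. amplitude p q N (family \<mu>)"
    proof
      show "amplitude p q N (family \<mu>) id \<pi> z = (if \<pi> = \<mu> then 1 else 0)"
        if "\<mu> \<in> {1..N} \<rightarrow>\<^sub>E {1..M}" "\<pi> \<in> {1..N} \<rightarrow>\<^sub>E {1..M}" for \<mu> \<pi> z
        by (rule amplitude_id[OF family that(2)])
      show "amplitude p q N (family \<mu>) (T i \<sigma>) \<pi> z =
          S_val p q (z (\<sigma> (Suc i))) (z (\<sigma> i)) * amplitude p q N (family \<mu>) \<sigma> \<pi> z +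
          (1 + S_val p q (z (\<sigma> (Suc i))) (z (\<sigma> i))) *
            hecke (of_real p) (of_real q) i (\<lambda>\<pi>. amplitude p q N (family \<mu>) \<sigma> \<pi> z) \<pi>"
        if "\<pi> \<in> {1..N} \<rightarrow>\<^sub>E {1..M}" "z \<in> polydisc N (p / 4)" "\<sigma> permutes {1..N}" "1 \<le> i" "i < N" for \<mu> \<sigma> \<pi> i z
        by (rule amplitude_T[OF family assms(3-6) that(2,3,1,4,5)])
    qed (use r assms(3-6) in auto)
    fix t :: real and X \<pi> assume "0 \<le> t" "(X, \<pi>) \<in> configurations N M"
    from asep_prob_eq[OF this(2) assms(7) this(1)]
    show "complex_of_real (asep_prob N p (Y, \<nu>) (X, \<pi>) t) =
             (\<Sum>\<sigma> | \<sigma> permutes {1..N}.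
                1 / (2 * complex_of_real pi * \<i>) ^ N *
                torus_integral r N
                  (\<lambda>\<xi>. ratfun_eval (h \<sigma> \<pi> * A_coeff p q N \<sigma>) \<xi> *
                       (\<Prod>i = 1..N. \<xi> (\<sigma> i) powi site X i) *
                       (\<Prod>i = 1..N. \<xi> i powi (- site Y i - 1) * exp (\<epsilon> p q (\<xi> i) * complex_of_real t)))
                  (\<lambda>_. 0))"
      unfolding amplitude_def \<open>family \<nu> = h\<close> .
  qed
qed

end
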